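(* Let $\{(N_k,B_k)\}_{k=1}^m$ be finitely many admissible pairs in $\mathbb{R}$ and let $\mathbf n=\{n_k\}_{k=1}^\infty$ be a sequence of positive integers. Assume that $B_k=\{0,1,\dots,b_k-1\}$ with $b_k\in\mathbb{N}_+$ for each $1\le k\le m$. Let $\Omega=\{1,\dots,m\}^\infty$, and for $\omega=\omega_1\omega_2\cdots\in\Omega$ let $$\mu^{\mathbf n}(\omega)=\delta_{N_{\omega_1}^{-n_1}B_{\omega_1}}*\delta_{N_{\omega_1}^{-n_1}N_{\omega_2}^{-n_2}B_{\omega_2}}*\cdots,\qquad \mu(\omega)=\delta_{N_{\omega_1}^{-1}B_{\omega_1}}*\delta_{N_{\omega_1}^{-1}N_{\omega_2}^{-1}B_{\omega_2}}*\cdots,$$ and $$\mathcal{E}_\omega=\{t\in\mathbb{N}_+:\gcd(t,b_{\omega_k})=1\text{ for all }k\in\mathbb{N}_+\}.$$ Then for every $\omega\in\Omega$ such that $\mu(\omega)$ is non-degenerate: (1) $\mu^{\mathbf n}(\omega)$ is a spectral measure; (2) $\mathcal{E}_\omega$ is precisely the set of all positive integer spectral eigenvalues of $\mu^{\mathbf n}(\omega)$. Furthermore, there exist uncountably many subsets $\Lambda_\omega\subseteq\mathbb{Z}$ such that $t\Lambda_\omega$ is a spectrum of $\mu^{\mathbf n}(\omega)$ for every $t\in\mathcal{E}_\omega$.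
   Context: For a nonempty finite $D\subset\mathbb{R}$, $\delta_D=\frac{1}{\#D}\sum_{a\in D}\delta_a$. Infinite convolutions are weak limits of the corresponding finite convolutions; those above exist for every $\omega\in\Omega$. Admissible pair: an integer $N\ge2$ and a finite $B\subset\mathbb{Z}$ with $\#B\ge2$ form an admissible pair $(N,B)$ if there is $L\subset\mathbb{Z}$ such that the matrix $\left[\frac{1}{\sqrt{\#B}}e^{-2\pi i bl/N}\right]_{b\in B,\,l\in L}$ is unitary. Non-degenerate: for $k\ge1$ put $\nu_{>k}(\omega)=\delta_{N_{\omega_{k+1}}^{-1}B_{\omega_{k+1}}}*\delta_{(N_{\omega_{k+1}}N_{\omega_{k+2}})^{-1}B_{\omega_{k+2}}}*\cdots$. $\mu(\omega)$ is non-degenerate if some subsequence $\{\nu_{>k_j}(\omega)\}_{j=1}^\infty$ converges weakly to a measure singular to Lebesgue measure. Spectrality: a Borel probability measure $\mu$ on $\mathbb{R}$ is a spectral measure if there is a countable $\Lambda\subset\mathbb{R}$ (a spectrum of $\mu$) such that $\{e^{-2\pi i\lambda x}:\lambda\in\Lambda\}$ is an orthonormal basis of $L^2(\mu)$. A real $t\ne0$ is a spectral eigenvalue of $\mu$ if there is $\Lambda\subset\mathbb{R}$ such that both $\Lambda$ and $t\Lambda$ are spectra of $\mu$. *)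

theory Defs
  imports "HOL-Probability.Probability"
begin

definition unitary_matrix_on :: "'i set \<Rightarrow> 'j set \<Rightarrow> ('i \<Rightarrow> 'j \<Rightarrow> complex) \<Rightarrow> bool" where
  "unitary_matrix_on I J M \<longleftrightarrow>
     finite I \<and> finite J \<and>
     (\<forall>i\<in>I. \<forall>i'\<in>I. (\<Sum>j\<in>J. M i j * cnj (M i' j)) = (if i = i' then 1 else 0)) \<and>
     (\<forall>j\<in>J. \<forall>j'\<in>J. (\<Sum>i\<in>I. cnj (M i j) * M i j') = (if j = j' then 1 else 0))"

definition admissible_pair :: "int \<Rightarrow> int set \<Rightarrow> bool" where
  "admissible_pair N B \<longleftrightarrow>
     2 \<le> N \<and> finite B \<and> 2 \<le> card B \<and>
     (\<exists>L :: int set. unitary_matrix_on B L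
        (\<lambda>b l. of_real (1 / sqrt (real (card B))) *
               cis (- 2 * pi * real_of_int b * real_of_int l / real_of_int N)))"

text \<open>Intended for finite nonempty \<open>D\<close> only; \<open>measure_unif_meas\<close> below gives the
  explicit formula.\<close>

definition unif_meas :: "real set \<Rightarrow> real measure" where
  "unif_meas D = distr (measure_pmf (pmf_of_set D)) borel (\<lambda>x. x)"

text \<open>The sequence of digit sets is indexed from \<open>1\<close>; the value at \<open>0\<close> is never used.\<close>

primrec fin_conv :: "(nat \<Rightarrow> real set) \<Rightarrow> nat \<Rightarrow> real measure" where
  "fin_conv D 0 = return borel 0"
| "fin_conv D (Suc k) = (fin_conv D k \<star> unif_meas (D (Suc k)))"

text \<open>The weak limit of the finite convolutions. It is unique whenever it exists
  (\<open>inf_conv_eqI\<close> below) and unspecified otherwise.\<close>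

definition inf_conv :: "(nat \<Rightarrow> real set) \<Rightarrow> real measure" where
  "inf_conv D = (THE M. real_distribution M \<and> weak_conv_m (fin_conv D) M)"

definition digit_set ::
  "(nat \<Rightarrow> int) \<Rightarrow> (nat \<Rightarrow> int set) \<Rightarrow> (nat \<Rightarrow> nat) \<Rightarrow> (nat \<Rightarrow> nat) \<Rightarrow> nat \<Rightarrow> real set" where
  "digit_set N B n \<omega> k =
     (\<lambda>d. (\<Prod>i=1..k. inverse (real_of_int (N (\<omega> i)) ^ n i)) * real_of_int d) ` B (\<omega> k)"

definition mu_n ::
  "(nat \<Rightarrow> int) \<Rightarrow> (nat \<Rightarrow> int set) \<Rightarrow> (nat \<Rightarrow> nat) \<Rightarrow> (nat \<Rightarrow> nat) \<Rightarrow> real measure" where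
  "mu_n N B n \<omega> = inf_conv (digit_set N B n \<omega>)"

definition mu :: "(nat \<Rightarrow> int) \<Rightarrow> (nat \<Rightarrow> int set) \<Rightarrow> (nat \<Rightarrow> nat) \<Rightarrow> real measure" where
  "mu N B \<omega> = mu_n N B (\<lambda>_. 1) \<omega>"

definition nu_tail ::
  "(nat \<Rightarrow> int) \<Rightarrow> (nat \<Rightarrow> int set) \<Rightarrow> (nat \<Rightarrow> nat) \<Rightarrow> nat \<Rightarrow> real measure" where
  "nu_tail N B \<omega> k = mu N B (\<lambda>i. \<omega> (k + i))"

definition singular_to :: "real measure \<Rightarrow> real measure \<Rightarrow> bool" where
  "singular_to M M' \<longleftrightarrow> (\<exists>A\<in>sets borel. emeasure M A = 0 \<and> emeasure M' (UNIV - A) = 0)"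

text \<open>Non-degeneracy of \<open>mu N B \<omega>\<close>; it depends on the sequence \<open>\<omega>\<close>, not just on the measure.\<close>

definition non_degenerate :: "(nat \<Rightarrow> int) \<Rightarrow> (nat \<Rightarrow> int set) \<Rightarrow> (nat \<Rightarrow> nat) \<Rightarrow> bool" where
  "non_degenerate N B \<omega> \<longleftrightarrow>
     (\<exists>\<kappa> \<nu>. strict_mono \<kappa> \<and> (\<forall>j. 1 \<le> \<kappa> j) \<and> real_distribution \<nu> \<and>
        weak_conv_m (\<lambda>j. nu_tail N B \<omega> (\<kappa> j)) \<nu> \<and> singular_to \<nu> lborel)"

definition in_L2 :: "real measure \<Rightarrow> (real \<Rightarrow> complex) \<Rightarrow> bool" where
  "in_L2 M f \<longleftrightarrow> f \<in> borel_measurable M \<and> integrable M (\<lambda>x. (cmod (f x))\<^sup>2)"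

definition inner_L2 :: "real measure \<Rightarrow> (real \<Rightarrow> complex) \<Rightarrow> (real \<Rightarrow> complex) \<Rightarrow> complex" where
  "inner_L2 M f g = (\<integral>x. f x * cnj (g x) \<partial>M)"

definition norm_L2 :: "real measure \<Rightarrow> (real \<Rightarrow> complex) \<Rightarrow> real" where
  "norm_L2 M f = sqrt (\<integral>x. (cmod (f x))\<^sup>2 \<partial>M)"

text \<open>The basis is an indexed family, so distinct indices must give orthogonal functions;
  completeness is density of the finite linear combinations.\<close>

definition orthonormal_basis_L2 ::
  "real measure \<Rightarrow> 'i set \<Rightarrow> ('i \<Rightarrow> real \<Rightarrow> complex) \<Rightarrow> bool" where
  "orthonormal_basis_L2 M I e \<longleftrightarrow>
     (\<forall>i\<in>I. in_L2 M (e i)) \<and>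
     (\<forall>i\<in>I. \<forall>j\<in>I. inner_L2 M (e i) (e j) = (if i = j then 1 else 0)) \<and>
     (\<forall>f. in_L2 M f \<longrightarrow> (\<forall>\<epsilon>>0. \<exists>F c. finite F \<and> F \<subseteq> I \<and>
        norm_L2 M (\<lambda>x. f x - (\<Sum>i\<in>F. c i * e i x)) < \<epsilon>))"

definition is_spectrum :: "real measure \<Rightarrow> real set \<Rightarrow> bool" where
  "is_spectrum M \<Lambda> \<longleftrightarrow>
     countable \<Lambda> \<and> orthonormal_basis_L2 M \<Lambda> (\<lambda>l x. cis (- 2 * pi * l * x))"

definition spectral_measure :: "real measure \<Rightarrow> bool" where
  "spectral_measure M \<longleftrightarrow> real_distribution M \<and> (\<exists>\<Lambda>. is_spectrum M \<Lambda>)"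

definition spectral_eigenvalue :: "real measure \<Rightarrow> real \<Rightarrow> bool" where
  "spectral_eigenvalue M t \<longleftrightarrow>
     t \<noteq> 0 \<and> (\<exists>\<Lambda>. is_spectrum M \<Lambda> \<and> is_spectrum M ((\<lambda>l. t * l) ` \<Lambda>))"

text \<open>Sequences are indexed from \<open>1\<close>; the entry at \<open>0\<close> is unconstrained and irrelevant.\<close>

definition Omega :: "nat \<Rightarrow> (nat \<Rightarrow> nat) set" where
  "Omega m = {\<omega>. \<forall>k\<ge>1. \<omega> k \<in> {1..m}}"

definition E_set :: "(nat \<Rightarrow> nat) \<Rightarrow> (nat \<Rightarrow> nat) \<Rightarrow> nat set" where
  "E_set b \<omega> = {t. 1 \<le> t \<and> (\<forall>k\<ge>1. gcd t (b (\<omega> k)) = 1)}"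

lemma measure_unif_meas:
  assumes "finite D" "D \<noteq> {}" "A \<in> sets borel"
  shows "measure (unif_meas D) A = real (card (D \<inter> A)) / real (card D)"
  using assms by (simp add: unif_meas_def measure_distr measure_pmf_of_set)

lemma real_distribution_unif_meas: "real_distribution (unif_meas D)"
  unfolding real_distribution_def real_distribution_axioms_def unif_meas_def
  by (auto intro!: prob_space.prob_space_distr measure_pmf.prob_space_axioms)

lemma real_distribution_fin_conv: "real_distribution (fin_conv D k)"
proof (induction k)
  case 0
  show ?case
    by (simp add: real_distribution_def real_distribution_axioms_def prob_space_return)
next
  case (Suc k)
  interpret A: real_distribution "fin_conv D k" by fact
  interpret B: real_distribution "unif_meas (D (Suc k))" by (rule real_distribution_unif_meas)
  interpret P: pair_prob_space "fin_conv D k" "unif_meas (D (Suc k))" ..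
  have "prob_space (fin_conv D k \<star> unif_meas (D (Suc k)))"
    unfolding convolution_def by (rule P.prob_space_distr) (simp add: split_beta')
  then show ?case
    by (simp add: real_distribution_def real_distribution_axioms_def)
qed

lemma inf_conv_eqI:
  assumes "real_distribution M" "weak_conv_m (fin_conv D) M"
  shows "inf_conv D = M"
  unfolding inf_conv_def
proof (rule the_equality)
  fix M' assume M': "real_distribution M' \<and> weak_conv_m (fin_conv D) M'"
  have "char M' t = char M t" for t
    by (rule LIMSEQ_unique[OF levy_continuity1 levy_continuity1])
      (use assms M' real_distribution_fin_conv in auto)
  then show "M' = M"
    using M' assms(1) by (intro Levy_uniqueness) auto
qed (use assms in auto)

end

theory Submission
  imports Defs
begin

text \<open>
  Admissibility of \<open>(N, {0..<b})\<close> means \<open>b dvd N\<close>, so with \<open>M\<^sub>i\<close> the \<open>i\<close>-th base,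
  \<open>P\<^sub>i = M\<^sub>0 \<dots> M\<^sub>i\<^sub>-\<^sub>1\<close> and \<open>r\<^sub>i = M\<^sub>i / b\<^sub>i\<close> the zeros of the Fourier transform are the
  integers \<open>P\<^sub>i r\<^sub>i d\<close> with \<open>\<not> b\<^sub>i dvd d\<close>. If \<open>r\<^sub>i = 1\<close> from some index on, all late tails are
  uniform on the unit interval; so non-degeneracy gives \<open>r\<^sub>i \<ge> 2\<close> infinitely often.

  For \<open>t\<close> coprime to all \<open>b\<^sub>i\<close>, every progression \<open>a + t\<int>\<close> then contains a point where the transform
  is bounded below, uniformly in \<open>a\<close> and along all tails. A set \<open>\<Lambda>\<close> is built level by level, its new
  elements being shifted by multiples of \<open>P\<^sub>k\<^sub>+\<^sub>1\<close> to such points for one multiplier \<open>t\<close> at a time. A long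
  block of levels devoted to \<open>t\<close> contracts the Parseval defect of \<open>t\<Lambda>\<close> by a factor
  depending only on \<open>t\<close>, and each \<open>t\<close> gets infinitely many blocks. One free binary choice
  per block gives uncountably many \<open>\<Lambda>\<close>.

  Conversely, let \<open>k\<close> be the first level with \<open>g = gcd t b\<^sub>k > 1\<close> and split off from the measure a factor
  uniform on \<open>g\<close> points at this level. If \<open>\<Lambda>\<close> and \<open>t\<Lambda>\<close> are spectra, \<open>t\<Lambda>\<close> is
  orthogonal for the remaining factor, and Bessel's inequality there contradicts Parseval's identity.
\<close>

section \<open>Masks of digit sets\<close>

text \<open>A multiplier \<open>t\<close> is coprime to the \<open>b i\<close> but may share factors
  with the ratios \<open>M i / b i\<close>. Hence shifts by multiples of \<open>t\<close> need not
  reach a prescribed residue, and the lower bound obtained depends on \<open>t\<close>; no single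
  choice of representatives is made to serve all multipliers with one constant. The construction
  works because two properties separate. The Parseval identity for the first \<open>k\<close> levels
  holds for every multiplier at once and ignores shifts by multiples of the base product, by
  periodicity. Only the comparison of the full transform with its first levels depends on the
  shifts, and this is arranged for one \<open>t\<close> per block. Blocks serving other multipliers
  do no harm, because the Parseval sums of \<open>t\<close> times the growing set only increase and
  never exceed 1. All lower bounds are uniform over digit sequences, so no limit of tails has to be
  taken. The exponents enter only through the bases \<open>N ^ n\<close>, which can only enlarge the
  ratios; so non-degeneracy, a statement about exponents 1, carries over.\<close>

lemma cis_int: "y \<in> \<int> \<Longrightarrow> cis (2 * pi * y) = 1"
  by (rule cis_multiple_2pi) auto

lemma cis_eq_1_iff: "cis (2 * pi * y) = 1 \<longleftrightarrow> y \<in> \<int>"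
proof
  assume "cis (2 * pi * y) = 1"
  then have "cos (2 * pi * y) = 1" by (simp add: complex_eq_iff)
  then obtain n :: int where "2 * pi * y = of_int n * 2 * pi"
    by (auto simp: cos_one_2pi_int)
  then show "y \<in> \<int>" by auto
qed (rule cis_int)

lemma cmod_cis_minus_1: "cmod (cis x - 1) = 2 * \<bar>sin (x / 2)\<bar>"
proof -
  have "cos x = 1 - 2 * (sin (x / 2))\<^sup>2"
    using cos_double_sin[of "x / 2"] by simp
  moreover have "(cmod (cis x - 1))\<^sup>2 = 2 - 2 * cos x"
  proof -
    have "(cmod (cis x - 1))\<^sup>2 = ((cos x)\<^sup>2 + (sin x)\<^sup>2) + 1 - 2 * cos x"
      unfolding cmod_power2 by (simp add: power2_eq_square algebra_simps)
    then show ?thesis by (simp only: sin_cos_squared_add2)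
  qed
  ultimately have "(cmod (cis x - 1))\<^sup>2 = (2 * \<bar>sin (x / 2)\<bar>)\<^sup>2"
    by (simp add: power_mult_distrib)
  then show ?thesis
    by (subst (asm) power2_eq_iff_nonneg) auto
qed

lemma cmod_cis_minus_1_le: "cmod (cis x - 1) \<le> \<bar>x\<bar>"
  using abs_sin_x_le_abs_x[of "x / 2"] by (simp add: cmod_cis_minus_1)

text \<open>The mask of the digits \<open>{0..<b}\<close>, that is, the Fourier transform of the
  uniform measure on them (up to a phase, a normalised Dirichlet kernel).\<close>

definition dmask :: "nat \<Rightarrow> real \<Rightarrow> complex" where
  "dmask b y = (\<Sum>d<b. cis (2 * pi * real d * y)) / of_nat b"

text \<open>Stated without division, so that it also covers integer \<open>y\<close>, where the
  ratio of the geometric sum is 1.\<close>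

lemma dmask_geometric:
  "of_nat b * dmask b y * (cis (2 * pi * y) - 1) = cis (2 * pi * (real b * y)) - 1"
proof (cases "b = 0")
  case False
  have "of_nat b * dmask b y = (\<Sum>d<b. cis (2 * pi * y) ^ d)"
  proof -
    have "cis (2 * pi * real d * y) = cis (2 * pi * y) ^ d" for d
      by (simp only: Complex.DeMoivre mult_ac)
    then show ?thesis using False by (simp add: dmask_def)
  qed
  then show ?thesis
    using power_diff_1_eq[of "cis (2 * pi * y)" b] by (simp add: Complex.DeMoivre mult_ac)
qed simp

lemma dmask_int: "y \<in> \<int> \<Longrightarrow> 1 \<le> b \<Longrightarrow> dmask b y = 1"
proof -
  assume y: "y \<in> \<int>" "1 \<le> b"
  have "cis (2 * pi * real d * y) = 1" for d
    using cis_int[of "real d * y"] y by (simp add: mult.assoc)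
  then show ?thesis using y by (simp add: dmask_def)
qed

lemma dmask_add_int: "z \<in> \<int> \<Longrightarrow> dmask b (y + z) = dmask b y"
proof -
  assume z: "z \<in> \<int>"
  have "cis (2 * pi * real d * (y + z)) = cis (2 * pi * real d * y)" for d
    using cis_int[of "real d * z"] z
    by (simp add: distrib_left mult.assoc flip: cis_mult)
  then show ?thesis by (simp add: dmask_def)
qed

lemma dmask_eq_0_iff:
  assumes "1 \<le> b"
  shows "dmask b y = 0 \<longleftrightarrow> real b * y \<in> \<int> \<and> y \<notin> \<int>"
proof (cases "y \<in> \<int>")
  case True
  then show ?thesis using dmask_int[OF True assms] by simp
next
  case False
  then have "cis (2 * pi * y) - 1 \<noteq> 0" by (simp add: cis_eq_1_iff)
  then have "dmask b y = 0 \<longleftrightarrow> cis (2 * pi * (real b * y)) - 1 = 0"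
    using dmask_geometric[of b y] assms by auto
  then show ?thesis using False cis_eq_1_iff[of "real b * y"] by simp
qed

lemma cmod_dmask_le_1: "cmod (dmask b y) \<le> 1"
proof -
  have "cmod (\<Sum>d<b. cis (2 * pi * real d * y)) \<le> real b"
    by (rule order_trans[OF norm_sum]) simp
  then show ?thesis
    by (cases "b = 0") (auto simp: dmask_def norm_divide)
qed

text \<open>The product \<open>b * y\<close> is kept together because level \<open>i\<close> is
  evaluated at \<open>x / base_prod M (Suc i)\<close> and \<open>b i \<le> M i\<close>: the bound
  becomes a multiple of \<open>x / base_prod M i\<close>, summable with a constant independent of
  the digit sequence.\<close>

lemma cmod_dmask_minus_1:
  assumes "1 \<le> b"
  shows "cmod (dmask b y - 1) \<le> 2 * pi * (real b * \<bar>y\<bar>)"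
proof -
  have "dmask b y - 1 = (\<Sum>d<b. cis (2 * pi * real d * y) - 1) / of_nat b"
    using assms by (simp add: dmask_def sum_subtractf diff_divide_distrib)
  also have "cmod \<dots> \<le> (\<Sum>d<b. 2 * pi * (real b * \<bar>y\<bar>)) / real b"
    unfolding norm_divide norm_of_nat
  proof (intro divide_right_mono order_trans[OF norm_sum] sum_mono)
    fix d assume d: "d \<in> {..<b}"
    have "cmod (cis (2 * pi * real d * y) - 1) \<le> \<bar>2 * pi * real d * y\<bar>"
      by (rule cmod_cis_minus_1_le)
    also have "\<dots> = 2 * pi * (real d * \<bar>y\<bar>)" by (simp add: abs_mult)
    also have "\<dots> \<le> 2 * pi * (real b * \<bar>y\<bar>)"
      using d by (intro mult_left_mono mult_right_mono) auto
    finally show "cmod (cis (2 * pi * real d * y) - 1) \<le> 2 * pi * (real b * \<bar>y\<bar>)" .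
  qed simp
  also have "\<dots> = 2 * pi * (real b * \<bar>y\<bar>)" using assms by simp
  finally show ?thesis .
qed

text \<open>The modulus is that of \<open>sin (pi * w) / (b * sin (pi * w / b))\<close>, and
  \<open>\<bar>sin u\<bar> \<le> \<bar>u\<bar>\<close> bounds the denominator. The result no longer
  involves \<open>b\<close>, which makes the later lower bounds uniform over digit
  sequences.\<close>

lemma cmod_dmask_ge_sinc:
  assumes "1 \<le> b"
  shows "\<bar>sinc (pi * w)\<bar> \<le> cmod (dmask b (w / real b))"
proof (cases "w / real b \<in> \<int>")
  case True
  show ?thesis
  proof (cases "w = 0")
    case False
    from True assms have "w \<in> \<int>"
      by (metis Ints_mult Ints_of_nat nonzero_mult_div_cancel_left of_nat_0_eq_iff
          not_one_le_zero times_divide_eq_right)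
    then have "sin (pi * w) = 0"
      by (auto elim!: Ints_cases simp: mult.commute)
    then show ?thesis using False by simp
  qed (use assms in \<open>simp add: dmask_int\<close>)
next
  case False
  let ?s = "sin (pi * w / real b)"
  have w: "w \<noteq> 0" using False by auto
  have eq: "real b * cmod (dmask b (w / real b)) * \<bar>?s\<bar> = \<bar>sin (pi * w)\<bar>"
    using arg_cong[OF dmask_geometric[of b "w / real b"], of cmod] assms
    by (simp add: norm_mult cmod_cis_minus_1)
  have le: "\<bar>?s\<bar> * real b \<le> pi * \<bar>w\<bar>"
    using abs_sin_x_le_abs_x[of "pi * w / real b"] assms by (simp add: abs_mult field_simps)
  have "\<bar>sin (pi * w)\<bar> = cmod (dmask b (w / real b)) * (\<bar>?s\<bar> * real b)"
    using eq by (simp add: mult_ac)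
  also have "\<dots> \<le> cmod (dmask b (w / real b)) * (pi * \<bar>w\<bar>)"
    by (intro mult_left_mono le) auto
  finally show ?thesis using w by (simp add: abs_mult field_simps)
qed

text \<open>Unitarity of the discrete Fourier transform of order \<open>b\<close>, with its columns permuted by \<open>t\<close>.\<close>

lemma sum_cmod_dmask_sq:
  assumes "1 \<le> b" "coprime t b"
  shows "(\<Sum>d<b. (cmod (dmask b (y + real t * real d / real b)))\<^sup>2) = 1"
proof -
  define c where "c e f = cis (2 * pi * (real e - real f) * y)" for e f :: nat
  have ortho: "(\<Sum>d<b. cis (2 * pi * (real e - real f) * (real t * real d / real b)))
      = (if e = f then of_nat b else 0)" if "e < b" "f < b" for e f
  proof -
    let ?v = "(real e - real f) * real t / real b"
    have "(\<Sum>d<b. cis (2 * pi * (real e - real f) * (real t * real d / real b))) = of_nat b * dmask b ?v"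
      using assms by (simp add: dmask_def mult_ac)
    moreover have "dmask b ?v = (if e = f then 1 else 0)"
    proof (cases "e = f")
      case False
      have "?v \<notin> \<int>"
      proof
        assume "?v \<in> \<int>"
        then obtain k where "?v = of_int k" by (auto elim: Ints_cases)
        then have "(real e - real f) * real t = of_int k * real b"
          using assms by (simp add: field_simps)
        then have "of_int ((int e - int f) * int t) = (of_int (k * int b) :: real)" by simp
        then have "(int e - int f) * int t = k * int b" by (simp only: of_int_eq_iff)
        then have "int b dvd (int e - int f) * int t" by simp
        moreover have "coprime (int b) (int t)" using assms(2) by (simp add: coprime_commute)
        ultimately have "int b dvd int e - int f" by (simp add: coprime_dvd_mult_left_iff)
        then show False using zdvd_imp_le[of "int b" "\<bar>int e - int f\<bar>"] that False by simp
      qed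
      moreover have "real b * ?v \<in> \<int>" using assms by simp
      ultimately show ?thesis using assms False by (simp add: dmask_eq_0_iff)
    qed (use assms in \<open>simp add: dmask_int\<close>)
    ultimately show ?thesis by simp
  qed
  have "complex_of_real (\<Sum>d<b. (cmod (dmask b (y + real t * real d / real b)))\<^sup>2)
      = (\<Sum>d<b. dmask b (y + real t * real d / real b) * cnj (dmask b (y + real t * real d / real b)))"
    by (simp add: complex_norm_square del: of_real_power)
  also have "\<dots> = (\<Sum>d<b. (\<Sum>e<b. \<Sum>f<b. c e f *
      cis (2 * pi * (real e - real f) * (real t * real d / real b))) / of_nat b ^ 2)"
    by (simp add: dmask_def sum_product cis_cnj cis_mult c_def power2_eq_square algebra_simps)
  also have "\<dots> = (\<Sum>e<b. \<Sum>f<b. c e f *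
      (\<Sum>d<b. cis (2 * pi * (real e - real f) * (real t * real d / real b)))) / of_nat b ^ 2"
  proof -
    have "(\<Sum>d<b. \<Sum>e<b. \<Sum>f<b. g d e f) = (\<Sum>e<b. \<Sum>f<b. \<Sum>d<b. g d e f)"
      for g :: "nat \<Rightarrow> nat \<Rightarrow> nat \<Rightarrow> complex"
    proof -
      have "(\<Sum>d<b. \<Sum>e<b. \<Sum>f<b. g d e f) = (\<Sum>e<b. \<Sum>d<b. \<Sum>f<b. g d e f)"
        by (rule sum.swap)
      also have "\<dots> = (\<Sum>e<b. \<Sum>f<b. \<Sum>d<b. g d e f)"
        by (intro sum.cong refl sum.swap)
      finally show ?thesis .
    qed
    then show ?thesis
      unfolding sum_divide_distrib[symmetric] sum_distrib_left
      by (rule arg_cong[where f = "\<lambda>x. x / of_nat b ^ 2"])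
  qed
  also have "\<dots> = (\<Sum>e<b. \<Sum>f<b. if e = f then of_nat b else 0) / of_nat b ^ 2"
    by (intro arg_cong2[of _ _ _ _ "(/)"] sum.cong refl) (simp only: ortho lessThan_iff, simp add: c_def)
  also have "\<dots> = 1" using assms by (simp add: power2_eq_square)
  finally show ?thesis by (metis of_real_eq_1_iff)
qed

section \<open>Fourier transforms of infinite convolutions\<close>

text \<open>Level \<open>i\<close> (counted from \<open>0\<close>, unlike the digit sets in \<open>Defs\<close>) has digits
  \<open>{0..<b i} / base_prod M (Suc i)\<close>. Fourier transforms are taken with the sign
  \<open>ft M b x = \<integral> exp (2 \<pi> \<i> x y) d\<mu>(y)\<close>.\<close>

definition digit_seq :: "(nat \<Rightarrow> nat) \<Rightarrow> (nat \<Rightarrow> nat) \<Rightarrow> bool" where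
  "digit_seq M b \<longleftrightarrow> (\<forall>i. 2 \<le> M i \<and> 1 \<le> b i \<and> b i dvd M i)"

definition base_prod :: "(nat \<Rightarrow> nat) \<Rightarrow> nat \<Rightarrow> nat" where
  "base_prod M k = (\<Prod>i<k. M i)"

definition ratio :: "(nat \<Rightarrow> nat) \<Rightarrow> (nat \<Rightarrow> nat) \<Rightarrow> nat \<Rightarrow> nat" where
  "ratio M b i = M i div b i"

definition tail :: "nat \<Rightarrow> (nat \<Rightarrow> 'a) \<Rightarrow> nat \<Rightarrow> 'a" where
  "tail k f = (\<lambda>i. f (k + i))"

definition ft_fin :: "(nat \<Rightarrow> nat) \<Rightarrow> (nat \<Rightarrow> nat) \<Rightarrow> nat \<Rightarrow> real \<Rightarrow> complex" where
  "ft_fin M b k x = (\<Prod>i<k. dmask (b i) (x / real (base_prod M (Suc i))))"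

text \<open>An infinite product attached to the digits alone; the limit exists for every digit
  sequence. Tails and modified sequences can thus be handled without constructing their
  measures.\<close>

definition ft :: "(nat \<Rightarrow> nat) \<Rightarrow> (nat \<Rightarrow> nat) \<Rightarrow> real \<Rightarrow> complex" where
  "ft M b x = lim (\<lambda>k. ft_fin M b k x)"

lemma digit_seqD:
  assumes "digit_seq M b"
  shows "2 \<le> M i" "1 \<le> b i" "b i dvd M i" "M i = b i * ratio M b i" "1 \<le> ratio M b i"
proof -
  show *: "2 \<le> M i" "1 \<le> b i" "b i dvd M i" using assms by (auto simp: digit_seq_def)
  show "M i = b i * ratio M b i" using * by (simp add: ratio_def)
  then show "1 \<le> ratio M b i" using * by (cases "ratio M b i") auto
qed

lemma digit_seq_tail: "digit_seq M b \<Longrightarrow> digit_seq (tail k M) (tail k b)"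
  by (simp add: digit_seq_def tail_def)

lemma tail_apply: "tail k f i = f (k + i)"
  by (simp add: tail_def)

lemma ratio_tail: "ratio (tail k M) (tail k b) i = ratio M b (k + i)"
  by (simp add: ratio_def tail_def)

lemma base_prod_0 [simp]: "base_prod M 0 = 1"
  by (simp add: base_prod_def)

lemma base_prod_Suc [simp]: "base_prod M (Suc k) = base_prod M k * M k"
  by (simp add: base_prod_def)

lemma base_prod_add: "base_prod M (k + l) = base_prod M k * base_prod (tail k M) l"
  by (induction l) (simp_all add: tail_def)

lemma base_prod_dvd: "k \<le> l \<Longrightarrow> base_prod M k dvd base_prod M l"
  using base_prod_add[of M k "l - k"] by simp

lemma base_prod_ge: "digit_seq M b \<Longrightarrow> 2 ^ k \<le> base_prod M k"
proof (induction k)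
  case (Suc k)
  then show ?case
    using mult_le_mono[of "2 ^ k" "base_prod M k" 2 "M k"] digit_seqD(1)[of M b k] by simp
qed simp

lemma base_prod_pos: "digit_seq M b \<Longrightarrow> 0 < base_prod M k"
  by (rule less_le_trans[OF _ base_prod_ge]) auto

lemma base_prod_ge_real: "digit_seq M b \<Longrightarrow> 2 ^ k \<le> real (base_prod M k)"
  using base_prod_ge[of M b k] by (metis of_nat_le_iff of_nat_numeral of_nat_power)

lemma abs_div_base_prod: "digit_seq M b \<Longrightarrow> \<bar>x / real (base_prod M k)\<bar> \<le> \<bar>x\<bar> / 2 ^ k"
  unfolding abs_divide abs_of_nat
  by (intro divide_left_mono base_prod_ge_real mult_pos_pos) (auto simp: base_prod_pos)

lemma ft_fin_0 [simp]: "ft_fin M b 0 x = 1"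
  by (simp add: ft_fin_def)

lemma ft_fin_Suc:
  "ft_fin M b (Suc k) x = ft_fin M b k x * dmask (b k) (x / real (base_prod M (Suc k)))"
  by (simp add: ft_fin_def)

lemma ft_fin_add:
  "ft_fin M b (k + l) x = ft_fin M b k x * ft_fin (tail k M) (tail k b) l (x / real (base_prod M k))"
proof (induction l)
  case (Suc l)
  have "real (base_prod M (Suc (k + l))) = real (base_prod M k) * real (base_prod (tail k M) (Suc l))"
    using base_prod_add[of M k "Suc l"] by simp
  then show ?case using Suc by (simp add: ft_fin_Suc tail_def del: base_prod_Suc)
qed simp

lemma cmod_ft_fin_le_1: "cmod (ft_fin M b k x) \<le> 1"
  unfolding ft_fin_def prod_norm[symmetric] by (intro prod_le_1) (auto simp: cmod_dmask_le_1)

text \<open>A product of factors of modulus at most 1 differs from 1 by at most the sum of the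
  deviations. Level \<open>i\<close> contributes at most
  \<open>2 * pi * \<bar>x\<bar> / 2 ^ i\<close>, whence the factor 4.\<close>

lemma cmod_ft_fin_minus_1:
  assumes "digit_seq M b"
  shows "cmod (ft_fin M b k x - 1) \<le> 4 * pi * \<bar>x\<bar>"
proof -
  have "cmod (ft_fin M b k x - (\<Prod>i<k. 1)) \<le> (\<Sum>i<k. cmod (dmask (b i) (x / real (base_prod M (Suc i))) - 1))"
    unfolding ft_fin_def by (rule norm_prod_diff) (auto simp: cmod_dmask_le_1)
  also have "\<dots> \<le> (\<Sum>i<k. 2 * pi * \<bar>x\<bar> * (1 / 2) ^ i)"
  proof (rule sum_mono)
    fix i
    note [simp] = base_prod_pos[OF assms]
    have "cmod (dmask (b i) (x / real (base_prod M (Suc i))) - 1)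
        \<le> 2 * pi * (real (b i) * \<bar>x / real (base_prod M (Suc i))\<bar>)"
      using digit_seqD[OF assms] by (intro cmod_dmask_minus_1)
    also have "real (b i) * \<bar>x / real (base_prod M (Suc i))\<bar>
        \<le> real (M i) * \<bar>x / real (base_prod M (Suc i))\<bar>"
      using digit_seqD(1,3)[OF assms, of i] by (intro mult_right_mono) (auto dest: dvd_imp_le)
    also have "\<dots> = \<bar>x\<bar> / real (base_prod M i)"
      using digit_seqD(1)[OF assms, of i] by (simp add: abs_mult)
    also have "\<dots> \<le> \<bar>x\<bar> / 2 ^ i"
      using base_prod_ge_real[OF assms, of i] by (intro divide_left_mono) auto
    finally show "cmod (dmask (b i) (x / real (base_prod M (Suc i))) - 1) \<le> 2 * pi * \<bar>x\<bar> * (1 / 2) ^ i"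
      by (simp add: power_divide)
  qed
  also have "\<dots> = 2 * pi * \<bar>x\<bar> * (\<Sum>i<k. (1 / 2) ^ i)"
    by (simp add: sum_distrib_left)
  also have "\<dots> \<le> 2 * pi * \<bar>x\<bar> * 2"
  proof (intro mult_left_mono)
    show "(\<Sum>i<k. (1 / 2 :: real) ^ i) \<le> 2"
      by (subst sum_gp_strict) auto
  qed auto
  finally show ?thesis by simp
qed

text \<open>Later partial products differ from the \<open>k\<close>-th by a tail factor evaluated at
  \<open>x / base_prod M k\<close>, which is close to 1; so the sequence is Cauchy.\<close>

lemma ft_fin_tendsto:
  assumes "digit_seq M b"
  shows "(\<lambda>k. ft_fin M b k x) \<longlonglongrightarrow> ft M b x"
proof -
  have lim: "(\<lambda>k. 4 * pi * \<bar>x\<bar> / 2 ^ k) \<longlonglongrightarrow> 0"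
    by (intro LIMSEQ_divide_realpow_zero) auto
  have diff: "cmod (ft_fin M b m x - ft_fin M b k x) \<le> 4 * pi * \<bar>x\<bar> / 2 ^ k" if km: "k \<le> m" for k m
  proof -
    obtain l where m: "m = k + l" using le_Suc_ex[OF km] by blast
    let ?g = "ft_fin (tail k M) (tail k b) l (x / real (base_prod M k))"
    have "cmod (ft_fin M b m x - ft_fin M b k x) = cmod (ft_fin M b k x) * cmod (?g - 1)"
      by (simp add: m ft_fin_add right_diff_distrib flip: norm_mult)
    also have "\<dots> \<le> 1 * (4 * pi * \<bar>x / real (base_prod M k)\<bar>)"
      by (intro mult_mono cmod_ft_fin_le_1 cmod_ft_fin_minus_1 digit_seq_tail assms) auto
    also have "\<dots> \<le> 4 * pi * \<bar>x\<bar> / 2 ^ k"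
      using mult_left_mono[OF abs_div_base_prod[OF assms, of x k], of "4 * pi"] by simp
    finally show ?thesis .
  qed
  have "Cauchy (\<lambda>k. ft_fin M b k x)"
  proof (rule CauchyI')
    fix e :: real assume "0 < e"
    then obtain K where K: "\<And>k. K \<le> k \<Longrightarrow> 4 * pi * \<bar>x\<bar> / 2 ^ k < e"
      using order_tendstoD(2)[OF lim] unfolding eventually_sequentially by blast
    have "cmod (ft_fin M b m x - ft_fin M b n x) < e" if "K \<le> m" "m < n" for m n
      using diff[of m n] K[of m] that by (simp add: norm_minus_commute)
    then show "\<exists>K. \<forall>m\<ge>K. \<forall>n>m. dist (ft_fin M b m x) (ft_fin M b n x) < e"
      unfolding dist_norm by blast
  qed
  then have "convergent (\<lambda>k. ft_fin M b k x)" by (rule Cauchy_convergent)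
  then show ?thesis unfolding ft_def by (simp add: convergent_LIMSEQ_iff)
qed

lemma ft_split:
  assumes "digit_seq M b"
  shows "ft M b x = ft_fin M b k x * ft (tail k M) (tail k b) (x / real (base_prod M k))"
proof (rule LIMSEQ_unique)
  show "(\<lambda>l. ft_fin M b (k + l) x) \<longlonglongrightarrow> ft M b x"
    using LIMSEQ_ignore_initial_segment[OF ft_fin_tendsto[OF assms], where k = k] by (simp add: add.commute)
  show "(\<lambda>l. ft_fin M b (k + l) x) \<longlonglongrightarrow>
      ft_fin M b k x * ft (tail k M) (tail k b) (x / real (base_prod M k))"
    unfolding ft_fin_add by (intro tendsto_mult_left ft_fin_tendsto digit_seq_tail assms)
qed

lemma cmod_ft_le_1: "digit_seq M b \<Longrightarrow> cmod (ft M b x) \<le> 1"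
  by (rule Lim_bounded[OF tendsto_norm[OF ft_fin_tendsto], where M = 0]) (auto simp: cmod_ft_fin_le_1)

lemma cmod_ft_le_ft_fin: "digit_seq M b \<Longrightarrow> cmod (ft M b x) \<le> cmod (ft_fin M b k x)"
  by (subst ft_split[of _ _ _ k])
    (auto simp: norm_mult intro!: mult_left_le cmod_ft_le_1 digit_seq_tail)

lemma cmod_ft_minus_1: "digit_seq M b \<Longrightarrow> cmod (ft M b x - 1) \<le> 4 * pi * \<bar>x\<bar>"
  by (rule Lim_bounded[OF tendsto_norm[OF tendsto_diff[OF ft_fin_tendsto tendsto_const]], where M = 0])
    (auto simp: cmod_ft_fin_minus_1)

text \<open>The denominators of the first \<open>k\<close> levels all divide
  \<open>base_prod M k\<close>. This is why elements may be shifted by multiples of a base product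
  without disturbing the levels already treated.\<close>

lemma ft_fin_periodic:
  assumes "digit_seq M b" "z \<in> \<int>"
  shows "ft_fin M b k (real (base_prod M k) * z + x) = ft_fin M b k x"
  unfolding ft_fin_def
proof (rule prod.cong[OF refl])
  fix i assume "i \<in> {..<k}"
  then have "base_prod M (Suc i) dvd base_prod M k" by (intro base_prod_dvd) auto
  then obtain c where c: "base_prod M k = base_prod M (Suc i) * c" ..
  have "(real (base_prod M k) * z + x) / real (base_prod M (Suc i))
      = x / real (base_prod M (Suc i)) + real c * z"
    using base_prod_pos[OF assms(1), of "Suc i"] unfolding c by (simp add: field_simps)
  then show "dmask (b i) ((real (base_prod M k) * z + x) / real (base_prod M (Suc i)))
      = dmask (b i) (x / real (base_prod M (Suc i)))"
    using assms(2) by (simp add: dmask_add_int del: base_prod_Suc)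
qed

section \<open>Lower bounds for the transform away from its zeros\<close>

definition away_from_ints :: "real \<Rightarrow> real \<Rightarrow> bool" where
  "away_from_ints \<delta> w \<longleftrightarrow> (\<forall>j :: int. j \<noteq> 0 \<longrightarrow> \<delta> \<le> \<bar>w - of_int j\<bar>)"

text \<open>Compactness: \<open>sinc (pi * w)\<close> is continuous and vanishes only at nonzero
  integers. Since \<open>sinc 0 = 1\<close>, \<open>away_from_ints\<close> does not keep
  \<open>w\<close> away from 0.\<close>

lemma sinc_bounded_below:
  assumes "0 < \<delta>"
  shows "\<exists>c>0. c \<le> 1 \<and> (\<forall>w. \<bar>w\<bar> \<le> R \<longrightarrow> away_from_ints \<delta> w \<longrightarrow> c \<le> \<bar>sinc (pi * w)\<bar>)"
proof -
  define K where "K = {- R..R} \<inter> (\<Inter>j\<in>- {0 :: int}. {w :: real. \<delta> \<le> \<bar>w - of_int j\<bar>})"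
  have K: "w \<in> K \<longleftrightarrow> \<bar>w\<bar> \<le> R \<and> away_from_ints \<delta> w" for w
    by (auto simp: K_def away_from_ints_def)
  have "compact K" unfolding K_def
    by (intro compact_Int_closed closed_INT ballI closed_Collect_le continuous_intros compact_Icc)
  have cont: "continuous_on K (\<lambda>w. \<bar>sinc (pi * w)\<bar>)"
    by (intro continuous_on_rabs continuous_on_sinc continuous_intros)
  have nz: "0 < \<bar>sinc (pi * w)\<bar>" if "w \<in> K" for w
  proof (rule ccontr)
    assume "\<not> 0 < \<bar>sinc (pi * w)\<bar>"
    then have "sin (pi * w) = 0" "w \<noteq> 0" by (auto split: if_splits)
    then obtain j :: int where "w = of_int j" using sin_zero_iff_int2[of "pi * w"] by auto
    then show False using that \<open>w \<noteq> 0\<close> \<open>0 < \<delta>\<close> by (auto simp: K_def dest!: bspec[of _ _ j])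
  qed
  show ?thesis
  proof (cases "K = {}")
    case True
    then show ?thesis using K by (intro exI[of _ 1]) auto
  next
    case False
    then obtain w0 where w0: "w0 \<in> K" "\<And>w. w \<in> K \<Longrightarrow> \<bar>sinc (pi * w0)\<bar> \<le> \<bar>sinc (pi * w)\<bar>"
      using continuous_attains_inf[OF \<open>compact K\<close> False cont] by blast
    have "0 < min 1 \<bar>sinc (pi * w0)\<bar>" using nz[OF w0(1)] by linarith
    moreover have "min 1 \<bar>sinc (pi * w0)\<bar> \<le> \<bar>sinc (pi * w)\<bar>" if "w \<in> K" for w
      using w0(2)[OF that] by linarith
    ultimately show ?thesis using K by (intro exI[of _ "min 1 \<bar>sinc (pi * w0)\<bar>"]) auto
  qed
qed

text \<open>The first \<open>n\<close> levels are bounded by \<open>sinc\<close>, each by the same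
  constant; the remaining tail is close to 1. As \<open>n\<close> depends only on \<open>R\<close>,
  the bound is the same for all digit sequences.\<close>

lemma ft_bounded_below:
  assumes "0 < \<delta>"
  shows "\<exists>\<epsilon>>0. \<forall>M b x. digit_seq M b \<longrightarrow> \<bar>x\<bar> \<le> R \<longrightarrow>
    (\<forall>l. away_from_ints \<delta> (x / real (base_prod M l * ratio M b l))) \<longrightarrow> \<epsilon> \<le> cmod (ft M b x)"
proof -
  obtain c where c: "0 < c" "c \<le> 1"
    "\<forall>w. \<bar>w\<bar> \<le> R \<longrightarrow> away_from_ints \<delta> w \<longrightarrow> c \<le> \<bar>sinc (pi * w)\<bar>"
    using sinc_bounded_below[OF assms, of R] by (elim exE conjE)
  \<comment> \<open>With this \<open>n\<close> the tail differs from 1 by at most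
    \<open>4 * pi * R / 2 ^ n \<le> 1 / 2\<close>.\<close>
  obtain n where n: "8 * pi * R < 2 ^ n" using real_arch_pow[of 2 "8 * pi * R"] by auto
  show ?thesis
  proof (intro exI[of _ "c ^ n / 2"] conjI allI impI)
    fix M b x
    assume d: "digit_seq M b" and x: "\<bar>x\<bar> \<le> R"
      and far: "\<forall>l. away_from_ints \<delta> (x / real (base_prod M l * ratio M b l))"
    have "c \<le> cmod (dmask (b i) (x / real (base_prod M (Suc i))))" for i
    proof -
      let ?Q = "base_prod M i * ratio M b i"
      have Q: "1 \<le> ?Q" using base_prod_pos[OF d, of i] digit_seqD(5)[OF d, of i] by simp
      have eq: "x / real (base_prod M (Suc i)) = x / real ?Q / real (b i)"
        using digit_seqD(4)[OF d, of i] by (simp add: mult_ac)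
      have "\<bar>x\<bar> / real ?Q \<le> \<bar>x\<bar> / 1"
        using Q by (intro divide_left_mono) (auto simp del: of_nat_mult)
      then have "\<bar>x / real ?Q\<bar> \<le> \<bar>x\<bar>" by (simp add: abs_mult)
      then have "c \<le> \<bar>sinc (pi * (x / real ?Q))\<bar>"
        using x far by (intro c(3)[rule_format]) auto
      also have "\<dots> \<le> cmod (dmask (b i) (x / real ?Q / real (b i)))"
        by (rule cmod_dmask_ge_sinc[OF digit_seqD(2)[OF d]])
      finally show ?thesis unfolding eq .
    qed
    then have 1: "c ^ n \<le> cmod (ft_fin M b n x)"
      unfolding ft_fin_def prod_norm[symmetric]
      using prod_mono[of "{..<n}" "\<lambda>_. c"] c(1) by (simp add: less_imp_le)
    let ?t = "ft (tail n M) (tail n b) (x / real (base_prod M n))"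
    have "cmod (?t - 1) \<le> 4 * pi * \<bar>x / real (base_prod M n)\<bar>"
      by (intro cmod_ft_minus_1 digit_seq_tail d)
    also have "\<dots> \<le> 4 * pi * (\<bar>x\<bar> / 2 ^ n)"
      by (intro mult_left_mono abs_div_base_prod[OF d]) auto
    also have "\<dots> \<le> 4 * pi * (R / 2 ^ n)"
      using x by (intro mult_left_mono divide_right_mono) auto
    also have "\<dots> \<le> 1 / 2"
      using n by (simp add: divide_le_eq mult_ac)
    finally have 2: "1 / 2 \<le> cmod ?t"
      using norm_triangle_ineq2[of 1 ?t] by (simp add: norm_minus_commute)
    show "c ^ n / 2 \<le> cmod (ft M b x)"
      unfolding ft_split[OF d, of x n] norm_mult
      using mult_mono[OF 1 2] c(1) by (simp add: less_imp_le)
  qed (use c in simp)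
qed

section \<open>Zeros and arithmetic progressions\<close>

definition zero_set :: "(nat \<Rightarrow> nat) \<Rightarrow> (nat \<Rightarrow> nat) \<Rightarrow> int set" where
  "zero_set M b = {int (base_prod M i * ratio M b i) * d | i d. \<not> int (b i) dvd d}"

lemma level_zero_iff:
  assumes "digit_seq M b"
  shows "dmask (b i) (x / real (base_prod M (Suc i))) = 0 \<longleftrightarrow>
    (\<exists>d. x = of_int (int (base_prod M i * ratio M b i) * d) \<and> \<not> int (b i) dvd d)"
proof -
  let ?Q = "real (base_prod M i * ratio M b i)"
  note D = digit_seqD[OF assms, of i]
  have Q: "?Q \<noteq> 0" using base_prod_pos[OF assms, of i] D(5) by simp
  have b: "real (b i) \<noteq> 0" using D(2) by simp
  have P: "real (base_prod M (Suc i)) = real (b i) * ?Q" using D(4) by simp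
  have 1: "real (b i) * (x / real (base_prod M (Suc i))) = x / ?Q"
    unfolding P using b by (simp del: of_nat_mult)
  have 2: "x / real (base_prod M (Suc i)) \<in> \<int> \<longleftrightarrow> int (b i) dvd d" if "x = ?Q * of_int d" for d :: int
  proof -
    have eq: "x / real (base_prod M (Suc i)) = of_int d / of_int (int (b i))"
      unfolding P that using Q b by (simp del: of_nat_mult)
    have "of_int d / of_int (int (b i)) \<in> (\<int> :: real set) \<longleftrightarrow> int (b i) dvd d"
    proof
      assume "of_int d / of_int (int (b i)) \<in> (\<int> :: real set)"
      then obtain e :: int where "of_int d / of_int (int (b i)) = (of_int e :: real)"
        by (auto elim: Ints_cases)
      then have "of_int d = (of_int (e * int (b i)) :: real)" using b by (simp add: field_simps)
      then have "d = e * int (b i)" by (simp only: of_int_eq_iff)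
      then show "int (b i) dvd d" by simp
    qed (use b in \<open>auto elim!: dvdE\<close>)
    then show ?thesis unfolding eq .
  qed
  have "dmask (b i) (x / real (base_prod M (Suc i))) = 0 \<longleftrightarrow>
      x / ?Q \<in> \<int> \<and> x / real (base_prod M (Suc i)) \<notin> \<int>"
    using dmask_eq_0_iff[OF D(2)] 1 by simp
  also have "\<dots> \<longleftrightarrow> (\<exists>d :: int. x = ?Q * of_int d \<and> \<not> int (b i) dvd d)"
  proof
    assume *: "x / ?Q \<in> \<int> \<and> x / real (base_prod M (Suc i)) \<notin> \<int>"
    then obtain d :: int where "x / ?Q = of_int d" by (auto elim: Ints_cases)
    then have "x = ?Q * of_int d" using Q by (simp add: field_simps)
    with 2[OF this] * show "\<exists>d :: int. x = ?Q * of_int d \<and> \<not> int (b i) dvd d" by blast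
  next
    assume "\<exists>d :: int. x = ?Q * of_int d \<and> \<not> int (b i) dvd d"
    then obtain d :: int where d: "x = ?Q * of_int d" "\<not> int (b i) dvd d" by blast
    then have "x / ?Q = of_int d" using Q by (simp del: of_nat_mult)
    then show "x / ?Q \<in> \<int> \<and> x / real (base_prod M (Suc i)) \<notin> \<int>" using 2[OF d(1)] d(2) by simp
  qed
  finally show ?thesis by simp
qed

text \<open>The infinite product can vanish only through one of its factors: far enough out, the
  tail is at distance less than 1 from 1.\<close>

lemma ft_eq_0_iff:
  assumes "digit_seq M b"
  shows "ft M b x = 0 \<longleftrightarrow> (\<exists>u\<in>zero_set M b. x = of_int u)"
proof
  assume 0: "ft M b x = 0"
  obtain n where n: "4 * pi * \<bar>x\<bar> < 2 ^ n" using real_arch_pow[of 2 "4 * pi * \<bar>x\<bar>"] by auto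
  have "cmod (ft (tail n M) (tail n b) (x / real (base_prod M n)) - 1)
      \<le> 4 * pi * \<bar>x / real (base_prod M n)\<bar>"
    by (intro cmod_ft_minus_1 digit_seq_tail assms)
  also have "\<dots> \<le> 4 * pi * (\<bar>x\<bar> / 2 ^ n)"
    by (intro mult_left_mono abs_div_base_prod[OF assms]) auto
  also have "\<dots> < 1" using n by (simp add: divide_less_eq)
  finally have "ft (tail n M) (tail n b) (x / real (base_prod M n)) \<noteq> 0" by auto
  then have "ft_fin M b n x = 0" using 0 ft_split[OF assms, of x n] by simp
  then obtain i where "dmask (b i) (x / real (base_prod M (Suc i))) = 0"
    unfolding ft_fin_def by auto
  then obtain d where "x = of_int (int (base_prod M i * ratio M b i) * d)" "\<not> int (b i) dvd d"
    unfolding level_zero_iff[OF assms] by blast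
  then show "\<exists>u\<in>zero_set M b. x = of_int u"
    unfolding zero_set_def by blast
next
  assume "\<exists>u\<in>zero_set M b. x = of_int u"
  then obtain i d where "x = of_int (int (base_prod M i * ratio M b i) * d)" "\<not> int (b i) dvd d"
    unfolding zero_set_def by blast
  then have "dmask (b i) (x / real (base_prod M (Suc i))) = 0"
    unfolding level_zero_iff[OF assms] by blast
  then show "ft M b x = 0" by (simp add: ft_split[OF assms, of x "Suc i"] ft_fin_Suc)
qed

text \<open>Hence one orthogonal set of integer frequencies stays orthogonal under every
  multiplier.\<close>

lemma zero_set_mult_coprime:
  assumes "u \<in> zero_set M b" "\<And>i. coprime t (b i)"
  shows "int t * u \<in> zero_set M b"
proof -
  obtain i d where u: "u = int (base_prod M i * ratio M b i) * d" "\<not> int (b i) dvd d"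
    using assms(1) unfolding zero_set_def by blast
  have "coprime (int (b i)) (int t)" using assms(2)[of i] by (simp add: coprime_commute)
  then have "\<not> int (b i) dvd int t * d" using u(2) by (simp add: coprime_dvd_mult_right_iff)
  moreover have "int t * u = int (base_prod M i * ratio M b i) * (int t * d)" by (simp add: u(1))
  ultimately show ?thesis unfolding zero_set_def by blast
qed

lemma zero_not_in_zero_set:
  assumes "digit_seq M b"
  shows "0 \<notin> zero_set M b"
proof -
  have "ft M b 0 \<noteq> 0" using cmod_ft_minus_1[OF assms, of 0] by auto
  then show ?thesis using ft_eq_0_iff[OF assms, of 0] by force
qed

text \<open>Suppose \<open>base_prod M k\<close> were a zero of level \<open>i\<close>. For
  \<open>i < k\<close> its cofactor is divisible by \<open>b i\<close>; for \<open>i \<ge> k\<close>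
  the number \<open>base_prod M i * ratio M b i\<close> would have to divide it, forcing
  \<open>i = k\<close> and ratio 1.\<close>

lemma base_prod_not_in_zero_set:
  assumes d: "digit_seq M b" and r: "2 \<le> ratio M b k"
  shows "int (base_prod M k) \<notin> zero_set M b"
proof
  assume "int (base_prod M k) \<in> zero_set M b"
  then obtain i e where e: "int (base_prod M k) = int (base_prod M i * ratio M b i) * e"
    "\<not> int (b i) dvd e"
    unfolding zero_set_def by blast
  show False
  proof (cases "i < k")
    case True
    then obtain c where "base_prod M k = base_prod M (Suc i) * c"
      using base_prod_dvd[of "Suc i" k M] by auto
    then have "int (base_prod M i * ratio M b i) * (int (b i) * int c)
        = int (base_prod M i * ratio M b i) * e"
      using e(1) digit_seqD(4)[OF d, of i] by (simp add: mult_ac)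
    then have "e = int (b i) * int c"
      using base_prod_pos[OF d, of i] digit_seqD(5)[OF d, of i] by simp
    then show False using e(2) by simp
  next
    case False
    then obtain c where c: "base_prod M i = base_prod M k * c"
      using base_prod_dvd[of k i M] by auto
    then have "int (base_prod M k) * 1 = int (base_prod M k) * (int (c * ratio M b i) * e)"
      using e(1) by (simp add: mult_ac)
    then have "1 = int (c * ratio M b i) * e"
      using base_prod_pos[OF d, of k] by (subst (asm) mult_cancel_left) auto
    then have 1: "int (c * ratio M b i) dvd 1" by (metis dvd_triv_left)
    then have "ratio M b i = 1" by (simp del: of_nat_mult)
    moreover have "c = 1" using 1 by (simp del: of_nat_mult)
    moreover have "i = k"
    proof (rule ccontr)
      assume "i \<noteq> k"
      then have "base_prod M (Suc k) dvd base_prod M i" using False by (intro base_prod_dvd) auto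
      then have "base_prod M k * M k \<le> base_prod M k"
        using c \<open>c = 1\<close> base_prod_pos[OF d, of i] by (auto dest: dvd_imp_le)
      then show False using base_prod_pos[OF d, of k] digit_seqD(1)[OF d, of k] by simp
    qed
    ultimately show False using r by simp
  qed
qed

text \<open>Zeros are nonzero integers, so radius 3/4 leaves distance 1/4. It is composed of a
  rounding error of at most 1/2 and a window of size 1/4, see
  \<open>good_extend_step\<close>.\<close>

lemma ft_near_0:
  "\<exists>c>0. \<forall>M b f. digit_seq M b \<longrightarrow> \<bar>f\<bar> \<le> 3 / 4 \<longrightarrow> c \<le> cmod (ft M b f)"
proof -
  obtain c where c: "c > 0" "\<forall>M b x. digit_seq M b \<longrightarrow> \<bar>x\<bar> \<le> 3 / 4 \<longrightarrow>
    (\<forall>l. away_from_ints (1 / 4) (x / real (base_prod M l * ratio M b l))) \<longrightarrow> c \<le> cmod (ft M b x)"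
    using ft_bounded_below[of "1 / 4" "3 / 4"] by auto
  have "c \<le> cmod (ft M b f)" if d: "digit_seq M b" and f: "\<bar>f\<bar> \<le> 3 / 4" for M b f
  proof (intro c(2)[rule_format] d f)
    fix l
    let ?Q = "base_prod M l * ratio M b l"
    have "1 \<le> ?Q" using base_prod_pos[OF d, of l] digit_seqD(5)[OF d, of l] by simp
    then have "\<bar>f\<bar> / real ?Q \<le> \<bar>f\<bar> / 1" by (intro divide_left_mono) (auto simp del: of_nat_mult)
    then have le: "\<bar>f / real ?Q\<bar> \<le> 3 / 4" using f unfolding abs_divide abs_of_nat by linarith
    show "away_from_ints (1 / 4) (f / real ?Q)"
      unfolding away_from_ints_def
    proof (intro allI impI)
      fix j :: int assume "j \<noteq> 0"
      then have "1 \<le> \<bar>of_int j :: real\<bar>" by linarith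
      then show "1 / 4 \<le> \<bar>f / real ?Q - of_int j\<bar>" using le by linarith
    qed
  qed
  then show ?thesis using c(1) by blast
qed

text \<open>Removes \<open>k\<close> levels: by periodicity they see only \<open>f\<close>, and
  there the finite product dominates the infinite one.\<close>

lemma ft_peel:
  assumes "digit_seq M b" "u \<in> \<int>"
  shows "cmod (ft M b f) * cmod (ft (tail k M) (tail k b) (u + f / real (base_prod M k)))
    \<le> cmod (ft M b (real (base_prod M k) * u + f))"
proof -
  let ?P = "real (base_prod M k)"
  have "(?P * u + f) / ?P = u + f / ?P"
    using base_prod_pos[OF assms(1), of k] by (simp add: field_simps)
  then have "ft M b (?P * u + f) = ft_fin M b k f * ft (tail k M) (tail k b) (u + f / ?P)"
    using ft_split[OF assms(1), of "?P * u + f" k] ft_fin_periodic[OF assms, of k f] by simp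
  then show ?thesis
    using cmod_ft_le_ft_fin[OF assms(1), of f k] by (simp add: norm_mult mult_right_mono)
qed

lemma coprime_solve:
  assumes "coprime (t :: int) p"
  shows "\<exists>z. p dvd a + t * z"
proof -
  obtain u v where uv: "u * t + v * p = 1" using bezout_int[of t p] assms by auto
  have "a + t * (- a * u) = a * 1 - a * u * t" by simp
  also have "\<dots> = a * (u * t + v * p) - a * u * t" by (simp only: uv)
  also have "\<dots> = p * (a * v)" by (simp add: algebra_simps)
  finally show ?thesis by (metis dvd_triv_left)
qed

text \<open>The first ratio divides every \<open>Q = base_prod M l * ratio M b l\<close>, since it
  divides \<open>M 0\<close>. As it does not divide \<open>u\<close>, the integer
  \<open>u - j * Q\<close> is nonzero, and \<open>u + f\<close> has distance at least
  \<open>1 - 3 / 4\<close> from \<open>j * Q\<close>.\<close>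

lemma away_from_ints_levels:
  assumes d: "digit_seq M b" and u: "\<not> int (ratio M b 0) dvd u" and f: "\<bar>f\<bar> \<le> 3 / 4"
    and R: "\<bar>of_int u + f\<bar> \<le> R" "1 \<le> R"
  shows "away_from_ints (1 / (8 * R)) ((of_int u + f) / real (base_prod M l * ratio M b l))"
  unfolding away_from_ints_def
proof (intro allI impI)
  fix j :: int assume j: "j \<noteq> 0"
  define Q where "Q = base_prod M l * ratio M b l"
  define y where "y = of_int u + f"
  have Q: "0 < Q" using base_prod_pos[OF d, of l] digit_seqD(5)[OF d, of l] by (simp add: Q_def)
  have "ratio M b 0 dvd Q"
  proof (cases l)
    case (Suc l')
    have "ratio M b 0 dvd M 0" using digit_seqD(4)[OF d, of 0] by (metis dvd_triv_right)
    moreover have "M 0 dvd base_prod M l" using base_prod_dvd[of 1 l M] Suc by simp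
    ultimately show ?thesis unfolding Q_def by (meson dvd_mult2 dvd_trans)
  qed (simp add: Q_def)
  then have "\<not> int (ratio M b 0) dvd u - j * int Q" using u
    by (metis dvd_diff_right_iff dvd_mult dvd_diff_left_iff int_dvd_int_iff)
  then have "u - j * int Q \<noteq> 0" by auto
  then have "1 \<le> \<bar>of_int (u - j * int Q) :: real\<bar>" by linarith
  moreover have "y - of_int j * real Q = of_int (u - j * int Q) + f" by (simp add: y_def)
  ultimately have num: "1 / 4 \<le> \<bar>y - of_int j * real Q\<bar>" using f by linarith
  have "1 / (8 * R) \<le> \<bar>y / real Q - of_int j\<bar>"
  \<comment> \<open>For small \<open>Q\<close>, division by at most \<open>2 * R\<close> turns 1/4
    into \<open>1 / (8 * R)\<close>; for large \<open>Q\<close> the quotient is at most 1/2 and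
    hence far from every nonzero integer.\<close>
  proof (cases "real Q \<le> 2 * R")
    case True
    have "1 / (8 * R) = (1 / 4) / (2 * R)" by simp
    also have "\<dots> \<le> \<bar>y - of_int j * real Q\<bar> / real Q"
      using True Q num R(2) by (intro frac_le) auto
    also have "\<dots> = \<bar>y / real Q - of_int j\<bar>"
    proof -
      have "y / real Q - of_int j = (y - of_int j * real Q) / real Q" using Q by (simp add: field_simps)
      then show ?thesis by (simp add: abs_divide)
    qed
    finally show ?thesis .
  next
    case False
    then have "\<bar>y\<bar> / real Q \<le> R / (2 * R)"
      using R unfolding y_def by (intro frac_le) auto
    then have "\<bar>y / real Q\<bar> \<le> 1 / 2" using R(2) by (simp add: abs_divide)
    moreover have "1 \<le> \<bar>of_int j :: real\<bar>" using j by linarith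
    ultimately have "1 / 2 \<le> \<bar>y / real Q - of_int j\<bar>" by linarith
    moreover have "1 / (8 * R) \<le> 1 / 2" using R(2) by (simp add: divide_le_eq)
    ultimately show ?thesis by linarith
  qed
  then show "1 / (8 * R) \<le> \<bar>(of_int u + f) / real (base_prod M l * ratio M b l) - of_int j\<bar>"
    by (simp only: Q_def y_def)
qed

text \<open>If the first ratio \<open>r \<ge> 2\<close> divides both \<open>a\<close> and \<open>t\<close> (after clearing the preceding levels),
  then \<open>t\<close> is replaced by \<open>t / r\<close>; otherwise the progression contains a small
  integer outside \<open>r\<int>\<close>, hence away from all zeros.\<close>

lemma ft_progression_bounded_below:
  "\<exists>\<epsilon>>0. \<forall>M b t a. digit_seq M b \<longrightarrow> (\<forall>i. coprime t (b i)) \<longrightarrow> (\<forall>k. \<exists>i\<ge>k. 2 \<le> ratio M b i) \<longrightarrow>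
    1 \<le> t \<longrightarrow> t \<le> T \<longrightarrow>
    (\<exists>z :: int. \<forall>f. \<bar>f\<bar> \<le> 3 / 4 \<longrightarrow> \<epsilon> \<le> cmod (ft M b (of_int (a + int t * z) + f)))"
proof (induction T)
  case 0
  show ?case by (intro exI[of _ 1]) auto
next
  case (Suc T)
  then obtain \<epsilon> where \<epsilon>: "\<epsilon> > 0" "\<And>M b t a. digit_seq M b \<Longrightarrow> \<forall>i. coprime t (b i) \<Longrightarrow>
      \<forall>k. \<exists>i\<ge>k. 2 \<le> ratio M b i \<Longrightarrow> 1 \<le> t \<Longrightarrow> t \<le> T \<Longrightarrow>
    \<exists>z :: int. \<forall>f. \<bar>f\<bar> \<le> 3 / 4 \<longrightarrow> \<epsilon> \<le> cmod (ft M b (of_int (a + int t * z) + f))"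
    by blast
  obtain c where c: "c > 0" "\<And>M b f. digit_seq M b \<Longrightarrow> \<bar>f\<bar> \<le> 3 / 4 \<Longrightarrow> c \<le> cmod (ft M b f)"
    using ft_near_0 by blast
  \<comment> \<open>The integer found below is less than \<open>2 * t\<close>, and the perturbation
    is less than 1.\<close>
  define R where "R = 2 * real (Suc T) + 1"
  have R: "1 \<le> R" by (simp add: R_def)
  then obtain e where e: "e > 0" "\<And>M b x. digit_seq M b \<Longrightarrow> \<bar>x\<bar> \<le> R \<Longrightarrow>
    (\<And>l. away_from_ints (1 / (8 * R)) (x / real (base_prod M l * ratio M b l))) \<Longrightarrow> e \<le> cmod (ft M b x)"
    using ft_bounded_below[of "1 / (8 * R)" R] by auto
  \<comment> \<open>The factor \<open>c\<close> pays for the levels peeled off; the minimum covers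
    both the induction hypothesis and the direct case.\<close>
  show ?case
  proof (intro exI[of _ "c * min \<epsilon> e"] conjI allI impI)
    show "0 < c * min \<epsilon> e" using c(1) \<epsilon>(1) e(1) by simp
    fix M b t and a :: int
    assume d: "digit_seq M b" and cop: "\<forall>i. coprime t (b i)"
      and inf: "\<forall>k. \<exists>i\<ge>k. 2 \<le> ratio M b i" and t: "1 \<le> t" "t \<le> Suc T"
    \<comment> \<open>Before level \<open>i\<close> the bases equal the digit counts, so
      \<open>t\<close> is coprime to \<open>P\<close> and the progression contains multiples of
      \<open>P\<close>.\<close>
    define i where "i = (LEAST i. 2 \<le> ratio M b i)"
    define P where "P = base_prod M i"
    define r where "r = ratio M b i"
    have r: "2 \<le> r" unfolding r_def i_def using inf LeastI_ex[of "\<lambda>i. 2 \<le> ratio M b i"] by blast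
    have "M l = b l" if "l < i" for l
      using not_less_Least[of l "\<lambda>i. 2 \<le> ratio M b i"] that digit_seqD(4,5)[OF d, of l]
      by (cases "ratio M b l = 1") (auto simp: i_def)
    then have "coprime t P" unfolding P_def base_prod_def
      using cop by (auto intro!: prod_coprime_right)
    then obtain z0 where "int P dvd a + int t * z0"
      using coprime_solve[of "int t" "int P" a] by auto
    then obtain a' where a': "a + int t * z0 = int P * a'" ..
    have peel: "c * cmod (ft (tail k M) (tail k b) (of_int v + f / real (base_prod M k)))
        \<le> cmod (ft M b (of_int w + f))"
      if "w = int (base_prod M k) * v" "\<bar>f\<bar> \<le> 3 / 4" for k v w f
    proof -
      have "c * cmod (ft (tail k M) (tail k b) (of_int v + f / real (base_prod M k)))
        \<le> cmod (ft M b f) * cmod (ft (tail k M) (tail k b) (of_int v + f / real (base_prod M k)))"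
        using c(2)[OF d that(2)] by (intro mult_right_mono) auto
      also have "\<dots> \<le> cmod (ft M b (of_int w + f))"
        using ft_peel[OF d, of "of_int v" f k] that(1) by simp
      finally show ?thesis .
    qed
    have small: "\<bar>f / real (base_prod M k)\<bar> \<le> 3 / 4" if "\<bar>f\<bar> \<le> 3 / 4" for f k
    proof -
      have "\<bar>f / real (base_prod M k)\<bar> \<le> \<bar>f\<bar> / 2 ^ k" by (rule abs_div_base_prod[OF d])
      also have "\<dots> \<le> \<bar>f\<bar> / 1" by (intro divide_left_mono) auto
      finally show ?thesis using that by linarith
    qed
    show "\<exists>z :: int. \<forall>f. \<bar>f\<bar> \<le> 3 / 4 \<longrightarrow> c * min \<epsilon> e \<le> cmod (ft M b (of_int (a + int t * z) + f))"
    proof (cases "int r dvd a' \<and> r dvd t")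
      case True
      then obtain a1 t1 where a1: "a' = int r * a1" and t1: "t = r * t1" by (auto elim!: dvdE)
      have t1_bounds: "1 \<le> t1" "t1 \<le> T"
      proof -
        show "1 \<le> t1" using t(1) t1 by (cases t1) auto
        then have "2 * t1 \<le> t" using r t1 by simp
        then show "t1 \<le> T" using t \<open>1 \<le> t1\<close> by linarith
      qed
      \<comment> \<open>Having divided by \<open>r\<close>, the progression of step
        \<open>t1\<close> is also made divisible by \<open>b i\<close>. Together with
        \<open>P\<close> and \<open>r\<close> this gives \<open>base_prod M (Suc i)\<close>, so
        \<open>Suc i\<close> whole levels can be peeled off.\<close>
      have cop1: "coprime t1 (b j)" for j using cop t1 by auto
      then obtain z1 where "int (b i) dvd a1 + int t1 * z1"
        using coprime_solve[of "int t1" "int (b i)" a1] by auto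
      then obtain a2 where a2: "a1 + int t1 * z1 = int (b i) * a2" ..
      have "\<forall>k. \<exists>j\<ge>k. 2 \<le> ratio (tail (Suc i) M) (tail (Suc i) b) j"
      proof
        fix k
        obtain j where "j \<ge> Suc i + k" "2 \<le> ratio M b j" using inf by blast
        then show "\<exists>j\<ge>k. 2 \<le> ratio (tail (Suc i) M) (tail (Suc i) b) j"
          by (intro exI[of _ "j - Suc i"]) (simp add: ratio_tail)
      qed
      then obtain z2 where z2: "\<And>f. \<bar>f\<bar> \<le> 3 / 4 \<Longrightarrow>
          \<epsilon> \<le> cmod (ft (tail (Suc i) M) (tail (Suc i) b) (of_int (a2 + int t1 * z2) + f))"
        using \<epsilon>(2)[OF digit_seq_tail[OF d], of t1 "Suc i" a2] cop1 t1_bounds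
        by (auto simp: tail_apply)
      have "a + int t * (z0 + int P * (z1 + int (b i) * z2))
          = int P * (a' + int t * (z1 + int (b i) * z2))"
        using a' by (simp add: algebra_simps)
      also have "a' + int t * (z1 + int (b i) * z2)
          = int r * ((a1 + int t1 * z1) + int (b i) * int t1 * z2)"
        by (simp add: a1 t1 algebra_simps)
      also have "\<dots> = int (r * b i) * (a2 + int t1 * z2)"
        unfolding a2 by (simp add: algebra_simps)
      finally have eq: "a + int t * (z0 + int P * (z1 + int (b i) * z2))
          = int (base_prod M (Suc i)) * (a2 + int t1 * z2)"
        using digit_seqD(4)[OF d, of i] by (simp add: P_def r_def mult_ac)
      show ?thesis
      proof (intro exI[of _ "z0 + int P * (z1 + int (b i) * z2)"] allI impI)
        fix f :: real assume f: "\<bar>f\<bar> \<le> 3 / 4"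
        have "c * min \<epsilon> e \<le> c * \<epsilon>" using c(1) by simp
        also have "\<dots> \<le> c * cmod (ft (tail (Suc i) M) (tail (Suc i) b)
            (of_int (a2 + int t1 * z2) + f / real (base_prod M (Suc i))))"
          using c(1) by (intro mult_left_mono z2 small f) simp
        also have "\<dots> \<le> cmod (ft M b (of_int (a + int t * (z0 + int P * (z1 + int (b i) * z2))) + f))"
          by (rule peel[OF eq f])
        finally show "c * min \<epsilon> e \<le>
          cmod (ft M b (of_int (a + int t * (z0 + int P * (z1 + int (b i) * z2))) + f))" .
      qed
    next
      case False
      define u where "u = a' mod int t"
      \<comment> \<open>If \<open>r\<close> divided both \<open>u\<close> and \<open>u + t\<close>,
        it would divide \<open>t\<close> and \<open>a'\<close>, which is the other case.\<close>
      have "\<exists>s\<in>{0, 1}. \<not> int r dvd u + int t * s"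
      proof (rule ccontr)
        assume "\<not> ?thesis"
        then have 1: "int r dvd u" "int r dvd u + int t" by auto
        then have "int r dvd int t" by (simp add: dvd_add_right_iff)
        moreover from this have "int r dvd a'" using 1(1)
          unfolding u_def by (metis dvd_mod_iff)
        ultimately show False using False by simp
      qed
      then obtain s where s: "s \<in> {0, 1}" "\<not> int r dvd u + int t * s" by blast
      define v where "v = u + int t * s"
      have "0 \<le> u" "u < int t" unfolding u_def using t(1) by simp_all
      then have v: "0 \<le> v" "v < 2 * int t" using s(1) unfolding v_def by auto
      have "a' div int t * int t + u = a'" unfolding u_def by (rule div_mult_mod_eq)
      then have v_eq: "v = a' + int t * (s - a' div int t)" unfolding v_def by (simp add: algebra_simps)
      have "a + int t * (z0 + int P * (s - a' div int t))
          = (a + int t * z0) + int P * (int t * (s - a' div int t))"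
        by (simp add: algebra_simps)
      also have "\<dots> = int (base_prod M i) * v"
        unfolding a' v_eq P_def by (simp only: distrib_left)
      finally have eq: "a + int t * (z0 + int P * (s - a' div int t)) = int (base_prod M i) * v" .
      show ?thesis
      proof (intro exI[of _ "z0 + int P * (s - a' div int t)"] allI impI)
        fix f :: real assume f: "\<bar>f\<bar> \<le> 3 / 4"
        let ?g = "f / real (base_prod M i)"
        have "\<bar>of_int v\<bar> \<le> 2 * real t" using v by simp
        moreover have "real t \<le> real (Suc T)" using t(2) by (simp only: of_nat_le_iff)
        ultimately have le: "\<bar>of_int v + ?g\<bar> \<le> R" using small[OF f, of i] abs_triangle_ineq[of "of_int v" ?g] unfolding R_def by argo
        have "\<not> int (ratio (tail i M) (tail i b) 0) dvd v"
          using s(2) by (simp add: ratio_tail v_def r_def)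
        from away_from_ints_levels[OF digit_seq_tail[OF d] this small[OF f] le R]
        have e': "e \<le> cmod (ft (tail i M) (tail i b) (of_int v + ?g))"
          by (intro e(2) digit_seq_tail[OF d] le)
        have "c * min \<epsilon> e \<le> c * e" using c(1) by simp
        also have "\<dots> \<le> c * cmod (ft (tail i M) (tail i b) (of_int v + ?g))"
          using c(1) by (intro mult_left_mono e') simp
        also have "\<dots> \<le> cmod (ft M b (of_int (a + int t * (z0 + int P * (s - a' div int t))) + f))"
          by (rule peel[OF eq f])
        finally show "c * min \<epsilon> e \<le>
          cmod (ft M b (of_int (a + int t * (z0 + int P * (s - a' div int t))) + f))" .
      qed
    qed
  qed
qed

section \<open>Construction of the spectra\<close>

locale digit_system =
  fixes M b :: "nat \<Rightarrow> nat"
  assumes digit_seq: "digit_seq M b"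
    and digits_ge_2: "2 \<le> b i"
    and ratios_frequently: "\<exists>i\<ge>k. 2 \<le> ratio M b i"
begin

abbreviation "P \<equiv> base_prod M"
abbreviation "F \<equiv> ft M b"
abbreviation "Fn \<equiv> ft_fin M b"

definition multipliers :: "nat set" where
  "multipliers = {t. 1 \<le> t \<and> (\<forall>i. coprime t (b i))}"

definition level_set :: "nat \<Rightarrow> int set" where
  "level_set k = {int (P i * ratio M b i) * d | i d. i < k \<and> \<not> int (b i) dvd d}"

text \<open>For a single \<open>t\<close> the last clause is the Jorgensen-Pedersen criterion for
  \<open>t * A\<close> to be a spectrum of the convolution of the first \<open>k\<close> levels;
  here it is imposed for all multipliers simultaneously. The element 0 is the parent of the markers
  below.\<close>

definition good :: "nat \<Rightarrow> int set \<Rightarrow> bool" where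
  "good k A \<longleftrightarrow> finite A \<and> 0 \<in> A \<and> (\<forall>a\<in>A. \<forall>a'\<in>A. a \<noteq> a' \<longrightarrow> a - a' \<in> level_set k) \<and>
    (\<forall>t\<in>multipliers. \<forall>x. (\<Sum>a\<in>A. (cmod (Fn k (x + of_int (int t * a))))\<^sup>2) = 1)"

text \<open>Multiplied by \<open>t\<close> and divided by \<open>P (Suc k)\<close>, the middle term
  is \<open>t * d / b k\<close>, a column of the discrete Fourier transform. The last term is the
  free shift, invisible to the first \<open>Suc k\<close> levels.\<close>

definition child :: "nat \<Rightarrow> (int \<Rightarrow> nat \<Rightarrow> int) \<Rightarrow> int \<times> nat \<Rightarrow> int" where
  "child k z = (\<lambda>(a, d). a + int (P k * ratio M b k) * int d + int (P (Suc k)) * z a d)"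

definition extend :: "nat \<Rightarrow> (int \<Rightarrow> nat \<Rightarrow> int) \<Rightarrow> int set \<Rightarrow> int set" where
  "extend k z A = child k z ` (A \<times> {..<b k})"

text \<open>The Parseval sum of the exponential of frequency \<open>- x\<close> over
  \<open>t * A\<close>; its Parseval defect is 1 minus this.\<close>

definition mass :: "nat \<Rightarrow> real \<Rightarrow> int set \<Rightarrow> real" where
  "mass t x A = (\<Sum>a\<in>A. (cmod (F (x + of_int (int t * a))))\<^sup>2)"

lemma base_prod_mono: "k \<le> l \<Longrightarrow> P k \<le> P l"
  using base_prod_dvd[of k l M] base_prod_pos[OF digit_seq, of l] by (auto intro: dvd_imp_le)

lemma level_set_subset_zero_set: "level_set k \<subseteq> zero_set M b"
  unfolding level_set_def zero_set_def by blast

text \<open>For \<open>i < k\<close> the shift is a multiple of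
  \<open>P (Suc i) = P i * ratio M b i * b i\<close>, so it changes the cofactor only by a multiple
  of \<open>b i\<close>.\<close>

lemma level_set_add:
  assumes "u \<in> level_set k"
  shows "u + int (P k) * v \<in> level_set (Suc k)"
proof -
  obtain i d where u: "u = int (P i * ratio M b i) * d" "i < k" "\<not> int (b i) dvd d"
    using assms unfolding level_set_def by blast
  obtain c where c: "P k = P (Suc i) * c"
    using base_prod_dvd[of "Suc i" k M] u(2) by (auto elim: dvdE)
  have "u + int (P k) * v = int (P i * ratio M b i) * (d + int (b i) * (int c * v))"
    unfolding u(1) c using digit_seqD(4)[OF digit_seq, of i] by (simp add: algebra_simps)
  moreover have "\<not> int (b i) dvd d + int (b i) * (int c * v)"
    using u(3) by (simp add: dvd_add_left_iff)
  ultimately show ?thesis using u(2) unfolding level_set_def by (blast intro: less_SucI)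
qed

lemma good_0: "good 0 {0}"
  by (simp add: good_def)

lemma extend_superset: "(\<And>a. z a 0 = 0) \<Longrightarrow> A \<subseteq> extend k z A"
  using digits_ge_2[of k] unfolding extend_def child_def
  by (auto intro!: image_eqI[where x = "(_, 0)"])

text \<open>Children of different parents inherit a zero of an earlier level; children of one parent
  differ in the digit and give a zero of level \<open>k\<close> itself.\<close>

lemma child_diff:
  assumes "\<And>a a'. a \<in> A \<Longrightarrow> a' \<in> A \<Longrightarrow> a \<noteq> a' \<Longrightarrow> a - a' \<in> level_set k"
    and "p \<in> A \<times> {..<b k}" "q \<in> A \<times> {..<b k}" "p \<noteq> q"
  shows "child k z p - child k z q \<in> level_set (Suc k)"
proof -
  obtain a d a' d' where p: "p = (a, d)" and q: "q = (a', d')" by (meson surj_pair)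
  have D: "int (P (Suc k)) = int (P k) * int (ratio M b k) * int (b k)"
    using digit_seqD(4)[OF digit_seq, of k] by (simp add: mult_ac)
  show ?thesis
  proof (cases "a = a'")
    case False
    have "child k z p - child k z q = (a - a') + int (P k) *
        (int (ratio M b k) * (int d - int d' + int (b k) * (z a d - z a' d')))"
      unfolding p q child_def D by (simp add: algebra_simps del: base_prod_Suc)
    then show ?thesis
      using level_set_add[OF assms(1)[OF _ _ False]] assms(2,3) by (simp add: p q)
  next
    case True
    have "child k z p - child k z q
        = int (P k * ratio M b k) * (int d - int d' + int (b k) * (z a d - z a d'))"
      unfolding p q child_def D True by (simp add: algebra_simps del: base_prod_Suc)
    moreover have "\<not> int (b k) dvd int d - int d' + int (b k) * (z a d - z a d')"
    proof
      assume "int (b k) dvd int d - int d' + int (b k) * (z a d - z a d')"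
      then have "int (b k) dvd int d - int d'" by (simp add: dvd_add_left_iff)
      then show False
        using zdvd_imp_le[of "int (b k)" "\<bar>int d - int d'\<bar>"] assms(2,3,4) True by (auto simp: p q)
    qed
    ultimately show ?thesis unfolding level_set_def by blast
  qed
qed

text \<open>By periodicity the first \<open>k\<close> levels at a child depend only on its parent,
  and for a fixed parent the squared masks of level \<open>k\<close> sum to 1 over the digits by
  \<open>sum_cmod_dmask_sq\<close>. The shifts \<open>z\<close> are arbitrary except that digit 0
  must reproduce the parent.\<close>

lemma good_extend:
  assumes good: "good k A" and z: "\<And>a. z a 0 = 0"
  shows "good (Suc k) (extend k z A)"
proof -
  have A: "finite A" "0 \<in> A" "\<And>a a'. a \<in> A \<Longrightarrow> a' \<in> A \<Longrightarrow> a \<noteq> a' \<Longrightarrow> a - a' \<in> level_set k"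
    "\<And>t x. t \<in> multipliers \<Longrightarrow> (\<Sum>a\<in>A. (cmod (Fn k (x + of_int (int t * a))))\<^sup>2) = 1"
    using good unfolding good_def by blast+
  note diff = child_diff[OF A(3), where z = z]
  have inj: "inj_on (child k z) (A \<times> {..<b k})"
  proof (rule inj_onI, rule ccontr)
    fix p q assume "p \<in> A \<times> {..<b k}" "q \<in> A \<times> {..<b k}" "child k z p = child k z q" "p \<noteq> q"
    then have "0 \<in> level_set (Suc k)" using diff[where p = p and q = q] by simp
    then show False using zero_not_in_zero_set[OF digit_seq] level_set_subset_zero_set by blast
  qed
  have "(\<Sum>a\<in>extend k z A. (cmod (Fn (Suc k) (x + of_int (int t * a))))\<^sup>2) = 1"
    if t: "t \<in> multipliers" for t x
  proof -
    have factor: "(cmod (Fn (Suc k) (x + of_int (int t * child k z (a, d)))))\<^sup>2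
        = (cmod (Fn k (x + of_int (int t * a))))\<^sup>2 *
          (cmod (dmask (b k) ((x + of_int (int t * a)) / real (P (Suc k)) + real t * real d / real (b k))))\<^sup>2"
      for a d
    proof -
      let ?y = "x + of_int (int t * child k z (a, d))"
      let ?i = "int t * (int (ratio M b k) * int d + int (M k) * z a d)"
      have "?y = real (P k) * of_int ?i + (x + of_int (int t * a))"
        by (simp add: child_def algebra_simps)
      then have 1: "Fn k ?y = Fn k (x + of_int (int t * a))"
        by (simp only: ft_fin_periodic[OF digit_seq Ints_of_int])
      have "?y / real (P (Suc k)) = ((x + of_int (int t * a)) / real (P (Suc k))
          + real t * real d / real (b k)) + of_int (int t * z a d)"
      proof -
        have nz: "real (P (Suc k)) \<noteq> 0" "real (b k) \<noteq> 0" "real (P k) \<noteq> 0"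
          using base_prod_pos[OF digit_seq, of "Suc k"] base_prod_pos[OF digit_seq, of k]
            digits_ge_2[of k] by auto
        have PS: "real (P (Suc k)) = real (P k) * real (ratio M b k) * real (b k)"
          using digit_seqD(4)[OF digit_seq, of k] by simp
        have "?y = x + of_int (int t * a) + real t * (real (P k) * real (ratio M b k) * real d)
            + real (P (Suc k)) * of_int (int t * z a d)"
          by (simp add: child_def algebra_simps)
        also have "real (P k) * real (ratio M b k) * real d = real (P (Suc k)) * (real d / real (b k))"
          unfolding PS using nz by simp
        finally show ?thesis using nz by (simp add: add_divide_distrib del: base_prod_Suc)
      qed
      then have "dmask (b k) (?y / real (P (Suc k)))
          = dmask (b k) ((x + of_int (int t * a)) / real (P (Suc k)) + real t * real d / real (b k))"
        by (simp only: dmask_add_int[OF Ints_of_int])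
      then show ?thesis by (simp only: ft_fin_Suc norm_mult power_mult_distrib 1)
    qed
    have "(\<Sum>a\<in>extend k z A. (cmod (Fn (Suc k) (x + of_int (int t * a))))\<^sup>2)
        = (\<Sum>(a, d)\<in>A \<times> {..<b k}. (cmod (Fn (Suc k) (x + of_int (int t * child k z (a, d)))))\<^sup>2)"
      unfolding extend_def by (subst sum.reindex[OF inj]) (simp add: case_prod_beta)
    also have "\<dots> = (\<Sum>a\<in>A. \<Sum>d<b k. (cmod (Fn (Suc k) (x + of_int (int t * child k z (a, d)))))\<^sup>2)"
      by (simp add: sum.cartesian_product)
    also have "\<dots> = (\<Sum>a\<in>A. (cmod (Fn k (x + of_int (int t * a))))\<^sup>2)"
      unfolding factor sum_distrib_left[symmetric]
      using sum_cmod_dmask_sq[OF digit_seqD(2)[OF digit_seq]] t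
      by (intro sum.cong refl) (simp add: multipliers_def)
    also have "\<dots> = 1" by (rule A(4)[OF t])
    finally show ?thesis .
  qed
  moreover have "\<forall>a\<in>extend k z A. \<forall>a'\<in>extend k z A. a \<noteq> a' \<longrightarrow> a - a' \<in> level_set (Suc k)"
    unfolding extend_def using diff by blast
  moreover have "finite (extend k z A)" unfolding extend_def using A(1) by simp
  moreover have "0 \<in> extend k z A" using extend_superset[of z A k, OF z] A(2) by blast
  ultimately show ?thesis unfolding good_def by blast
qed

section \<open>Extension by blocks devoted to one multiplier\<close>

lemma cmod_Fn_antimono: "k \<le> l \<Longrightarrow> cmod (Fn l x) \<le> cmod (Fn k x)"
proof (induction l rule: dec_induct)
  case (step l)
  have "cmod (Fn (Suc l) x) \<le> cmod (Fn l x)"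
    unfolding ft_fin_Suc norm_mult by (rule mult_left_le) (auto simp: cmod_dmask_le_1)
  then show ?case using step.IH by linarith
qed simp

text \<open>The residue of a new element modulo \<open>P (Suc k)\<close> is prescribed, so its image under
  \<open>a \<mapsto> t * a / P (Suc k)\<close> may be moved freely along a progression of step \<open>t\<close>.\<close>

lemma good_extend_step:
  assumes eps: "\<And>k a. \<exists>z :: int. \<forall>f. \<bar>f\<bar> \<le> 3 / 4 \<longrightarrow>
      \<epsilon> \<le> cmod (ft (tail k M) (tail k b) (of_int (a + int t * z) + f))"
    and good: "good k A"
  shows "\<exists>A'. good (Suc k) A' \<and> A \<subseteq> A' \<and> (\<forall>a\<in>A' - A. \<forall>x. \<bar>x\<bar> \<le> real (P (Suc k)) / 4 \<longrightarrow>
    \<epsilon> * cmod (Fn (Suc k) (x + of_int (int t * a))) \<le> cmod (F (x + of_int (int t * a))))"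
proof -
  let ?Q = "real (P (Suc k))"
  have Q: "0 < ?Q" using base_prod_pos[OF digit_seq, of "Suc k"] by simp
  have "\<exists>z. \<forall>x. \<bar>x\<bar> \<le> ?Q / 4 \<longrightarrow> \<epsilon> \<le> cmod (ft (tail (Suc k) M) (tail (Suc k) b)
      ((x + of_int (int t * (c + int (P (Suc k)) * z))) / ?Q))" for c :: int
  proof -
    \<comment> \<open>Rounding \<open>v\<close> costs at most 1/2 and the window contributes
      \<open>\<bar>x\<bar> / ?Q \<le> 1 / 4\<close>; the sum is the radius 3/4 that
      \<open>eps\<close> allows.\<close>
    define v where "v = real t * of_int c / ?Q"
    obtain z :: int where z: "\<And>f. \<bar>f\<bar> \<le> 3 / 4 \<Longrightarrow> \<epsilon> \<le> cmod (ft (tail (Suc k) M) (tail (Suc k) b)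
        (of_int (round v + int t * z) + f))"
      using eps[where k = "Suc k" and a = "round v"] by blast
    have "\<epsilon> \<le> cmod (ft (tail (Suc k) M) (tail (Suc k) b)
      ((x + of_int (int t * (c + int (P (Suc k)) * z))) / ?Q))" if x: "\<bar>x\<bar> \<le> ?Q / 4" for x
    proof -
      have "\<bar>x / ?Q\<bar> \<le> 1 / 4" using x Q by (simp add: abs_divide divide_le_eq del: base_prod_Suc)
      moreover have "\<bar>v - of_int (round v)\<bar> \<le> 1 / 2"
        using of_int_round_abs_le[of v] by (simp add: abs_minus_commute)
      ultimately have "\<bar>x / ?Q + (v - of_int (round v))\<bar> \<le> 3 / 4" by linarith
      moreover have "(x + of_int (int t * (c + int (P (Suc k)) * z))) / ?Q
          = of_int (round v + int t * z) + (x / ?Q + (v - of_int (round v)))"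
        using Q unfolding v_def by (simp add: field_simps del: base_prod_Suc)
      ultimately show ?thesis using z by presburger
    qed
    then show ?thesis by blast
  qed
  then obtain s where s: "\<And>c x. \<bar>x\<bar> \<le> ?Q / 4 \<Longrightarrow> \<epsilon> \<le> cmod (ft (tail (Suc k) M) (tail (Suc k) b)
      ((x + of_int (int t * (c + int (P (Suc k)) * s c))) / ?Q))" by metis
  \<comment> \<open>Digit 0 keeps the old elements fixed; only new elements are moved.\<close>
  define z where "z a d = (if d = 0 then 0 else s (a + int (P k * ratio M b k) * int d))" for a d
  have z0: "z a 0 = 0" for a by (simp add: z_def)
  show ?thesis
  proof (intro exI[of _ "extend k z A"] conjI ballI allI impI)
    show "good (Suc k) (extend k z A)" by (intro good_extend good z0)
    show "A \<subseteq> extend k z A" by (intro extend_superset z0)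
    fix a x assume a: "a \<in> extend k z A - A" and x: "\<bar>x\<bar> \<le> ?Q / 4"
    then obtain a0 d where a0: "a0 \<in> A" "a = child k z (a0, d)" unfolding extend_def by auto
    have "d \<noteq> 0"
    proof
      assume "d = 0"
      then have "a = a0" using a0(2) by (simp add: child_def z0)
      then show False using a a0(1) by simp
    qed
    then have "a = (a0 + int (P k * ratio M b k) * int d)
        + int (P (Suc k)) * s (a0 + int (P k * ratio M b k) * int d)"
      unfolding a0(2) child_def z_def by simp
    then have "\<epsilon> \<le> cmod (ft (tail (Suc k) M) (tail (Suc k) b) ((x + of_int (int t * a)) / ?Q))"
      using s[OF x, of "a0 + int (P k * ratio M b k) * int d"] by simp
    then show "\<epsilon> * cmod (Fn (Suc k) (x + of_int (int t * a))) \<le> cmod (F (x + of_int (int t * a)))"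
      unfolding ft_split[OF digit_seq, of _ "Suc k"] norm_mult
      by (subst mult.commute) (intro mult_left_mono, auto)
  qed
qed

text \<open>Bounds won at earlier levels survive because \<open>Fn\<close> decreases with the level.
  The window is that of the first level, the smallest one.\<close>

lemma good_extend_block:
  assumes eps: "\<And>k a. \<exists>z :: int. \<forall>f. \<bar>f\<bar> \<le> 3 / 4 \<longrightarrow>
      \<epsilon> \<le> cmod (ft (tail k M) (tail k b) (of_int (a + int t * z) + f))"
    and "0 < \<epsilon>" and good: "good k A"
  shows "\<exists>A'. good (k + n) A' \<and> A \<subseteq> A' \<and> (\<forall>a\<in>A' - A. \<forall>x. \<bar>x\<bar> \<le> real (P k) / 4 \<longrightarrow>
    \<epsilon> * cmod (Fn (k + n) (x + of_int (int t * a))) \<le> cmod (F (x + of_int (int t * a))))"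
proof (induction n)
  case 0
  then show ?case using good by (intro exI[of _ A]) simp
next
  case (Suc n)
  then obtain A' where A': "good (k + n) A'" "A \<subseteq> A'"
    "\<And>a x. a \<in> A' - A \<Longrightarrow> \<bar>x\<bar> \<le> real (P k) / 4 \<Longrightarrow>
      \<epsilon> * cmod (Fn (k + n) (x + of_int (int t * a))) \<le> cmod (F (x + of_int (int t * a)))"
    by blast
  obtain A'' where A'': "good (Suc (k + n)) A''" "A' \<subseteq> A''"
    "\<And>a x. a \<in> A'' - A' \<Longrightarrow> \<bar>x\<bar> \<le> real (P (Suc (k + n))) / 4 \<Longrightarrow>
      \<epsilon> * cmod (Fn (Suc (k + n)) (x + of_int (int t * a))) \<le> cmod (F (x + of_int (int t * a)))"
    using good_extend_step[OF eps A'(1)] by blast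
  have "\<epsilon> * cmod (Fn (Suc (k + n)) (x + of_int (int t * a))) \<le> cmod (F (x + of_int (int t * a)))"
    if a: "a \<in> A'' - A" and x: "\<bar>x\<bar> \<le> real (P k) / 4" for a x
  proof (cases "a \<in> A'")
    case True
    have "\<epsilon> * cmod (Fn (Suc (k + n)) (x + of_int (int t * a)))
        \<le> \<epsilon> * cmod (Fn (k + n) (x + of_int (int t * a)))"
      using \<open>0 < \<epsilon>\<close> by (intro mult_left_mono cmod_Fn_antimono) auto
    also have "\<dots> \<le> cmod (F (x + of_int (int t * a)))"
      using A'(3)[of a x] a x True by simp
    finally show ?thesis .
  next
    case False
    have "P k \<le> P (Suc (k + n))" by (intro base_prod_mono) simp
    then have "real (P k) \<le> real (P (Suc (k + n)))" by (simp only: of_nat_le_iff)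
    then have "\<bar>x\<bar> \<le> real (P (Suc (k + n))) / 4" using x by argo
    moreover have "a \<in> A'' - A'" using a False by blast
    ultimately show ?thesis by (intro A''(3))
  qed
  then show ?case using A' A'' by (intro exI[of _ A'']) auto
qed

lemma mass_mono: "finite B \<Longrightarrow> A \<subseteq> B \<Longrightarrow> mass t x A \<le> mass t x B"
  unfolding mass_def by (intro sum_mono2) auto

lemma good_mass_le_1:
  assumes "good k A" "t \<in> multipliers"
  shows "mass t x A \<le> 1"
proof -
  have "mass t x A \<le> (\<Sum>a\<in>A. (cmod (Fn k (x + of_int (int t * a))))\<^sup>2)"
    unfolding mass_def by (intro sum_mono power_mono cmod_ft_le_ft_fin digit_seq) auto
  also have "\<dots> = 1" using assms unfolding good_def by blast
  finally show ?thesis .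
qed

text \<open>On a finite set and a bounded window the arguments are bounded, so the tail factor tends
  to 1 uniformly.\<close>

lemma sum_Fn_close_to_mass:
  assumes "finite A" "0 < \<delta>"
  shows "\<exists>n0. \<forall>n\<ge>n0. \<forall>x. \<bar>x\<bar> \<le> R \<longrightarrow>
    (\<Sum>a\<in>A. (cmod (Fn n (x + of_int (int t * a))))\<^sup>2) \<le> mass t x A + \<delta>"
proof -
  \<comment> \<open>A bound for all \<open>\<bar>x + t * a\<bar>\<close>; the tail factor is then
    within \<open>4 * pi * Y / 2 ^ n\<close> of 1, its square within twice that.\<close>
  define Y where "Y = R + real t * (\<Sum>a\<in>A. \<bar>of_int a\<bar>)"
  obtain n0 where n0: "real (card A) * (8 * pi * Y) / \<delta> < 2 ^ n0"
    using real_arch_pow[of 2 "real (card A) * (8 * pi * Y) / \<delta>"] by auto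
  have "(\<Sum>a\<in>A. (cmod (Fn n (x + of_int (int t * a))))\<^sup>2) \<le> mass t x A + \<delta>"
    if n: "n0 \<le> n" and x: "\<bar>x\<bar> \<le> R" for n x
  proof -
    have Y0: "0 \<le> Y" unfolding Y_def using x by (auto intro!: add_nonneg_nonneg sum_nonneg mult_nonneg_nonneg)
    have le: "(cmod (Fn n (x + of_int (int t * a))))\<^sup>2
        \<le> (cmod (F (x + of_int (int t * a))))\<^sup>2 + 8 * pi * Y / 2 ^ n" if a: "a \<in> A" for a
    proof -
      let ?y = "x + of_int (int t * a)"
      define g where "g = cmod (ft (tail n M) (tail n b) (?y / real (P n)))"
      have g: "0 \<le> g" "g \<le> 1" unfolding g_def by (auto intro!: cmod_ft_le_1 digit_seq_tail digit_seq)
      have "\<bar>?y\<bar> \<le> \<bar>x\<bar> + \<bar>of_int (int t * a)\<bar>" by (rule abs_triangle_ineq)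
      also have "\<dots> \<le> R + real t * \<bar>of_int a\<bar>" using x by (simp add: abs_mult)
      also have "\<dots> \<le> Y" unfolding Y_def
        using member_le_sum[of a A "\<lambda>a. \<bar>real_of_int a\<bar>"] a assms(1)
        by (intro add_left_mono mult_left_mono) auto
      finally have y: "\<bar>?y\<bar> \<le> Y" .
      have "1 - g \<le> cmod (ft (tail n M) (tail n b) (?y / real (P n)) - 1)"
        unfolding g_def using norm_triangle_ineq2[of 1 "ft (tail n M) (tail n b) (?y / real (P n))"]
        by (simp add: norm_minus_commute)
      also have "\<dots> \<le> 4 * pi * \<bar>?y / real (P n)\<bar>"
        by (intro cmod_ft_minus_1 digit_seq_tail digit_seq)
      also have "\<dots> \<le> 4 * pi * (\<bar>?y\<bar> / 2 ^ n)"
        by (intro mult_left_mono abs_div_base_prod[OF digit_seq]) auto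
      also have "\<dots> \<le> 4 * pi * (Y / 2 ^ n)"
        using y by (intro mult_left_mono divide_right_mono) auto
      finally have g1: "1 - g \<le> 4 * pi * (Y / 2 ^ n)" .
      have "1 - g\<^sup>2 = (1 - g) * (1 + g)" by (simp add: power2_eq_square algebra_simps)
      also have "\<dots> \<le> (4 * pi * (Y / 2 ^ n)) * 2"
        using g g1 Y0 by (intro mult_mono) auto
      finally have g2: "1 - g\<^sup>2 \<le> 8 * pi * Y / 2 ^ n" by simp
      have "(cmod (Fn n ?y))\<^sup>2 - (cmod (F ?y))\<^sup>2 = (cmod (Fn n ?y))\<^sup>2 * (1 - g\<^sup>2)"
        unfolding ft_split[OF digit_seq, of ?y n] g_def
        by (simp add: norm_mult power_mult_distrib algebra_simps)
      also have "\<dots> \<le> 1 * (1 - g\<^sup>2)"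
        using g cmod_ft_fin_le_1[of M b n ?y]
        by (intro mult_right_mono) (auto simp: power_le_one)
      also have "\<dots> \<le> 8 * pi * Y / 2 ^ n" using g2 by (simp only: mult_1)
      finally show ?thesis by (simp only: diff_le_eq add.commute)
    qed
    have "(\<Sum>a\<in>A. (cmod (Fn n (x + of_int (int t * a))))\<^sup>2)
        \<le> (\<Sum>a\<in>A. (cmod (F (x + of_int (int t * a))))\<^sup>2 + 8 * pi * Y / 2 ^ n)"
      by (intro sum_mono le)
    also have "\<dots> = mass t x A + real (card A) * (8 * pi * Y) / 2 ^ n"
      by (simp add: sum.distrib mass_def)
    also have "real (card A) * (8 * pi * Y) / 2 ^ n \<le> real (card A) * (8 * pi * Y) / 2 ^ n0"
      using n Y0 by (intro divide_left_mono power_increasing) auto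
    also have "\<dots> \<le> \<delta>" using n0 assms(2) by (simp add: field_simps)
    finally show ?thesis by simp
  qed
  then show ?thesis by blast
qed

text \<open>A base power outside \<open>zero_set M b\<close>; shifting an element by it is what makes spectra differ.\<close>

definition offset :: "nat \<Rightarrow> nat" where
  "offset k = P (SOME i. k < i \<and> 2 \<le> ratio M b i)"

lemma offset: "int (offset k) \<notin> zero_set M b" "P (Suc k) dvd offset k"
proof -
  define i where "i = (SOME i. k < i \<and> 2 \<le> ratio M b i)"
  have "\<exists>i. k < i \<and> 2 \<le> ratio M b i"
    using ratios_frequently[of "Suc k"] by (auto simp: Suc_le_eq)
  then have i: "k < i" "2 \<le> ratio M b i" unfolding i_def by (metis (mono_tags, lifting) someI_ex)+
  have "offset k = P i" by (simp add: offset_def i_def)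
  then show "int (offset k) \<notin> zero_set M b" "P (Suc k) dvd offset k"
    using base_prod_not_in_zero_set[OF digit_seq i(2)] base_prod_dvd[of "Suc k" i M] i(1)
    by (auto simp del: base_prod_Suc)
qed

text \<open>The child of 0 with digit 1, shifted or not according to the bit. The two versions
  differ by \<open>offset k\<close>, which is not a zero, so no orthogonal set contains
  both.\<close>

definition marker :: "nat \<Rightarrow> bool \<Rightarrow> int" where
  "marker k \<beta> = int (P k * ratio M b k) + (if \<beta> then int (offset k) else 0)"

lemma good_extend_marked:
  assumes "good k A"
  shows "\<exists>A'. good (Suc k) A' \<and> A \<subseteq> A' \<and> marker k \<beta> \<in> A'"
proof -
  obtain c where c: "offset k = P (Suc k) * c" using offset(2)[of k] by blast
  define z where "z a d = (if d = 0 \<or> \<not> \<beta> then 0 else int c)" for a :: int and d :: nat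
  have z0: "z a 0 = 0" for a by (simp add: z_def)
  have "0 \<in> A" using assms unfolding good_def by blast
  then have "child k z (0, 1) \<in> extend k z A"
    using digits_ge_2[of k] unfolding extend_def by (intro imageI) auto
  moreover have "child k z (0, 1) = marker k \<beta>"
    unfolding child_def marker_def z_def c by simp
  ultimately show ?thesis using good_extend[OF assms, of z, OF z0] extend_superset[of z A k, OF z0] by auto
qed

text \<open>The block is taken so long that at its end \<open>Fn\<close> agrees with \<open>F\<close> on the old elements; the new
  ones then carry a proportion \<open>\<epsilon>\<^sup>2\<close> of the missing mass.\<close>

lemma good_extend_stage:
  assumes eps: "\<And>k a. \<exists>z :: int. \<forall>f. \<bar>f\<bar> \<le> 3 / 4 \<longrightarrow>
      \<epsilon> \<le> cmod (ft (tail k M) (tail k b) (of_int (a + int t * z) + f))"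
    and \<epsilon>: "0 < \<epsilon>" "\<epsilon> \<le> 1" and good: "good k A" and t: "t \<in> multipliers" and \<delta>: "0 < \<delta>"
  shows "\<exists>k' A'. k < k' \<and> good k' A' \<and> A \<subseteq> A' \<and> marker k \<beta> \<in> A' \<and>
    (\<forall>x. \<bar>x\<bar> \<le> R \<longrightarrow> \<bar>x\<bar> \<le> real (P k) / 4 \<longrightarrow>
      1 - mass t x A' \<le> (1 - \<epsilon>\<^sup>2) * (1 - mass t x A) + \<epsilon>\<^sup>2 * \<delta>)"
proof -
  \<comment> \<open>The level carrying the marker precedes the block; its elements then count as old
    ones, which is harmless since they can only increase the mass.\<close>
  obtain A1 where A1: "good (Suc k) A1" "A \<subseteq> A1" "marker k \<beta> \<in> A1"
    using good_extend_marked[OF good] by blast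
  have fin1: "finite A1" using A1(1) unfolding good_def by blast
  obtain n where n: "\<And>m x. n \<le> m \<Longrightarrow> \<bar>x\<bar> \<le> R \<Longrightarrow>
      (\<Sum>a\<in>A1. (cmod (Fn m (x + of_int (int t * a))))\<^sup>2) \<le> mass t x A1 + \<delta>"
    using sum_Fn_close_to_mass[OF fin1 \<delta>] by blast
  let ?k = "Suc k + n"
  obtain A' where A': "good ?k A'" "A1 \<subseteq> A'" "\<And>a x. a \<in> A' - A1 \<Longrightarrow> \<bar>x\<bar> \<le> real (P (Suc k)) / 4 \<Longrightarrow>
      \<epsilon> * cmod (Fn ?k (x + of_int (int t * a))) \<le> cmod (F (x + of_int (int t * a)))"
    using good_extend_block[OF eps \<epsilon>(1) A1(1), of n] by blast
  have fin: "finite A'" using A'(1) unfolding good_def by blast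
  have "1 - mass t x A' \<le> (1 - \<epsilon>\<^sup>2) * (1 - mass t x A) + \<epsilon>\<^sup>2 * \<delta>"
    if x: "\<bar>x\<bar> \<le> R" "\<bar>x\<bar> \<le> real (P k) / 4" for x
  proof -
    have "real (P k) \<le> real (P (Suc k))"
      using base_prod_mono[of k "Suc k"] by (simp only: of_nat_le_iff)
    then have xk: "\<bar>x\<bar> \<le> real (P (Suc k)) / 4" using x(2) by linarith
    let ?f = "\<lambda>a. (cmod (Fn ?k (x + of_int (int t * a))))\<^sup>2"
    have "1 = sum ?f A'" using A'(1) t unfolding good_def by metis
    also have "\<dots> = sum ?f (A' - A1) + sum ?f A1" by (rule sum.subset_diff[OF A'(2) fin])
    also have "\<dots> \<le> sum ?f (A' - A1) + (mass t x A1 + \<delta>)"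
      using n[of ?k x] x(1) by simp
    finally have 1: "1 - mass t x A1 - \<delta> \<le> sum ?f (A' - A1)" by simp
    have "\<epsilon>\<^sup>2 * sum ?f (A' - A1) \<le> mass t x (A' - A1)"
      unfolding mass_def sum_distrib_left power_mult_distrib[symmetric]
      using \<epsilon>(1) xk by (intro sum_mono power_mono A'(3)) auto
    moreover have "mass t x A' = mass t x (A' - A1) + mass t x A1"
      unfolding mass_def by (rule sum.subset_diff[OF A'(2) fin])
    moreover have "\<epsilon>\<^sup>2 * (1 - mass t x A1 - \<delta>) \<le> \<epsilon>\<^sup>2 * sum ?f (A' - A1)"
      using 1 by (intro mult_left_mono) auto
    ultimately have "1 - mass t x A' \<le> (1 - \<epsilon>\<^sup>2) * (1 - mass t x A1) + \<epsilon>\<^sup>2 * \<delta>"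
      by (simp add: algebra_simps)
    also have "\<dots> \<le> (1 - \<epsilon>\<^sup>2) * (1 - mass t x A) + \<epsilon>\<^sup>2 * \<delta>"
      using mass_mono[OF fin1 A1(2), of t x] \<epsilon> by (intro add_right_mono mult_left_mono) (auto simp: power_le_one)
    finally show ?thesis .
  qed
  then show ?thesis using A' A1 by (intro exI[of _ ?k] exI[of _ A']) auto
qed

section \<open>The infinite construction: schedule, stages and their union\<close>

definition rate :: "nat \<Rightarrow> real" where
  "rate t = (SOME \<epsilon>. 0 < \<epsilon> \<and> \<epsilon> \<le> 1 \<and> (\<forall>k a. \<exists>z :: int. \<forall>f. \<bar>f\<bar> \<le> 3 / 4 \<longrightarrow>
    \<epsilon> \<le> cmod (ft (tail k M) (tail k b) (of_int (a + int t * z) + f))))"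

text \<open>One constant per multiplier, the same at all levels: repeated blocks for
  \<open>t\<close> must contract by a fixed factor. It is capped at 1 so that
  \<open>1 - (rate t)\<^sup>2\<close> is nonnegative.\<close>

lemma rate:
  assumes "t \<in> multipliers"
  shows "0 < rate t" "rate t \<le> 1"
    "\<exists>z :: int. \<forall>f. \<bar>f\<bar> \<le> 3 / 4 \<longrightarrow>
      rate t \<le> cmod (ft (tail k M) (tail k b) (of_int (a + int t * z) + f))"
proof -
  obtain \<epsilon> where \<epsilon>: "0 < \<epsilon>" "\<forall>M b t' a. digit_seq M b \<longrightarrow> (\<forall>i. coprime t' (b i)) \<longrightarrow>
      (\<forall>k. \<exists>i\<ge>k. 2 \<le> ratio M b i) \<longrightarrow> 1 \<le> t' \<longrightarrow> t' \<le> t \<longrightarrow>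
    (\<exists>z :: int. \<forall>f. \<bar>f\<bar> \<le> 3 / 4 \<longrightarrow> \<epsilon> \<le> cmod (ft M b (of_int (a + int t' * z) + f)))"
    using ft_progression_bounded_below[of t] by (elim exE conjE)
  have "\<exists>z :: int. \<forall>f. \<bar>f\<bar> \<le> 3 / 4 \<longrightarrow>
      min 1 \<epsilon> \<le> cmod (ft (tail k M) (tail k b) (of_int (a + int t * z) + f))" for k a
  proof -
    have "\<exists>j\<ge>l. 2 \<le> ratio (tail k M) (tail k b) j" for l
    proof -
      obtain j where "k + l \<le> j" "2 \<le> ratio M b j" using ratios_frequently by blast
      then show ?thesis by (intro exI[of _ "j - k"]) (simp add: ratio_tail)
    qed
    then obtain z :: int where "\<forall>f. \<bar>f\<bar> \<le> 3 / 4 \<longrightarrow>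
        \<epsilon> \<le> cmod (ft (tail k M) (tail k b) (of_int (a + int t * z) + f))"
      using \<epsilon>(2)[rule_format, OF digit_seq_tail[OF digit_seq], of t k a] assms
      by (auto simp: multipliers_def tail_apply)
    then show ?thesis by (intro exI[of _ z]) (auto intro: min.coboundedI2)
  qed
  then have "\<exists>\<epsilon>>0. \<epsilon> \<le> 1 \<and> (\<forall>k a. \<exists>z :: int. \<forall>f. \<bar>f\<bar> \<le> 3 / 4 \<longrightarrow>
    \<epsilon> \<le> cmod (ft (tail k M) (tail k b) (of_int (a + int t * z) + f)))"
    using \<epsilon>(1) by (intro exI[of _ "min 1 \<epsilon>"]) auto
  from someI_ex[OF this[folded conj_assoc]] show "0 < rate t" "rate t \<le> 1"
    "\<exists>z :: int. \<forall>f. \<bar>f\<bar> \<le> 3 / 4 \<longrightarrow>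
      rate t \<le> cmod (ft (tail k M) (tail k b) (of_int (a + int t * z) + f))"
    unfolding rate_def conj_assoc by blast+
qed

lemma one_multiplier: "1 \<in> multipliers"
  by (simp add: multipliers_def)

text \<open>The index coding \<open>(t, n)\<close> is at least \<open>n\<close>, so every multiplier
  recurs beyond any bound. Indices that decode to a non-multiplier default to 1, which always is
  one.\<close>

definition schedule :: "nat \<Rightarrow> nat" where
  "schedule j = (if fst (prod_decode j) \<in> multipliers then fst (prod_decode j) else 1)"

lemma schedule: "schedule j \<in> multipliers"
  using one_multiplier by (simp add: schedule_def)

lemma schedule_frequently: "t \<in> multipliers \<Longrightarrow> \<exists>j\<ge>n. schedule j = t"
  by (intro exI[of _ "prod_encode (t, n)"]) (simp add: schedule_def le_prod_encode_2)

text \<open>States are pairs of a level and a finite set. The window grows with \<open>j\<close> and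
  the error \<open>1 / Suc j\<close> tends to 0, so that every real \<open>x\<close> is eventually
  served with vanishing error.\<close>

definition next_stage :: "nat \<Rightarrow> bool \<Rightarrow> nat \<times> int set \<Rightarrow> nat \<times> int set \<Rightarrow> bool" where
  "next_stage j \<beta> s s' \<longleftrightarrow> fst s < fst s' \<and> good (fst s') (snd s') \<and> snd s \<subseteq> snd s' \<and>
    marker (fst s) \<beta> \<in> snd s' \<and>
    (\<forall>x. \<bar>x\<bar> \<le> real j \<longrightarrow> \<bar>x\<bar> \<le> real (P (fst s)) / 4 \<longrightarrow>
      1 - mass (schedule j) x (snd s') \<le> (1 - (rate (schedule j))\<^sup>2) * (1 - mass (schedule j) x (snd s))
        + (rate (schedule j))\<^sup>2 * (1 / real (Suc j)))"

text \<open>The choice depends only on \<open>j\<close>, the bit and the preceding stage, hence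
  sequences that agree before \<open>j\<close> have the same stage \<open>j\<close>. Injectivity of
  \<open>spectrum_of\<close> rests on this.\<close>

primrec stage :: "(nat \<Rightarrow> bool) \<Rightarrow> nat \<Rightarrow> nat \<times> int set" where
  "stage \<alpha> 0 = (0, {0})"
| "stage \<alpha> (Suc j) = (SOME s'. next_stage j (\<alpha> j) (stage \<alpha> j) s')"

lemma next_stage_ex:
  assumes "good (fst s) (snd s)"
  shows "\<exists>s'. next_stage j \<beta> s s'"
proof -
  obtain k' A' where "fst s < k'" "good k' A'" "snd s \<subseteq> A'" "marker (fst s) \<beta> \<in> A'"
    "\<forall>x. \<bar>x\<bar> \<le> real j \<longrightarrow> \<bar>x\<bar> \<le> real (P (fst s)) / 4 \<longrightarrow>
      1 - mass (schedule j) x A' \<le> (1 - (rate (schedule j))\<^sup>2) * (1 - mass (schedule j) x (snd s))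
        + (rate (schedule j))\<^sup>2 * (1 / real (Suc j))"
    using good_extend_stage[OF rate(3)[OF schedule[of j]] rate(1,2)[OF schedule] assms schedule,
        of "1 / real (Suc j)" \<beta> "real j"] by auto
  then show ?thesis by (intro exI[of _ "(k', A')"]) (simp add: next_stage_def)
qed

lemma good_stage: "good (fst (stage \<alpha> j)) (snd (stage \<alpha> j))"
  and next_stage: "next_stage j (\<alpha> j) (stage \<alpha> j) (stage \<alpha> (Suc j))"
proof -
  have *: "good (fst (stage \<alpha> j)) (snd (stage \<alpha> j)) \<and> next_stage j (\<alpha> j) (stage \<alpha> j) (stage \<alpha> (Suc j))" for j
  proof (induction j)
    case 0
    show ?case using good_0 someI_ex[OF next_stage_ex[of "(0, {0})" 0 "\<alpha> 0"]] by simp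
  next
    case (Suc j)
    then have "good (fst (stage \<alpha> (Suc j))) (snd (stage \<alpha> (Suc j)))" by (simp add: next_stage_def)
    then show ?case using someI_ex[OF next_stage_ex] by simp
  qed
  then show "good (fst (stage \<alpha> j)) (snd (stage \<alpha> j))"
    "next_stage j (\<alpha> j) (stage \<alpha> j) (stage \<alpha> (Suc j))" by blast+
qed

lemma stage_mono: "i \<le> j \<Longrightarrow> snd (stage \<alpha> i) \<subseteq> snd (stage \<alpha> j)"
  by (rule lift_Suc_mono_le[of "\<lambda>j. snd (stage \<alpha> j)"]) (use next_stage[of _ \<alpha>] in \<open>simp_all add: next_stage_def\<close>)

lemma stage_level: "j \<le> fst (stage \<alpha> j)"
proof (induction j)
  case (Suc j)
  then show ?case using next_stage[of j \<alpha>] unfolding next_stage_def by linarith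
qed simp

definition spectrum_of :: "(nat \<Rightarrow> bool) \<Rightarrow> int set" where
  "spectrum_of \<alpha> = (\<Union>j. snd (stage \<alpha> j))"

lemma spectrum_of_diff:
  assumes "a \<in> spectrum_of \<alpha>" "a' \<in> spectrum_of \<alpha>" "a \<noteq> a'"
  shows "a - a' \<in> zero_set M b"
proof -
  obtain i j where "a \<in> snd (stage \<alpha> i)" "a' \<in> snd (stage \<alpha> j)" using assms unfolding spectrum_of_def by blast
  then have "a \<in> snd (stage \<alpha> (max i j))" "a' \<in> snd (stage \<alpha> (max i j))"
    using stage_mono[of i "max i j" \<alpha>] stage_mono[of j "max i j" \<alpha>] by auto
  then show ?thesis
    using good_stage[of \<alpha> "max i j"] assms(3) level_set_subset_zero_set unfolding good_def by blast
qed

text \<open>At the first disagreement both constructions are at the same stage, hence at the same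
  level, and add opposite markers. If the unions coincided, they would contain both markers.\<close>

lemma inj_spectrum_of: "inj spectrum_of"
proof (rule injI, rule ccontr)
  fix \<alpha> \<alpha>' assume eq: "spectrum_of \<alpha> = spectrum_of \<alpha>'" and "\<alpha> \<noteq> \<alpha>'"
  then have ex: "\<exists>j. \<alpha> j \<noteq> \<alpha>' j" by auto
  define j where "j = (LEAST j. \<alpha> j \<noteq> \<alpha>' j)"
  have j: "\<alpha> j \<noteq> \<alpha>' j" unfolding j_def by (rule LeastI_ex[OF ex])
  have "stage \<alpha> i = stage \<alpha>' i" if "i \<le> j" for i
    using that
  proof (induction i)
    case (Suc i)
    then have "\<alpha> i = \<alpha>' i" using not_less_Least[of i "\<lambda>j. \<alpha> j \<noteq> \<alpha>' j"] by (auto simp: j_def)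
    then show ?case using Suc by simp
  qed simp
  then have st: "stage \<alpha>' j = stage \<alpha> j" by simp
  let ?k = "fst (stage \<alpha> j)"
  have "marker ?k (\<alpha> j) \<in> spectrum_of \<alpha>" "marker ?k (\<alpha>' j) \<in> spectrum_of \<alpha>'"
    using next_stage[of j \<alpha>] next_stage[of j \<alpha>'] unfolding next_stage_def spectrum_of_def st by blast+
  then have "marker ?k True \<in> spectrum_of \<alpha>" "marker ?k False \<in> spectrum_of \<alpha>"
    using j eq by (cases "\<alpha> j"; cases "\<alpha>' j"; simp)+
  moreover have "marker ?k True \<noteq> marker ?k False"
    unfolding marker_def offset_def using base_prod_pos[OF digit_seq] by (simp add: less_imp_neq[symmetric])
  ultimately have "marker ?k True - marker ?k False \<in> zero_set M b" by (rule spectrum_of_diff)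
  then show False using offset(1)[of ?k] by (simp add: marker_def)
qed

text \<open>The defect decreases to some \<open>L \<ge> 0\<close>. If \<open>L\<close> were
  positive, a late block devoted to \<open>t\<close> would push the defect below its own
  limit.\<close>

lemma mass_stage_tendsto:
  assumes t: "t \<in> multipliers"
  shows "(\<lambda>j. mass t x (snd (stage \<alpha> j))) \<longlonglongrightarrow> 1"
proof -
  define D where "D j = 1 - mass t x (snd (stage \<alpha> j))" for j
  have D0: "0 \<le> D j" for j unfolding D_def using good_mass_le_1[OF good_stage t, of x \<alpha> j] by simp
  have "decseq D"
  proof (rule decseq_SucI)
    fix j
    have "mass t x (snd (stage \<alpha> j)) \<le> mass t x (snd (stage \<alpha> (Suc j)))"
      using good_stage[of \<alpha> "Suc j"] stage_mono[of j "Suc j" \<alpha>] by (intro mass_mono) (auto simp: good_def)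
    then show "D (Suc j) \<le> D j" unfolding D_def by linarith
  qed
  then obtain L where L: "D \<longlonglongrightarrow> L" "\<And>j. L \<le> D j" using decseq_convergent[of D 0] D0 by auto
  have "0 \<le> L" by (rule LIMSEQ_le_const[OF L(1)]) (use D0 in auto)
  define e where "e = (rate t)\<^sup>2"
  have e: "0 < e" "e \<le> 1" unfolding e_def using rate(1,2)[OF t] by (auto simp: power_le_one)
  have "L \<le> 0"
  proof (rule ccontr)
    assume "\<not> L \<le> 0"
    then have "0 < L" by simp
    \<comment> \<open>With defect below \<open>L + e * L / 4\<close> and error below
      \<open>L / 4\<close>, one contraction gives less than \<open>L - e * L / 2\<close>.\<close>
    then have "L < L + e * L / 4" using e by simp
    then have "eventually (\<lambda>j. D j < L + e * L / 4) sequentially"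
      using order_tendstoD(2)[OF L(1)] by blast
    moreover have "eventually (\<lambda>j. 1 / real (Suc j) < L / 4) sequentially"
    proof -
      have "(\<lambda>j. 1 / real (Suc j)) \<longlonglongrightarrow> 0" using LIMSEQ_inverse_real_of_nat by (simp add: inverse_eq_divide)
      then show ?thesis using \<open>0 < L\<close> by (intro order_tendstoD(2)[of _ 0]) auto
    qed
    ultimately obtain J where J: "\<And>j. J \<le> j \<Longrightarrow> D j < L + e * L / 4 \<and> 1 / real (Suc j) < L / 4"
      unfolding eventually_sequentially by (metis le_trans linear)
    \<comment> \<open>For \<open>j \<ge> n\<close> both windows of \<open>next_stage\<close> contain
      \<open>x\<close>, since the base product at stage \<open>j\<close> is at least
      \<open>j\<close>.\<close>
    obtain n :: nat where n: "4 * \<bar>x\<bar> \<le> real n" using real_arch_simple by blast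
    obtain j where j: "max J n \<le> j" "schedule j = t" using schedule_frequently[OF t] by blast
    have "4 * \<bar>x\<bar> \<le> real j" using n j(1) by linarith
    moreover have "real j \<le> real (P (fst (stage \<alpha> j)))"
    proof -
      have "j \<le> fst (stage \<alpha> j)" by (rule stage_level)
      also have "\<dots> < 2 ^ fst (stage \<alpha> j)" by (rule less_exp)
      also have "\<dots> \<le> P (fst (stage \<alpha> j))" by (rule base_prod_ge[OF digit_seq])
      finally show ?thesis by simp
    qed
    ultimately have "D (Suc j) \<le> (1 - e) * D j + e * (1 / real (Suc j))"
      using next_stage[of j \<alpha>] unfolding next_stage_def D_def e_def j(2) by simp
    also have "\<dots> \<le> (1 - e) * (L + e * L / 4) + e * (L / 4)"
      using J[of j] j(1) e by (intro add_mono mult_left_mono) auto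
    also have "\<dots> = L - e * L / 2 - e * e * L / 4" by (simp add: field_simps)
    also have "\<dots> < L" using e \<open>0 < L\<close> by (smt (verit) divide_pos_pos mult_pos_pos)
    finally show False using L(2)[of "Suc j"] by simp
  qed
  then have "D \<longlonglongrightarrow> 0" using L(1) \<open>0 \<le> L\<close> by simp
  then have "(\<lambda>j. 1 - D j) \<longlonglongrightarrow> 1 - 0" by (intro tendsto_intros)
  then show ?thesis by (simp add: D_def)
qed

end

section \<open>Density of exponentials\<close>

definition expo :: "real \<Rightarrow> real \<Rightarrow> complex" where
  "expo l x = cis (- 2 * pi * l * x)"

lemma expo_measurable [measurable]: "expo l \<in> borel_measurable borel"
  unfolding expo_def by (intro borel_measurable_continuous_onI continuous_intros)

lemma cmod_expo [simp]: "cmod (expo l x) = 1"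
  by (simp add: expo_def)

lemma expo_mult: "expo l x * expo l' x = expo (l + l') x"
  by (simp add: expo_def cis_mult algebra_simps)

lemma expo_mult_cnj: "expo l x * cnj (expo l' x) = expo (l - l') x"
  by (simp add: expo_def cis_cnj cis_mult algebra_simps)

lemma expo_0 [simp]: "expo 0 x = 1"
  by (simp add: expo_def)

lemma cos_power_expo_eq:
  assumes "L \<noteq> 0"
  shows "complex_of_real (cos (pi * (x - s) / L)) =
    cis (- pi * s / L) / 2 * expo (- 1 / (2 * L)) x + cis (pi * s / L) / 2 * expo (1 / (2 * L)) x"
proof -
  have 1: "cis (- pi * s / L) * expo (- 1 / (2 * L)) x = cis (pi * (x - s) / L)"
    using assms by (simp add: expo_def cis_mult field_simps)
  have "pi * s / L + - 2 * pi * (1 / (2 * L)) * x = - (pi * (x - s) / L)"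
    using assms by (simp add: field_simps)
  then have 2: "cis (pi * s / L) * expo (1 / (2 * L)) x = cis (- (pi * (x - s) / L))"
    by (simp only: expo_def cis_mult)
  have "complex_of_real (cos (pi * (x - s) / L))
      = (cis (pi * (x - s) / L) + cis (- (pi * (x - s) / L))) / 2"
    by (simp add: complex_eq_iff)
  then show ?thesis by (simp add: 1[symmetric] 2[symmetric] add_divide_distrib)
qed

context real_distribution
begin

lemma integrable_bounded:
  fixes f :: "real \<Rightarrow> 'b :: {banach, second_countable_topology}"
  assumes "f \<in> borel_measurable borel" "\<And>x. norm (f x) \<le> C"
  shows "integrable M f"
  using assms by (intro integrable_const_bound[of _ C]) auto

lemma in_L2_bounded:
  assumes "f \<in> borel_measurable borel" "\<And>x. cmod (f x) \<le> C"
  shows "in_L2 M f"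
proof -
  have "norm ((cmod (f x))\<^sup>2) \<le> C\<^sup>2" for x
    using power_mono[OF assms(2)[of x], of 2] by simp
  then have "integrable M (\<lambda>x. (cmod (f x))\<^sup>2)"
    using assms(1) by (intro integrable_bounded[of _ "C\<^sup>2"]) auto
  then show ?thesis using assms(1) by (simp add: in_L2_def)
qed

lemma integral_expo: "(\<integral>x. expo l x \<partial>M) = char M (2 * pi * (- l))"
  by (simp add: char_def expo_def cis_conv_exp mult_ac)

lemma integrable_expo: "integrable M (expo l)"
  by (rule integrable_bounded[of _ 1]) auto

text \<open>A closed linear space of square integrable functions containing all exponentials is
  everything. Polynomials in \<open>cos (pi * (x - s) / L)\<close> yield the indicators of superlevel sets of this
  function, hence as \<open>L \<rightarrow> \<infinity>\<close> those of intervals centred at \<open>s\<close>.\<close>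

context
  fixes V :: "(real \<Rightarrow> complex) \<Rightarrow> bool"
  assumes V_add: "\<And>f g. V f \<Longrightarrow> V g \<Longrightarrow> V (\<lambda>x. f x + g x)"
    and V_scale: "\<And>f c. V f \<Longrightarrow> V (\<lambda>x. c * f x)"
    and V_expo: "\<And>l. V (expo l)"
    and V_closed: "\<And>f. in_L2 M f \<Longrightarrow>
      (\<And>\<epsilon>. 0 < \<epsilon> \<Longrightarrow> \<exists>g. V g \<and> (\<integral>x. (cmod (f x - g x))\<^sup>2 \<partial>M) < \<epsilon>) \<Longrightarrow> V f"
    and V_L2: "\<And>f. V f \<Longrightarrow> in_L2 M f"
begin

lemma V_measurable: "V f \<Longrightarrow> f \<in> borel_measurable borel"
  using V_L2[of f] measurable_cong_sets[OF events_eq_borel refl] by (auto simp: in_L2_def)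

lemma V_dominated:
  assumes V: "\<And>n. V (g n)" and f: "in_L2 M f"
    and lim: "\<And>x. (\<lambda>n. g n x) \<longlonglongrightarrow> f x"
    and w: "integrable M w" "\<And>n x. (cmod (f x - g n x))\<^sup>2 \<le> w x"
  shows "V f"
proof (rule V_closed[OF f])
  fix \<epsilon> :: real assume "0 < \<epsilon>"
  have [measurable]: "f \<in> borel_measurable M" "g n \<in> borel_measurable M" for n
    using V_L2[OF V] f by (auto simp: in_L2_def)
  have "(\<lambda>n. \<integral>x. (cmod (f x - g n x))\<^sup>2 \<partial>M) \<longlonglongrightarrow> (\<integral>x. 0 \<partial>M)"
  proof (rule integral_dominated_convergence[where w = w])
    show "AE x in M. (\<lambda>n. (cmod (f x - g n x))\<^sup>2) \<longlonglongrightarrow> 0"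
    proof (rule AE_I2)
      fix x
      have "(\<lambda>n. (cmod (f x - g n x))\<^sup>2) \<longlonglongrightarrow> (cmod (f x - f x))\<^sup>2"
        by (intro tendsto_intros lim)
      then show "(\<lambda>n. (cmod (f x - g n x))\<^sup>2) \<longlonglongrightarrow> 0" by simp
    qed
  qed (use w in auto)
  then have "(\<lambda>n. \<integral>x. (cmod (f x - g n x))\<^sup>2 \<partial>M) \<longlonglongrightarrow> 0" by simp
  from order_tendstoD(2)[OF this \<open>0 < \<epsilon>\<close>]
  obtain n where "(\<integral>x. (cmod (f x - g n x))\<^sup>2 \<partial>M) < \<epsilon>"
    by (auto simp: eventually_sequentially)
  then show "\<exists>g. V g \<and> (\<integral>x. (cmod (f x - g x))\<^sup>2 \<partial>M) < \<epsilon>" using V by blast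
qed

lemma V_bounded_limit:
  assumes V: "\<And>n. V (g n)" and bd: "\<And>n x. cmod (g n x) \<le> C"
    and lim: "\<And>x. (\<lambda>n. g n x) \<longlonglongrightarrow> f x"
  shows "V f"
proof -
  have f: "f \<in> borel_measurable borel"
    by (rule borel_measurable_LIMSEQ_metric[of g]) (use V_measurable V lim in auto)
  have fC: "cmod (f x) \<le> C" for x
    by (rule Lim_bounded[OF tendsto_norm[OF lim[of x]], where M = 0]) (use bd in auto)
  show ?thesis
  proof (rule V_dominated[OF V _ lim])
    show "in_L2 M f" by (rule in_L2_bounded[OF f fC])
    show "integrable M (\<lambda>x. (C + C)\<^sup>2)" by simp
    fix n x
    have "cmod (f x - g n x) \<le> C + C"
      using norm_triangle_ineq4[of "f x" "g n x"] fC[of x] bd[of n x] by linarith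
    then show "(cmod (f x - g n x))\<^sup>2 \<le> (C + C)\<^sup>2" by (intro power_mono) auto
  qed
qed

lemma V_const: "V (\<lambda>x. c)"
  using V_scale[OF V_expo[of 0], of c] by simp

lemma V_sum: "finite A \<Longrightarrow> (\<And>i. i \<in> A \<Longrightarrow> V (f i)) \<Longrightarrow> V (\<lambda>x. \<Sum>i\<in>A. f i x)"
  by (induction A rule: finite_induct) (auto intro: V_const V_add)

text \<open>\<open>V\<close> is only a linear space, not closed under products. Carrying an
  arbitrary exponential along turns multiplication by the cosine into two frequency shifts, so
  induction on the power works.\<close>

lemma V_cos_power_expo:
  assumes "L \<noteq> 0"
  shows "V (\<lambda>x. complex_of_real (cos (pi * (x - s) / L)) ^ n * expo l x)"
proof (induction n arbitrary: l)
  case (Suc n)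
  let ?c = "\<lambda>x. complex_of_real (cos (pi * (x - s) / L))"
  have "V (\<lambda>x. cis (- pi * s / L) / 2 * (?c x ^ n * expo (l - 1 / (2 * L)) x)
      + cis (pi * s / L) / 2 * (?c x ^ n * expo (l + 1 / (2 * L)) x))"
    by (intro V_add V_scale Suc.IH)
  also have "(\<lambda>x. cis (- pi * s / L) / 2 * (?c x ^ n * expo (l - 1 / (2 * L)) x)
      + cis (pi * s / L) / 2 * (?c x ^ n * expo (l + 1 / (2 * L)) x)) = (\<lambda>x. ?c x ^ Suc n * expo l x)"
  proof
    fix x
    have 1: "expo (l - 1 / (2 * L)) x = expo (- 1 / (2 * L)) x * expo l x"
      "expo (l + 1 / (2 * L)) x = expo (1 / (2 * L)) x * expo l x"
      by (simp_all add: expo_mult algebra_simps)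
    show "cis (- pi * s / L) / 2 * (?c x ^ n * expo (l - 1 / (2 * L)) x)
      + cis (pi * s / L) / 2 * (?c x ^ n * expo (l + 1 / (2 * L)) x) = ?c x ^ Suc n * expo l x"
      unfolding power_Suc cos_power_expo_eq[OF assms, of x s] 1 by (simp add: algebra_simps)
  qed
  finally show ?case .
qed (use V_expo in simp)

lemma V_continuous_cos:
  assumes "L \<noteq> 0" and G: "continuous_on {-1..1} G"
  shows "V (\<lambda>x. complex_of_real (G (cos (pi * (x - s) / L))))"
proof -
  have "\<exists>p. real_polynomial_function p \<and> (\<forall>u\<in>{-1..1 :: real}. \<bar>G u - p u\<bar> < 1 / real (Suc n))" for n
    using Stone_Weierstrass_real_polynomial_function[OF compact_Icc G, of "1 / real (Suc n)"] by (metis of_nat_0_less_iff zero_less_Suc zero_less_divide_1_iff)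
  then obtain p where p: "\<And>n. real_polynomial_function (p n)"
    "\<And>n u. u \<in> {-1..1 :: real} \<Longrightarrow> \<bar>G u - p n u\<bar> < 1 / real (Suc n)" by metis
  obtain C where "\<forall>y\<in>G ` {-1..1}. norm y \<le> C"
    using compact_imp_bounded[OF compact_continuous_image[OF G compact_Icc]]
    unfolding bounded_iff by blast
  then have C: "\<bar>G u\<bar> \<le> C" if "u \<in> {-1..1}" for u using that by force
  have cI: "cos (pi * (x - s) / L) \<in> {-1..1}" for x by simp
  show ?thesis
  proof (rule V_bounded_limit)
    fix n
    obtain a m where pn: "p n = (\<lambda>x. \<Sum>i\<le>m. a i * x ^ i)"
      using p(1)[of n] unfolding real_polynomial_function_iff_sum by blast
    have "V (\<lambda>x. \<Sum>i\<le>m. complex_of_real (a i) * (complex_of_real (cos (pi * (x - s) / L)) ^ i * expo 0 x))"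
      by (intro V_sum V_scale V_cos_power_expo assms) auto
    then show "V (\<lambda>x. complex_of_real (p n (cos (pi * (x - s) / L))))"
      by (simp add: pn)
    show "cmod (complex_of_real (p n (cos (pi * (x - s) / L)))) \<le> C + 1" for x
    proof -
      have "1 / real (Suc n) \<le> 1" by simp
      then show ?thesis using p(2)[OF cI[of x], of n] C[OF cI, of x] unfolding norm_of_real by linarith
    qed
  next
    fix x
    let ?u = "cos (pi * (x - s) / L)"
    have "(\<lambda>n. p n ?u) \<longlonglongrightarrow> G ?u"
    proof (rule LIM_zero_cancel, rule Lim_null_comparison)
      show "eventually (\<lambda>n. norm (p n ?u - G ?u) \<le> 1 / real (Suc n)) sequentially"
        using p(2)[OF cI[of x]] by (intro always_eventually allI) (simp add: abs_minus_commute less_imp_le)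
      show "(\<lambda>n. 1 / real (Suc n)) \<longlonglongrightarrow> 0"
        using LIMSEQ_inverse_real_of_nat by (simp add: inverse_eq_divide)
    qed
    then show "(\<lambda>n. complex_of_real (p n ?u)) \<longlonglongrightarrow> complex_of_real (G ?u)"
      by (rule tendsto_of_real)
  qed
qed

lemma V_superlevel_cos:
  assumes "L \<noteq> 0"
  shows "V (\<lambda>x. if \<alpha> \<le> cos (pi * (x - s) / L) then 1 else 0)"
proof (rule V_bounded_limit)
  \<comment> \<open>For positive \<open>n\<close> these ramps equal 1 from \<open>\<alpha>\<close>
    on and 0 below \<open>\<alpha> - 1 / n\<close>; they decrease to the indicator.\<close>
  let ?G = "\<lambda>n u. max 0 (min 1 (1 + real n * (u - \<alpha>)))"
  show "V (\<lambda>x. complex_of_real (?G n (cos (pi * (x - s) / L))))" for n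
    by (intro V_continuous_cos[OF assms, of "?G n"] continuous_intros)
  show "cmod (complex_of_real (?G n (cos (pi * (x - s) / L)))) \<le> 1" for n x
    by simp
  fix x
  let ?u = "cos (pi * (x - s) / L)"
  show "(\<lambda>n. complex_of_real (?G n ?u)) \<longlonglongrightarrow> (if \<alpha> \<le> ?u then 1 else 0)"
  proof (cases "\<alpha> \<le> ?u")
    case True
    then have "?G n ?u = 1" for n by simp
    then show ?thesis using True by simp
  next
    case False
    then obtain n0 :: nat where n0: "1 / (\<alpha> - ?u) \<le> real n0" using real_arch_simple by blast
    have "complex_of_real (?G n ?u) = 0" if "n0 \<le> n" for n
    proof -
      have "1 / (\<alpha> - ?u) \<le> real n" using n0 that by linarith
      then have "1 + real n * (?u - \<alpha>) \<le> 0" using False by (simp add: field_simps)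
      then show ?thesis by simp
    qed
    then have "eventually (\<lambda>n. complex_of_real (?G n ?u) = 0) sequentially"
      unfolding eventually_sequentially by blast
    then show ?thesis using False by (simp add: tendsto_eventually)
  qed
qed

lemma V_interval: "V (indicator {u..v})"
proof (cases "u \<le> v")
  case True
  define s where "s = (u + v) / 2"
  define w where "w = (v - u) / 2"
  have w: "0 \<le> w" using True by (simp add: w_def)
  have iff: "x \<in> {u..v} \<longleftrightarrow> \<bar>x - s\<bar> \<le> w" for x
    unfolding s_def w_def by (auto simp: abs_le_iff field_simps)
  \<comment> \<open>Within distance \<open>L n\<close> of \<open>s\<close> the cosine decreases in
    \<open>\<bar>x - s\<bar>\<close>, so the superlevel set is the interval there; its periodic
    copies, at multiples of \<open>2 * L n\<close>, move off to infinity.\<close>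
  define L where "L n = real n + w + 1" for n
  have L: "0 < L n" "w \<le> L n" for n using w by (auto simp: L_def)
  show ?thesis
  proof (rule V_bounded_limit)
    show "V (\<lambda>x. if cos (pi * w / L n) \<le> cos (pi * (x - s) / L n) then 1 else 0)" for n
      using L[of n] by (intro V_superlevel_cos) auto
    show "cmod (if cos (pi * w / L n) \<le> cos (pi * (x - s) / L n) then 1 else 0) \<le> 1" for n x
      by simp
    fix x
    obtain n0 :: nat where n0: "\<bar>x - s\<bar> \<le> real n0" using real_arch_simple by blast
    have "(if cos (pi * w / L n) \<le> cos (pi * (x - s) / L n) then 1 else 0) = (indicator {u..v} x :: complex)"
      if "n0 \<le> n" for n
    proof -
      have le: "\<bar>x - s\<bar> \<le> L n" using n0 that w by (simp add: L_def)
      have bound: "0 \<le> pi * y / L n \<and> pi * y / L n \<le> pi" if "0 \<le> y" "y \<le> L n" for y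
        using that L(1)[of n] by (simp add: divide_le_eq)
      have "cos (pi * y / L n) = cos (pi * \<bar>y\<bar> / L n)" for y
        by (cases "0 \<le> y") simp_all
      from this[of "x - s"]
      have "cos (pi * w / L n) \<le> cos (pi * (x - s) / L n) \<longleftrightarrow> pi * \<bar>x - s\<bar> / L n \<le> pi * w / L n"
        using cos_mono_le_eq[of "pi * w / L n" "pi * \<bar>x - s\<bar> / L n"] bound[OF w L(2)] bound[OF abs_ge_zero le]
        by simp
      also have "\<dots> \<longleftrightarrow> x \<in> {u..v}" unfolding iff using L(1)[of n] by (simp add: divide_le_cancel)
      finally show ?thesis by (simp add: indicator_def)
    qed
    then have "eventually (\<lambda>n. (if cos (pi * w / L n) \<le> cos (pi * (x - s) / L n) then 1 else 0)
        = (indicator {u..v} x :: complex)) sequentially"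
      unfolding eventually_sequentially by blast
    then show "(\<lambda>n. if cos (pi * w / L n) \<le> cos (pi * (x - s) / L n) then 1 else 0)
        \<longlonglongrightarrow> (indicator {u..v} x :: complex)"
      by (rule tendsto_eventually)
  qed
next
  case False
  then have "indicator {u..v} = (\<lambda>x. 0 :: complex)" by (auto simp: indicator_def)
  then show ?thesis by (simp add: V_const)
qed

lemma V_borel:
  assumes "A \<in> sets borel"
  shows "V (indicator A)"
proof -
  \<comment> \<open>Bounds in the wrong order give the empty set, so this generator is closed under
    intersection.\<close>
  let ?G = "range (\<lambda>(a, b). {a..b :: real})"
  have "Int_stable ?G"
  proof (rule Int_stableI)
    fix A B assume "A \<in> ?G" "B \<in> ?G"
    then obtain a b c d where "A = {a..b}" "B = {c..d}" by auto
    then have "A \<inter> B = (\<lambda>(a, b). {a..b}) (max a c, min b d)" by auto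
    then show "A \<inter> B \<in> ?G" by blast
  qed
  moreover have "?G \<subseteq> Pow UNIV" by simp
  moreover have "A \<in> sigma_sets UNIV ?G" using assms by (simp add: borel_eq_atLeastAtMost)
  ultimately show ?thesis
  proof (induction rule: sigma_sets_induct_disjoint)
    case (basic A)
    then show ?case using V_interval by auto
  next
    case empty
    have "indicator {} = (\<lambda>x. 0 :: complex)" by auto
    then show ?case by (simp add: V_const)
  next
    case (compl A)
    have "indicator (UNIV - A) = (\<lambda>x. 1 + (- 1) * indicator A x :: complex)"
      by (auto simp: indicator_def)
    then show ?case using V_add[OF V_const[of 1] V_scale[OF compl.IH, of "- 1"]] by simp
  next
    case (union A)
    show ?case
    proof (rule V_bounded_limit)
      have eq: "(\<Sum>i<n. indicator (A i) x) = (indicator (\<Union>i<n. A i) x :: complex)" for n x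
        using union(1) by (intro indicator_UN_disjoint[symmetric]) (auto intro: disjoint_family_on_mono)
      show "V (\<lambda>x. \<Sum>i<n. indicator (A i) x)" for n
        by (rule V_sum) (use union in auto)
      show "cmod (\<Sum>i<n. indicator (A i) x) \<le> 1" for n x
        unfolding eq by (simp add: indicator_def)
      fix x
      show "(\<lambda>n. \<Sum>i<n. indicator (A i) x) \<longlonglongrightarrow> (indicator (\<Union> (range A)) x :: complex)"
        unfolding eq by (rule LIMSEQ_indicator_UN)
    qed
  qed
qed

lemma V_simple:
  assumes "simple_function M g"
  shows "V g"
proof -
  have fin: "finite (range g)" using simple_functionD(1)[OF assms] by simp
  have "V (\<lambda>x. \<Sum>y\<in>range g. y * indicator (g -` {y}) x)"
  proof (intro V_sum fin V_scale V_borel)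
    fix y show "g -` {y} \<in> sets borel" using simple_functionD(2)[OF assms, of "{y}"] by simp
  qed
  also have "(\<lambda>x. \<Sum>y\<in>range g. y * indicator (g -` {y}) x) = g"
  proof
    fix x
    have "(\<Sum>y\<in>range g. y * indicator (g -` {y}) x) = (\<Sum>y\<in>range g. if y = g x then y else 0)"
      by (intro sum.cong) (auto simp: indicator_def)
    then show "(\<Sum>y\<in>range g. y * indicator (g -` {y}) x) = g x" using fin by simp
  qed
  finally show ?thesis .
qed

lemma V_everything:
  assumes f: "in_L2 M f"
  shows "V f"
proof -
  have "f \<in> borel_measurable M" using f by (simp add: in_L2_def)
  from borel_measurable_implies_sequence_metric[OF this, of 0]
  obtain g where g: "\<And>i. simple_function M (g i)" "\<And>x. (\<lambda>i. g i x) \<longlonglongrightarrow> f x"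
    "\<And>i x. cmod (g i x) \<le> 2 * cmod (f x)"
    by auto
  show ?thesis
  proof (rule V_dominated[OF V_simple[OF g(1)] f g(2)])
    \<comment> \<open>The simple functions satisfy \<open>cmod (g n x) \<le> 2 * cmod (f x)\<close>,
      so the difference is at most \<open>3 * cmod (f x)\<close>.\<close>
    show "integrable M (\<lambda>x. 9 * (cmod (f x))\<^sup>2)" using f by (simp add: in_L2_def)
    fix n x
    have "cmod (f x - g n x) \<le> 3 * cmod (f x)"
      using norm_triangle_ineq4[of "f x" "g n x"] g(3)[of n x] by linarith
    then have "(cmod (f x - g n x))\<^sup>2 \<le> (3 * cmod (f x))\<^sup>2" by (intro power_mono) auto
    then show "(cmod (f x - g n x))\<^sup>2 \<le> 9 * (cmod (f x))\<^sup>2" by (simp add: power_mult_distrib)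
  qed
qed

end

end

section \<open>Orthogonality, completeness and infinite convolutions\<close>

context real_distribution
begin

lemma in_L2_add:
  assumes "in_L2 M f" "in_L2 M g"
  shows "in_L2 M (\<lambda>x. f x + g x)"
proof -
  have [measurable]: "f \<in> borel_measurable M" "g \<in> borel_measurable M"
    using assms by (auto simp: in_L2_def)
  have "integrable M (\<lambda>x. (cmod (f x + g x))\<^sup>2)"
  proof (rule Bochner_Integration.integrable_bound)
    show "integrable M (\<lambda>x. 2 * (cmod (f x))\<^sup>2 + 2 * (cmod (g x))\<^sup>2)"
      using assms by (simp add: in_L2_def)
    show "AE x in M. norm ((cmod (f x + g x))\<^sup>2) \<le> norm (2 * (cmod (f x))\<^sup>2 + 2 * (cmod (g x))\<^sup>2)"
    proof (rule AE_I2)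
      fix x
      have "(cmod (f x + g x))\<^sup>2 \<le> (cmod (f x) + cmod (g x))\<^sup>2"
        by (intro power_mono norm_triangle_ineq) simp
      also have "\<dots> \<le> 2 * (cmod (f x))\<^sup>2 + 2 * (cmod (g x))\<^sup>2"
        using sum_squares_bound[of "cmod (f x)" "cmod (g x)"] by (simp add: power2_sum)
      finally show "norm ((cmod (f x + g x))\<^sup>2) \<le> norm (2 * (cmod (f x))\<^sup>2 + 2 * (cmod (g x))\<^sup>2)"
        by simp
    qed
  qed simp
  then show ?thesis by (simp add: in_L2_def)
qed

lemma in_L2_scale: "in_L2 M f \<Longrightarrow> in_L2 M (\<lambda>x. c * f x)"
  by (auto simp: in_L2_def norm_mult power_mult_distrib)

lemma in_L2_diff: "in_L2 M f \<Longrightarrow> in_L2 M g \<Longrightarrow> in_L2 M (\<lambda>x. f x - g x)"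
  using in_L2_add[of f "\<lambda>x. - 1 * g x"] in_L2_scale[of g "- 1"] by simp

lemma in_L2_expo: "in_L2 M (expo l)"
  by (rule in_L2_bounded[of _ 1]) auto

lemma in_L2_span: "in_L2 M (\<lambda>x. \<Sum>l\<in>A. c l * expo l x)"
proof (rule in_L2_bounded)
  show "(\<lambda>x. \<Sum>l\<in>A. c l * expo l x) \<in> borel_measurable borel" by measurable
  show "cmod (\<Sum>l\<in>A. c l * expo l x) \<le> (\<Sum>l\<in>A. cmod (c l))" for x
    by (rule order_trans[OF norm_sum]) (simp add: norm_mult)
qed

lemma integral_cmod_sq_triangle:
  assumes "in_L2 M f" "in_L2 M g"
  shows "(\<integral>x. (cmod (f x + g x))\<^sup>2 \<partial>M) \<le> 2 * (\<integral>x. (cmod (f x))\<^sup>2 \<partial>M) + 2 * (\<integral>x. (cmod (g x))\<^sup>2 \<partial>M)"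
proof -
  have "(\<integral>x. (cmod (f x + g x))\<^sup>2 \<partial>M) \<le> (\<integral>x. 2 * (cmod (f x))\<^sup>2 + 2 * (cmod (g x))\<^sup>2 \<partial>M)"
  proof (rule integral_mono)
    show "integrable M (\<lambda>x. (cmod (f x + g x))\<^sup>2)" using in_L2_add[OF assms] by (simp add: in_L2_def)
    show "integrable M (\<lambda>x. 2 * (cmod (f x))\<^sup>2 + 2 * (cmod (g x))\<^sup>2)"
      using assms by (simp add: in_L2_def)
    fix x
    have "(cmod (f x + g x))\<^sup>2 \<le> (cmod (f x) + cmod (g x))\<^sup>2"
      by (intro power_mono norm_triangle_ineq) simp
    also have "\<dots> \<le> 2 * (cmod (f x))\<^sup>2 + 2 * (cmod (g x))\<^sup>2"
      using sum_squares_bound[of "cmod (f x)" "cmod (g x)"] by (simp add: power2_sum)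
    finally show "(cmod (f x + g x))\<^sup>2 \<le> 2 * (cmod (f x))\<^sup>2 + 2 * (cmod (g x))\<^sup>2" .
  qed
  also have "\<dots> = 2 * (\<integral>x. (cmod (f x))\<^sup>2 \<partial>M) + 2 * (\<integral>x. (cmod (g x))\<^sup>2 \<partial>M)"
    using assms by (simp add: in_L2_def)
  finally show ?thesis .
qed

lemma inner_L2_expo: "inner_L2 M (expo l) (expo l') = char M (2 * pi * (l' - l))"
  by (simp add: inner_L2_def expo_mult_cnj integral_expo)

lemma char_uminus: "char M (- t) = cnj (char M t)"
proof -
  have "cnj (char M t) = (\<integral>x. cnj (iexp (t * x)) \<partial>M)"
    unfolding char_def by (simp flip: integral_cnj)
  also have "\<dots> = char M (- t)" unfolding char_def by (simp add: exp_cnj)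
  finally show ?thesis by simp
qed

definition orthogonal_freqs :: "real set \<Rightarrow> bool" where
  "orthogonal_freqs A \<longleftrightarrow> (\<forall>l\<in>A. \<forall>l'\<in>A. l \<noteq> l' \<longrightarrow> char M (2 * pi * (l - l')) = 0)"

text \<open>Pythagoras: the squared distance is the Bessel defect plus the squared distance of
  \<open>c\<close> from the Fourier coefficients. Bessel's inequality, Parseval's identity and the
  completeness criterion are all read off from it.\<close>

lemma integral_expo_minus_span:
  assumes fin: "finite A" and ortho: "orthogonal_freqs A"
  shows "(\<integral>x. (cmod (expo \<xi> x - (\<Sum>l\<in>A. c l * expo l x)))\<^sup>2 \<partial>M) =
    1 - (\<Sum>l\<in>A. (cmod (char M (2 * pi * (l - \<xi>))))\<^sup>2)
      + (\<Sum>l\<in>A. (cmod (char M (2 * pi * (l - \<xi>)) - c l))\<^sup>2)"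
proof -
  define g where "g l = char M (2 * pi * (l - \<xi>))" for l
  have int: "(\<integral>x. expo (l - l') x \<partial>M) = (if l = l' then 1 else 0)" if "l \<in> A" "l' \<in> A" for l l'
    using ortho that unfolding integral_expo orthogonal_freqs_def
    by (auto simp: char_zero dest!: bspec[of _ _ l'] bspec[of _ _ l])
  have g1: "(\<integral>x. expo (\<xi> - l) x \<partial>M) = g l" for l by (simp add: integral_expo g_def)
  have g2: "(\<integral>x. expo (l - \<xi>) x \<partial>M) = cnj (g l)" for l
    unfolding integral_expo g_def char_uminus[symmetric] by (simp add: algebra_simps)
  have pt: "complex_of_real ((cmod (expo \<xi> x - (\<Sum>l\<in>A. c l * expo l x)))\<^sup>2) =
      1 - (\<Sum>l\<in>A. cnj (c l) * expo (\<xi> - l) x) - (\<Sum>l\<in>A. c l * expo (l - \<xi>) x)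
        + (\<Sum>l\<in>A. \<Sum>l'\<in>A. c l * cnj (c l') * expo (l - l') x)" for x
  proof -
    have 1: "expo \<xi> x * cnj (\<Sum>l\<in>A. c l * expo l x) = (\<Sum>l\<in>A. cnj (c l) * expo (\<xi> - l) x)"
      by (simp add: sum_distrib_left expo_mult_cnj[symmetric] mult_ac)
    have 2: "(\<Sum>l\<in>A. c l * expo l x) * cnj (expo \<xi> x) = (\<Sum>l\<in>A. c l * expo (l - \<xi>) x)"
      by (simp add: sum_distrib_right expo_mult_cnj[symmetric] mult.assoc)
    have 3: "(\<Sum>l\<in>A. c l * expo l x) * cnj (\<Sum>l\<in>A. c l * expo l x)
        = (\<Sum>l\<in>A. \<Sum>l'\<in>A. c l * cnj (c l') * expo (l - l') x)"
      by (simp add: sum_product expo_mult_cnj[symmetric] mult_ac)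
    have 4: "expo \<xi> x * cnj (expo \<xi> x) = 1" by (simp add: expo_mult_cnj)
    show ?thesis
      unfolding complex_norm_square complex_cnj_diff
      by (simp only: left_diff_distrib right_diff_distrib 1 2 3 4) simp
  qed
  have "complex_of_real (\<integral>x. (cmod (expo \<xi> x - (\<Sum>l\<in>A. c l * expo l x)))\<^sup>2 \<partial>M)
      = (\<integral>x. complex_of_real ((cmod (expo \<xi> x - (\<Sum>l\<in>A. c l * expo l x)))\<^sup>2) \<partial>M)"
    by (rule integral_complex_of_real[symmetric])
  also have "\<dots> = 1 - (\<Sum>l\<in>A. cnj (c l) * g l) - (\<Sum>l\<in>A. c l * cnj (g l))
      + (\<Sum>l\<in>A. \<Sum>l'\<in>A. c l * cnj (c l') * (\<integral>x. expo (l - l') x \<partial>M))"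
    unfolding pt using integrable_expo prob_space by (simp add: g1 g2)
  also have "(\<Sum>l\<in>A. \<Sum>l'\<in>A. c l * cnj (c l') * (\<integral>x. expo (l - l') x \<partial>M)) = (\<Sum>l\<in>A. c l * cnj (c l))"
  proof (rule sum.cong[OF refl])
    fix l assume l: "l \<in> A"
    have "(\<Sum>l'\<in>A. c l * cnj (c l') * (\<integral>x. expo (l - l') x \<partial>M)) = (\<Sum>l'\<in>A. if l' = l then c l * cnj (c l) else 0)"
      using l by (intro sum.cong refl) (auto simp: int)
    then show "(\<Sum>l'\<in>A. c l * cnj (c l') * (\<integral>x. expo (l - l') x \<partial>M)) = c l * cnj (c l)"
      using l fin by simp
  qed
  also have "1 - (\<Sum>l\<in>A. cnj (c l) * g l) - (\<Sum>l\<in>A. c l * cnj (g l)) + (\<Sum>l\<in>A. c l * cnj (c l))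
      = 1 - (\<Sum>l\<in>A. complex_of_real ((cmod (g l))\<^sup>2)) + (\<Sum>l\<in>A. complex_of_real ((cmod (g l - c l))\<^sup>2))"
    unfolding complex_norm_square
    by (simp add: algebra_simps sum.distrib sum_subtractf)
  also have "\<dots> = complex_of_real (1 - (\<Sum>l\<in>A. (cmod (g l))\<^sup>2) + (\<Sum>l\<in>A. (cmod (g l - c l))\<^sup>2))"
    by simp
  finally show ?thesis unfolding g_def by (simp only: of_real_eq_iff)
qed

lemma bessel:
  assumes "finite A" "orthogonal_freqs A"
  shows "(\<Sum>l\<in>A. (cmod (char M (2 * pi * (l - \<xi>))))\<^sup>2) \<le> 1"
proof -
  have "0 \<le> (\<integral>x. (cmod (expo \<xi> x - (\<Sum>l\<in>A. char M (2 * pi * (l - \<xi>)) * expo l x)))\<^sup>2 \<partial>M)"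
    by simp
  then show ?thesis unfolding integral_expo_minus_span[OF assms] by simp
qed

lemma is_spectrum_orthogonal: "is_spectrum M \<Lambda> \<Longrightarrow> orthogonal_freqs \<Lambda>"
  unfolding is_spectrum_def orthonormal_basis_L2_def orthogonal_freqs_def expo_def[symmetric]
    inner_L2_expo by metis

lemma is_spectrum_parseval:
  assumes "is_spectrum M \<Lambda>" "0 < \<eta>"
  shows "\<exists>A. finite A \<and> A \<subseteq> \<Lambda> \<and> 1 - \<eta> < (\<Sum>l\<in>A. (cmod (char M (2 * pi * (l - \<xi>))))\<^sup>2)"
proof -
  have "0 < sqrt \<eta>" using assms(2) by simp
  then obtain A c where A: "finite A" "A \<subseteq> \<Lambda>"
    "norm_L2 M (\<lambda>x. expo \<xi> x - (\<Sum>l\<in>A. c l * expo l x)) < sqrt \<eta>"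
    using assms(1) in_L2_expo[of \<xi>]
    unfolding is_spectrum_def orthonormal_basis_L2_def expo_def[symmetric] by blast
  have ortho: "orthogonal_freqs A"
    using is_spectrum_orthogonal[OF assms(1)] A(2) unfolding orthogonal_freqs_def by blast
  have "(\<integral>x. (cmod (expo \<xi> x - (\<Sum>l\<in>A. c l * expo l x)))\<^sup>2 \<partial>M) < \<eta>"
    using A(3) unfolding norm_L2_def by simp
  moreover have "0 \<le> (\<Sum>l\<in>A. (cmod (char M (2 * pi * (l - \<xi>)) - c l))\<^sup>2)"
    by (intro sum_nonneg) simp
  ultimately have "1 - \<eta> < (\<Sum>l\<in>A. (cmod (char M (2 * pi * (l - \<xi>))))\<^sup>2)"
    unfolding integral_expo_minus_span[OF A(1) ortho] by linarith
  then show ?thesis using A by blast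
qed

text \<open>The Jorgensen-Pedersen criterion. Parseval puts every exponential into the closed span
  of those with frequencies in \<open>\<Lambda>\<close>, and by \<open>V_everything\<close> a closed
  space containing all exponentials is the whole space.\<close>

lemma is_spectrumI:
  assumes count: "countable \<Lambda>" and ortho: "orthogonal_freqs \<Lambda>"
    and parseval: "\<And>\<xi> \<eta>. 0 < \<eta> \<Longrightarrow>
      \<exists>A. finite A \<and> A \<subseteq> \<Lambda> \<and> 1 - \<eta> < (\<Sum>l\<in>A. (cmod (char M (2 * pi * (l - \<xi>))))\<^sup>2)"
  shows "is_spectrum M \<Lambda>"
proof -
  define V where "V f \<longleftrightarrow> in_L2 M f \<and> (\<forall>\<epsilon>>0. \<exists>A c. finite A \<and> A \<subseteq> \<Lambda> \<and>
    (\<integral>x. (cmod (f x - (\<Sum>l\<in>A. c l * expo l x)))\<^sup>2 \<partial>M) < \<epsilon>)" for f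
  have approx: "\<exists>A c. finite A \<and> A \<subseteq> \<Lambda> \<and> (\<integral>x. (cmod (f x - (\<Sum>l\<in>A. c l * expo l x)))\<^sup>2 \<partial>M) < \<epsilon>"
    if "V f" "0 < \<epsilon>" for f \<epsilon>
    using that unfolding V_def by blast
  have all: "V f" if "in_L2 M f" for f
  proof (rule V_everything[of V])
    fix f g assume f: "V f" and g: "V g"
    show "V (\<lambda>x. f x + g x)"
      unfolding V_def
    proof (intro conjI allI impI)
      show "in_L2 M (\<lambda>x. f x + g x)" using f g by (simp add: V_def in_L2_add)
      fix \<epsilon> :: real assume "0 < \<epsilon>"
      \<comment> \<open>\<open>integral_cmod_sq_triangle\<close> doubles both errors.\<close>
      then have \<epsilon>: "0 < \<epsilon> / 4" by simp
      obtain A c where A: "finite A" "A \<subseteq> \<Lambda>"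
        "(\<integral>x. (cmod (f x - (\<Sum>l\<in>A. c l * expo l x)))\<^sup>2 \<partial>M) < \<epsilon> / 4"
        using approx[OF f \<epsilon>] by (elim exE conjE)
      obtain A' c' where A': "finite A'" "A' \<subseteq> \<Lambda>"
        "(\<integral>x. (cmod (g x - (\<Sum>l\<in>A'. c' l * expo l x)))\<^sup>2 \<partial>M) < \<epsilon> / 4"
        using approx[OF g \<epsilon>] by (elim exE conjE)
      define d where "d l = (if l \<in> A then c l else 0) + (if l \<in> A' then c' l else 0)" for l
      have d: "(\<Sum>l\<in>A \<union> A'. d l * expo l x)
          = (\<Sum>l\<in>A. c l * expo l x) + (\<Sum>l\<in>A'. c' l * expo l x)" for x
      proof -
        have "(\<Sum>l\<in>A. c l * expo l x) = (\<Sum>l\<in>A \<union> A'. (if l \<in> A then c l else 0) * expo l x)"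
          using A(1) A'(1) by (intro sum.mono_neutral_cong_left) auto
        moreover have "(\<Sum>l\<in>A'. c' l * expo l x) = (\<Sum>l\<in>A \<union> A'. (if l \<in> A' then c' l else 0) * expo l x)"
          using A(1) A'(1) by (intro sum.mono_neutral_cong_left) auto
        ultimately show ?thesis by (simp add: d_def distrib_right sum.distrib)
      qed
      have "(\<integral>x. (cmod (f x + g x - (\<Sum>l\<in>A \<union> A'. d l * expo l x)))\<^sup>2 \<partial>M)
          = (\<integral>x. (cmod ((f x - (\<Sum>l\<in>A. c l * expo l x)) + (g x - (\<Sum>l\<in>A'. c' l * expo l x))))\<^sup>2 \<partial>M)"
        unfolding d by (simp add: algebra_simps)
      also have "\<dots> \<le> 2 * (\<integral>x. (cmod (f x - (\<Sum>l\<in>A. c l * expo l x)))\<^sup>2 \<partial>M)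
          + 2 * (\<integral>x. (cmod (g x - (\<Sum>l\<in>A'. c' l * expo l x)))\<^sup>2 \<partial>M)"
        using f g by (intro integral_cmod_sq_triangle in_L2_diff in_L2_span) (auto simp: V_def)
      also have "\<dots> < \<epsilon>" using A(3) A'(3) by linarith
      finally show "\<exists>A c. finite A \<and> A \<subseteq> \<Lambda> \<and>
          (\<integral>x. (cmod (f x + g x - (\<Sum>l\<in>A. c l * expo l x)))\<^sup>2 \<partial>M) < \<epsilon>"
        using A(1,2) A'(1,2) by (intro exI[of _ "A \<union> A'"] exI[of _ d]) auto
    qed
  next
    fix f and a :: complex assume f: "V f"
    show "V (\<lambda>x. a * f x)"
      unfolding V_def
    proof (intro conjI allI impI)
      show "in_L2 M (\<lambda>x. a * f x)" using f by (simp add: V_def in_L2_scale)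
      fix \<epsilon> :: real assume \<epsilon>: "0 < \<epsilon>"
      \<comment> \<open>The added 1 keeps the divisor positive when \<open>a = 0\<close>.\<close>
      have pos: "0 < (cmod a)\<^sup>2 + 1" by (simp add: add_nonneg_pos)
      obtain A c where A: "finite A" "A \<subseteq> \<Lambda>"
        "(\<integral>x. (cmod (f x - (\<Sum>l\<in>A. c l * expo l x)))\<^sup>2 \<partial>M) < \<epsilon> / ((cmod a)\<^sup>2 + 1)"
        using approx[OF f divide_pos_pos[OF \<epsilon> pos]] by (elim exE conjE)
      let ?I = "\<integral>x. (cmod (f x - (\<Sum>l\<in>A. c l * expo l x)))\<^sup>2 \<partial>M"
      have "(\<integral>x. (cmod (a * f x - (\<Sum>l\<in>A. (a * c l) * expo l x)))\<^sup>2 \<partial>M)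
          = (\<integral>x. (cmod a)\<^sup>2 * (cmod (f x - (\<Sum>l\<in>A. c l * expo l x)))\<^sup>2 \<partial>M)"
        by (simp add: norm_mult[symmetric] power_mult_distrib[symmetric] right_diff_distrib
            sum_distrib_left mult.assoc)
      also have "\<dots> = (cmod a)\<^sup>2 * ?I" by simp
      also have "\<dots> \<le> ((cmod a)\<^sup>2 + 1) * ?I" by (intro mult_right_mono) auto
      also have "\<dots> < \<epsilon>" using A(3) pos by (simp add: pos_less_divide_eq mult.commute)
      finally show "\<exists>A c. finite A \<and> A \<subseteq> \<Lambda> \<and>
          (\<integral>x. (cmod (a * f x - (\<Sum>l\<in>A. c l * expo l x)))\<^sup>2 \<partial>M) < \<epsilon>"
        using A(1,2) by (intro exI[of _ A] exI[of _ "\<lambda>l. a * c l"]) simp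
    qed
  next
    fix \<xi>
    show "V (expo \<xi>)"
      unfolding V_def
    proof (intro conjI allI impI in_L2_expo)
      fix \<epsilon> :: real assume "0 < \<epsilon>"
      from parseval[OF this, of \<xi>] obtain A where A: "finite A" "A \<subseteq> \<Lambda>"
        "1 - \<epsilon> < (\<Sum>l\<in>A. (cmod (char M (2 * pi * (l - \<xi>))))\<^sup>2)" by blast
      have "orthogonal_freqs A" using ortho A(2) unfolding orthogonal_freqs_def by blast
      from integral_expo_minus_span[OF A(1) this, of \<xi> "\<lambda>l. char M (2 * pi * (l - \<xi>))"] A
      show "\<exists>A c. finite A \<and> A \<subseteq> \<Lambda> \<and>
          (\<integral>x. (cmod (expo \<xi> x - (\<Sum>l\<in>A. c l * expo l x)))\<^sup>2 \<partial>M) < \<epsilon>"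
        by (intro exI[of _ A] exI[of _ "\<lambda>l. char M (2 * pi * (l - \<xi>))"]) simp
    qed
  next
    fix f assume f: "in_L2 M f"
      and close: "\<And>\<epsilon>. 0 < \<epsilon> \<Longrightarrow> \<exists>g. V g \<and> (\<integral>x. (cmod (f x - g x))\<^sup>2 \<partial>M) < \<epsilon>"
    show "V f"
      unfolding V_def
    proof (intro conjI allI impI f)
      fix \<epsilon> :: real assume "0 < \<epsilon>"
      then have \<epsilon>: "0 < \<epsilon> / 4" by simp
      then obtain g where g: "V g" "(\<integral>x. (cmod (f x - g x))\<^sup>2 \<partial>M) < \<epsilon> / 4"
        using close by blast
      obtain A c where A: "finite A" "A \<subseteq> \<Lambda>"
        "(\<integral>x. (cmod (g x - (\<Sum>l\<in>A. c l * expo l x)))\<^sup>2 \<partial>M) < \<epsilon> / 4"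
        using approx[OF g(1) \<epsilon>] by (elim exE conjE)
      have "(\<integral>x. (cmod (f x - (\<Sum>l\<in>A. c l * expo l x)))\<^sup>2 \<partial>M)
          = (\<integral>x. (cmod ((f x - g x) + (g x - (\<Sum>l\<in>A. c l * expo l x))))\<^sup>2 \<partial>M)"
        by simp
      also have "\<dots> \<le> 2 * (\<integral>x. (cmod (f x - g x))\<^sup>2 \<partial>M)
          + 2 * (\<integral>x. (cmod (g x - (\<Sum>l\<in>A. c l * expo l x)))\<^sup>2 \<partial>M)"
        using f g(1) by (intro integral_cmod_sq_triangle in_L2_diff in_L2_span) (auto simp: V_def)
      also have "\<dots> < \<epsilon>" using A(3) g(2) by linarith
      finally show "\<exists>A c. finite A \<and> A \<subseteq> \<Lambda> \<and>
          (\<integral>x. (cmod (f x - (\<Sum>l\<in>A. c l * expo l x)))\<^sup>2 \<partial>M) < \<epsilon>"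
        using A(1,2) by blast
    qed
  next
    show "in_L2 M f" by fact
  qed (simp add: V_def)
  have norm: "norm_L2 M f < \<epsilon>" if "(\<integral>x. (cmod (f x))\<^sup>2 \<partial>M) < \<epsilon>\<^sup>2" "0 < \<epsilon>" for f \<epsilon>
    using that unfolding norm_L2_def by (simp add: real_less_lsqrt)
  show ?thesis
    unfolding is_spectrum_def orthonormal_basis_L2_def expo_def[symmetric] inner_L2_expo
  proof (intro conjI ballI allI impI count in_L2_expo)
    fix l l' assume "l \<in> \<Lambda>" "l' \<in> \<Lambda>"
    then show "char M (2 * pi * (l' - l)) = (if l = l' then 1 else 0)"
      using ortho unfolding orthogonal_freqs_def by (auto simp: char_zero)
  next
    fix f and \<epsilon> :: real assume "in_L2 M f" "0 < \<epsilon>"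
    then have \<epsilon>: "0 < \<epsilon>\<^sup>2" by simp
    obtain A c where A: "finite A" "A \<subseteq> \<Lambda>"
      "(\<integral>x. (cmod (f x - (\<Sum>l\<in>A. c l * expo l x)))\<^sup>2 \<partial>M) < \<epsilon>\<^sup>2"
      using approx[OF all[OF \<open>in_L2 M f\<close>] \<epsilon>] by (elim exE conjE)
    from norm[OF A(3) \<open>0 < \<epsilon>\<close>] A(1,2)
    show "\<exists>A c. finite A \<and> A \<subseteq> \<Lambda> \<and> norm_L2 M (\<lambda>x. f x - (\<Sum>l\<in>A. c l * expo l x)) < \<epsilon>"
      by (intro exI[of _ A] exI[of _ c] conjI)
  qed
qed

end

section \<open>The transform of the infinite convolution\<close>

lemma char_unif_meas:
  assumes "finite D" "D \<noteq> {}"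
  shows "char (unif_meas D) t = (\<Sum>x\<in>D. cis (t * x)) / of_nat (card D)"
proof -
  have "char (unif_meas D) t = (\<integral>x. cis (t * x) \<partial>measure_pmf (pmf_of_set D))"
    unfolding char_def unif_meas_def by (subst integral_distr) (auto simp: cis_conv_exp)
  also have "\<dots> = (\<Sum>x\<in>D. pmf (pmf_of_set D) x *\<^sub>R cis (t * x))"
    by (rule integral_measure_pmf) (use assms in auto)
  also have "\<dots> = (\<Sum>x\<in>D. cis (t * x)) / of_nat (card D)"
    using assms by (simp add: scaleR_conv_of_real sum_divide_distrib)
  finally show ?thesis .
qed

lemma char_convolution:
  assumes "real_distribution M1" "real_distribution M2"
  shows "char (M1 \<star> M2) t = char M1 t * char M2 t"
proof -
  interpret A: real_distribution M1 by fact
  interpret B: real_distribution M2 by fact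
  interpret pair_prob_space M1 M2 ..
  have int: "integrable (M1 \<Otimes>\<^sub>M M2) (\<lambda>p. iexp (t * (fst p + snd p)))"
    by (intro P.integrable_const_bound[of _ 1]) auto
  have "char (M1 \<star> M2) t = (\<integral>p. iexp (t * (fst p + snd p)) \<partial>(M1 \<Otimes>\<^sub>M M2))"
    unfolding char_def convolution_def by (subst integral_distr) (auto simp: split_beta')
  also have "\<dots> = (\<integral>x. (\<integral>y. iexp (t * (fst (x, y) + snd (x, y))) \<partial>M2) \<partial>M1)"
    by (rule integral_fst'[OF int, symmetric])
  also have "\<dots> = (\<integral>x. (\<integral>y. iexp (t * x) * iexp (t * y) \<partial>M2) \<partial>M1)"
    by (simp add: distrib_left exp_add[symmetric])
  also have "\<dots> = char M1 t * char M2 t"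
    unfolding char_def by (simp add: A.integrable_iexp B.integrable_iexp)
  finally show ?thesis .
qed

context
  fixes M b :: "nat \<Rightarrow> nat" and D :: "nat \<Rightarrow> real set"
  assumes digit_seq: "digit_seq M b"
    and D: "\<And>k. D (Suc k) = (\<lambda>d. real d / real (base_prod M (Suc k))) ` {..<b k}"
begin

lemma digits_finite: "finite (D (Suc k))" "D (Suc k) \<noteq> {}"
  using digit_seqD(2)[OF digit_seq, of k] by (auto simp: D lessThan_empty_iff)

lemma char_digits: "char (unif_meas (D (Suc k))) (2 * pi * x) = dmask (b k) (x / real (base_prod M (Suc k)))"
proof -
  have inj: "inj_on (\<lambda>d. real d / real (base_prod M (Suc k))) {..<b k}"
    using base_prod_pos[OF digit_seq, of "Suc k"] by (intro inj_onI) (simp del: base_prod_Suc)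
  then have "card (D (Suc k)) = b k" by (simp add: D card_image)
  moreover have "(\<Sum>y\<in>D (Suc k). cis (2 * pi * x * y)) = (\<Sum>d<b k. cis (2 * pi * real d * (x / real (base_prod M (Suc k)))))"
    unfolding D by (subst sum.reindex[OF inj]) (simp add: mult_ac)
  ultimately show ?thesis by (simp add: char_unif_meas[OF digits_finite] dmask_def)
qed

lemma char_fin_conv: "char (fin_conv D k) (2 * pi * x) = ft_fin M b k x"
proof (induction k)
  case 0
  show ?case by (simp add: char_def integral_return)
next
  case (Suc k)
  then show ?case
    by (simp add: char_convolution real_distribution_fin_conv real_distribution_unif_meas char_digits ft_fin_Suc
        del: base_prod_Suc)
qed

text \<open>Level \<open>i\<close> adds at most \<open>(M i - 1) / base_prod M (Suc i)\<close>, and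
  these bounds telescope. The common bounded support yields tightness.\<close>

lemma AE_fin_conv: "AE x in fin_conv D k. 0 \<le> x \<and> x \<le> 1 - 1 / real (base_prod M k)"
proof (induction k)
  case 0
  show ?case unfolding fin_conv.simps by (subst AE_return) auto
next
  case (Suc k)
  interpret A: real_distribution "fin_conv D k" by (rule real_distribution_fin_conv)
  interpret B: real_distribution "unif_meas (D (Suc k))" by (rule real_distribution_unif_meas)
  interpret pair_prob_space "fin_conv D k" "unif_meas (D (Suc k))" ..
  let ?Q = "real (base_prod M (Suc k))"
  have "AE y in unif_meas (D (Suc k)). y \<in> D (Suc k)"
    unfolding unif_meas_def using digits_finite[of k]
    by (subst AE_distr_iff) (auto simp: AE_measure_pmf_iff finite_imp_closed)
  then have B: "AE y in unif_meas (D (Suc k)). 0 \<le> y \<and> y \<le> (real (M k) - 1) / ?Q"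
  proof (rule AE_mp, intro AE_I2 impI)
    fix y assume "y \<in> D (Suc k)"
    then obtain d where d: "d < b k" "y = real d / ?Q" unfolding D by auto
    have "b k \<le> M k" using digit_seqD(1,3)[OF digit_seq, of k] by (intro dvd_imp_le) auto
    then have "real d \<le> real (M k) - 1" using d(1) by linarith
    then show "0 \<le> y \<and> y \<le> (real (M k) - 1) / ?Q" unfolding d(2) by (auto intro!: divide_right_mono)
  qed
  have eq: "1 - 1 / real (base_prod M k) + (real (M k) - 1) / ?Q = 1 - 1 / ?Q"
    using base_prod_pos[OF digit_seq, of k] digit_seqD(1)[OF digit_seq, of k] by (simp add: field_simps)
  have "AE x in fin_conv D k. AE y in unif_meas (D (Suc k)). 0 \<le> x + y \<and> x + y \<le> 1 - 1 / ?Q"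
    using Suc.IH
  proof eventually_elim
    case (elim x)
    from B show ?case by eventually_elim (use elim eq in argo)
  qed
  then have AE: "AE x in fin_conv D k. AE y in unif_meas (D (Suc k)). fst (x, y) + snd (x, y) \<in> {0..1 - 1 / ?Q}"
    by (simp only: fst_conv snd_conv atLeastAtMost_iff)
  let ?N = "fin_conv D k \<Otimes>\<^sub>M unif_meas (D (Suc k))"
  have "sets ?N = sets (borel \<Otimes>\<^sub>M borel)"
    by (intro sets_pair_measure_cong A.events_eq_borel B.events_eq_borel)
  then have meas: "(\<lambda>p. fst p + snd p) \<in> borel_measurable ?N"
    by (subst measurable_cong_sets[OF _ refl]) auto
  have "AE p in ?N. fst p + snd p \<in> {0..1 - 1 / ?Q}"
  proof (rule AE_pair_measure[OF _ AE])
    have "{p \<in> space ?N. fst p + snd p \<in> {0..1 - 1 / ?Q}} = (\<lambda>p. fst p + snd p) -` {0..1 - 1 / ?Q} \<inter> space ?N"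
      by blast
    also have "\<dots> \<in> sets ?N" by (rule measurable_sets[OF meas]) simp
    finally show "{p \<in> space ?N. fst p + snd p \<in> {0..1 - 1 / ?Q}} \<in> sets ?N" .
  qed
  then have "AE x in distr ?N borel (\<lambda>p. fst p + snd p). x \<in> {0..1 - 1 / ?Q}"
    by (subst AE_distr_iff[OF meas]) simp_all
  then show ?case by (simp only: fin_conv.simps convolution_def split_beta' atLeastAtMost_iff)
qed

lemma tight_fin_conv: "tight (fin_conv D)"
  unfolding tight_def
proof (intro conjI allI impI real_distribution_fin_conv)
  fix \<epsilon> :: real assume "0 < \<epsilon>"
  have "measure (fin_conv D k) {-1<..1} = 1" for k
  proof -
    interpret real_distribution "fin_conv D k" by (rule real_distribution_fin_conv)
    have "AE x in fin_conv D k. x \<in> {-1<..1}"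
      using AE_fin_conv[of k] by (rule AE_mp) (intro AE_I2 impI, auto intro: order_trans)
    then show ?thesis by (subst prob_eq_1) auto
  qed
  then show "\<exists>a b. a < b \<and> (\<forall>n. 1 - \<epsilon> < measure (fin_conv D n) {a<..b})"
    using \<open>0 < \<epsilon>\<close> by (intro exI[of _ "- 1"] exI[of _ 1]) simp
qed

text \<open>Tightness gives a weak limit along a subsequence. Its characteristic function is the
  pointwise limit of the whole sequence, so by Levy continuity the whole sequence converges to
  it.\<close>

lemma real_distribution_inf_conv: "real_distribution (inf_conv D)"
  and char_inf_conv: "char (inf_conv D) (2 * pi * x) = ft M b x"
proof -
  obtain s \<mu> where s: "strict_mono (s :: nat \<Rightarrow> nat)" and \<mu>: "real_distribution \<mu>"
    and conv: "weak_conv_m (fin_conv D \<circ> id \<circ> s) \<mu>"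
    using tight_imp_convergent_subsubsequence[OF tight_fin_conv, of id] by (auto simp: strict_mono_def)
  have lim: "(\<lambda>k. char (fin_conv D k) t) \<longlonglongrightarrow> ft M b (t / (2 * pi))" for t
    using ft_fin_tendsto[OF digit_seq, of "t / (2 * pi)"]
    by (simp flip: char_fin_conv)
  have eq: "char \<mu> t = ft M b (t / (2 * pi))" for t
  proof (rule LIMSEQ_unique)
    show "(\<lambda>k. char ((fin_conv D \<circ> id \<circ> s) k) t) \<longlonglongrightarrow> char \<mu> t"
      by (rule levy_continuity1[OF _ \<mu> conv]) (simp add: real_distribution_fin_conv)
    show "(\<lambda>k. char ((fin_conv D \<circ> id \<circ> s) k) t) \<longlonglongrightarrow> ft M b (t / (2 * pi))"
      using LIMSEQ_subseq_LIMSEQ[OF lim s] by (simp add: comp_def)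
  qed
  have "inf_conv D = \<mu>"
    using lim by (intro inf_conv_eqI \<mu> levy_continuity real_distribution_fin_conv) (simp_all add: eq)
  then show "real_distribution (inf_conv D)" "char (inf_conv D) (2 * pi * x) = ft M b x"
    using \<mu> eq by simp_all
qed

end

section \<open>Spectral eigenvalues and the main theorem\<close>

text \<open>The transform of \<open>{0..<g * c} = c * {0..<g} + {0..<c}\<close>. The geometric
  factor is cancelled; where \<open>c * y\<close> is an integer both sides are 0 or both are
  1.\<close>

lemma dmask_mult:
  assumes "1 \<le> g" "1 \<le> c"
  shows "dmask (g * c) y = dmask g (real c * y) * dmask c y"
proof (cases "cis (2 * pi * (real c * y)) = 1")
  case False
  then have "cis (2 * pi * y) \<noteq> 1"
    unfolding cis_eq_1_iff by (metis Ints_mult Ints_of_nat)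
  then have nz: "cis (2 * pi * y) - 1 \<noteq> 0" by simp
  have "of_nat (g * c) * dmask (g * c) y * (cis (2 * pi * y) - 1)
      = of_nat g * dmask g (real c * y) * (cis (2 * pi * (real c * y)) - 1)"
    unfolding dmask_geometric by (simp add: mult_ac)
  also have "\<dots> = of_nat g * dmask g (real c * y) * (of_nat c * dmask c y * (cis (2 * pi * y) - 1))"
    by (simp only: dmask_geometric)
  finally have "(of_nat (g * c) * (cis (2 * pi * y) - 1)) * dmask (g * c) y
      = (of_nat (g * c) * (cis (2 * pi * y) - 1)) * (dmask g (real c * y) * dmask c y)"
    by (simp add: mult_ac)
  moreover have "of_nat (g * c) * (cis (2 * pi * y) - 1) \<noteq> 0" using nz assms by simp
  ultimately show ?thesis by (metis mult_left_cancel)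
next
  case True
  then have cy: "real c * y \<in> \<int>" by (simp add: cis_eq_1_iff)
  show ?thesis
  proof (cases "y \<in> \<int>")
    case True
    then show ?thesis using cy assms by (simp add: dmask_int)
  next
    case False
    have "real (g * c) * y \<in> \<int>" using cy by (simp add: mult.assoc)
    then have "dmask (g * c) y = 0" using False assms dmask_eq_0_iff[of "g * c" y] by simp
    moreover have "dmask c y = 0" using False assms cy dmask_eq_0_iff[of c y] by simp
    ultimately show ?thesis by simp
  qed
qed

text \<open>The squared moduli at the points \<open>y + d / g\<close> sum to 1, and the one at
  \<open>y + 1 / g\<close> is nonzero because \<open>g * y\<close> is not an integer.\<close>

lemma cmod_dmask_less_1:
  assumes "2 \<le> g" "real g * y \<notin> \<int>"
  shows "cmod (dmask g y) < 1"
proof -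
  have "(\<Sum>d<g. (cmod (dmask g (y + real 1 * real d / real g)))\<^sup>2) = 1"
    by (rule sum_cmod_dmask_sq) (use assms in auto)
  moreover have "(\<Sum>d\<in>{0, 1}. (cmod (dmask g (y + real 1 * real d / real g)))\<^sup>2)
      \<le> (\<Sum>d<g. (cmod (dmask g (y + real 1 * real d / real g)))\<^sup>2)"
    by (rule sum_mono2) (use assms in auto)
  ultimately have le: "(cmod (dmask g y))\<^sup>2 + (cmod (dmask g (y + 1 / real g)))\<^sup>2 \<le> 1" by simp
  have "real g * (y + 1 / real g) = real g * y + 1" using assms(1) by (simp add: field_simps)
  then have "real g * (y + 1 / real g) \<notin> \<int>"
    using assms(2) by (metis Ints_1 Ints_diff add_diff_cancel_right')
  then have "dmask g (y + 1 / real g) \<noteq> 0" using assms(1) dmask_eq_0_iff[of g] by simp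
  then have "(cmod (dmask g y))\<^sup>2 < 1\<^sup>2" using le by (smt (verit) norm_eq_zero one_power2 zero_less_power2)
  then show ?thesis by (rule power2_less_imp_less) simp
qed

text \<open>Writing \<open>{0..<g c} = c {0..<g} + {0..<c}\<close> at level \<open>k\<close> splits \<open>\<mu> = \<delta> * \<rho>\<close>, with
  \<open>\<delta>\<close> uniform on \<open>g\<close> points.\<close>

lemma ft_factor:
  assumes d: "digit_seq M b" and g: "b k = g * c" "1 \<le> g" "1 \<le> c"
  shows "digit_seq M (b(k := c))"
    "ft M b x = dmask g (real c * (x / real (base_prod M (Suc k)))) * ft M (b(k := c)) x"
proof -
  have "c dvd M k" using digit_seqD(3)[OF d, of k] g(1) by (metis dvd_mult_right)
  then show d': "digit_seq M (b(k := c))" using d g(3) by (auto simp: digit_seq_def)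
  have "ft_fin M b k x = ft_fin M (b(k := c)) k x" by (simp add: ft_fin_def)
  moreover have "tail (Suc k) b = tail (Suc k) (b(k := c))" by (auto simp: tail_def)
  ultimately show "ft M b x = dmask g (real c * (x / real (base_prod M (Suc k)))) * ft M (b(k := c)) x"
    unfolding ft_split[OF d, of x "Suc k"] ft_split[OF d', of x "Suc k"] ft_fin_Suc g(1)
      dmask_mult[OF g(2,3)] fun_upd_same
    by (simp only: mult_ac)
qed

lemma spectral_eigenvalue_imp_coprime:
  assumes \<mu>: "real_distribution \<mu>" "\<And>x. char \<mu> (2 * pi * x) = ft M b x" and d: "digit_seq M b"
    and spec: "is_spectrum \<mu> \<Lambda>" "is_spectrum \<mu> ((\<lambda>l. real t * l) ` \<Lambda>)" and t: "1 \<le> t"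
  shows "coprime t (b i)"
proof (rule ccontr)
  assume "\<not> coprime t (b i)"
  \<comment> \<open>Minimality keeps \<open>t\<close> coprime to the digit counts of all earlier
    levels, so their zeros survive multiplication by \<open>t\<close>.\<close>
  define k where "k = (LEAST k. \<not> coprime t (b k))"
  have k: "\<not> coprime t (b k)" unfolding k_def by (rule LeastI) fact
  have before: "coprime t (b j)" if "j < k" for j
    using not_less_Least[of j "\<lambda>k. \<not> coprime t (b k)"] that by (simp add: k_def)
  define g where "g = gcd t (b k)"
  have "g \<noteq> 1" using k unfolding g_def by (simp add: coprime_iff_gcd_eq_1)
  moreover have "g \<noteq> 0" using t unfolding g_def by simp
  ultimately have g2: "2 \<le> g" by linarith
  obtain c where c: "b k = g * c" unfolding g_def by (meson dvdE gcd_dvd2)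
  obtain t' where t': "t = g * t'" unfolding g_def by (meson dvdE gcd_dvd1)
  have c1: "1 \<le> c" using c digit_seqD(2)[OF d, of k] by (cases c) auto
  have g1: "1 \<le> g" using g2 by simp
  define b' where "b' = b(k := c)"
  define Q where "Q = real (base_prod M (Suc k))"
  have Q: "0 < Q" using base_prod_pos[OF d, of "Suc k"] by (simp add: Q_def)
  have d': "digit_seq M b'" and factor: "\<And>x. ft M b x = dmask g (real c * (x / Q)) * ft M b' x"
    unfolding b'_def Q_def using ft_factor[OF d c g1 c1] by blast+
  \<comment> \<open>Digit sets are counted from 1 and levels from 0.\<close>
  define D where "D k = (\<lambda>e. real e / real (base_prod M k)) ` {..<b' (k - 1)}" for k
  have DS: "D (Suc j) = (\<lambda>e. real e / real (base_prod M (Suc j))) ` {..<b' j}" for j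
    by (simp add: D_def)
  define \<rho> where "\<rho> = inf_conv D"
  interpret \<mu>: real_distribution \<mu> by fact
  interpret \<rho>: real_distribution \<rho>
    unfolding \<rho>_def by (rule real_distribution_inf_conv[OF d' DS])
  have char\<rho>: "char \<rho> (2 * pi * x) = ft M b' x" for x
    unfolding \<rho>_def by (rule char_inf_conv[OF d' DS])
  define \<Lambda>t where "\<Lambda>t = (\<lambda>l. real t * l) ` \<Lambda>"
  have ortho: "\<rho>.orthogonal_freqs \<Lambda>t"
    unfolding \<rho>.orthogonal_freqs_def
  proof (intro ballI impI)
    fix x y assume xy: "x \<in> \<Lambda>t" "y \<in> \<Lambda>t" "x \<noteq> y"
    then obtain l l' where l: "l \<in> \<Lambda>" "l' \<in> \<Lambda>" "x = real t * l" "y = real t * l'"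
      unfolding \<Lambda>t_def by blast
    then have "l \<noteq> l'" using xy(3) by auto
    then have "ft M b (l - l') = 0"
      using \<mu>.is_spectrum_orthogonal[OF spec(1)] l(1,2) unfolding \<mu>.orthogonal_freqs_def \<mu>(2) by blast
    then obtain u where u: "u \<in> zero_set M b" "l - l' = of_int u"
      unfolding ft_eq_0_iff[OF d] by blast
    then obtain j e where e: "u = int (base_prod M j * ratio M b j) * e" "\<not> int (b j) dvd e"
      unfolding zero_set_def by blast
    have xy_eq: "x - y = of_int (int t * u)" unfolding l using u(2) by (simp flip: right_diff_distrib)
    have "ft M b' (x - y) = 0"
    proof (cases "j < k")
      case True
      have "coprime (int (b j)) (int t)" using before[OF True] by (simp add: coprime_commute)
      then have "\<not> int (b' j) dvd int t * e"
        using e(2) True unfolding b'_def by (simp add: coprime_dvd_mult_right_iff)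
      moreover have "int t * u = int (base_prod M j * ratio M b' j) * (int t * e)"
        using True by (simp add: e(1) b'_def ratio_def)
      ultimately have "int t * u \<in> zero_set M b'" unfolding zero_set_def by blast
      then show ?thesis unfolding ft_eq_0_iff[OF d'] xy_eq by blast
    next
      \<comment> \<open>Here \<open>t * u\<close> is a multiple of
        \<open>g * base_prod M k * ratio M b k\<close>, where the split-off mask equals 1. So the
        zero that the orthogonality of \<open>\<Lambda>t\<close> provides must come from the
        remaining factor.\<close>
      case False
      have "base_prod M k * ratio M b k dvd base_prod M j * ratio M b j"
      proof (cases "j = k")
        case False
        then have "base_prod M (Suc k) dvd base_prod M j" using \<open>\<not> j < k\<close> by (intro base_prod_dvd) simp
        moreover have "base_prod M k * ratio M b k dvd base_prod M (Suc k)"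
          using digit_seqD(4)[OF d, of k] by (metis base_prod_Suc dvd_triv_right mult_dvd_mono dvd_refl)
        ultimately show ?thesis by (meson dvd_mult2 dvd_trans)
      qed simp
      then obtain q where q: "base_prod M j * ratio M b j = base_prod M k * ratio M b k * q" ..
      have Qeq: "Q = real (base_prod M k * ratio M b k) * (real g * real c)"
        unfolding Q_def using digit_seqD(4)[OF d, of k] c by simp
      have nz: "real (base_prod M k * ratio M b k) \<noteq> 0" "real g \<noteq> 0" "real c \<noteq> 0"
        using base_prod_pos[OF d, of k] digit_seqD(5)[OF d, of k] g1 c1 by auto
      have "x - y = real (base_prod M k * ratio M b k) * (real g * of_int (int t' * int q * e))"
        unfolding xy_eq e(1) q t' by (simp add: mult_ac)
      then have "real c * ((x - y) / Q) = of_int (int t' * int q * e)"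
        unfolding Qeq using nz by (simp del: of_nat_mult of_int_mult)
      then have "dmask g (real c * ((x - y) / Q)) = 1"
        using g1 by (simp only: dmask_int[OF Ints_of_int])
      moreover have "ft M b (x - y) = 0"
        using \<mu>.is_spectrum_orthogonal[OF spec(2)] xy
        unfolding \<mu>.orthogonal_freqs_def \<mu>(2) \<Lambda>t_def by blast
      ultimately show ?thesis using factor[of "x - y"] by simp
    qed
    then show "char \<rho> (2 * pi * (x - y)) = 0" by (simp add: char\<rho>)
  qed
  obtain A0 where "A0 \<subseteq> \<Lambda>t" "0 < (\<Sum>l\<in>A0. (cmod (char \<mu> (2 * pi * (l - 0))))\<^sup>2)"
    using \<mu>.is_spectrum_parseval[OF spec(2), of 1 0] unfolding \<Lambda>t_def by auto
  then have "\<Lambda>t \<noteq> {}" by auto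
  then obtain x0 where x0: "x0 \<in> \<Lambda>t" by blast
  \<comment> \<open>At distance 1/4 from \<open>x0\<close> the argument of the split-off mask times
    \<open>g\<close> lies strictly between -1 and 0, so its modulus is less than 1, while the
    remaining factor does not vanish.\<close>
  define \<xi> where "\<xi> = x0 + 1 / 4"
  define q where "q = cmod (dmask g (real c * ((x0 - \<xi>) / Q)))"
  have q1: "q < 1"
    unfolding q_def
  proof (rule cmod_dmask_less_1[OF g2])
    have "b k \<le> base_prod M (Suc k)"
      using digit_seqD(1,3)[OF d, of k] base_prod_pos[OF d, of k]
      by (auto intro!: dvd_imp_le simp: base_prod_pos[OF d])
    then have le: "real g * real c \<le> Q" unfolding Q_def using c by (metis of_nat_le_iff of_nat_mult)
    define h where "h = real g * real c / Q"
    have eq: "real g * (real c * ((x0 - \<xi>) / Q)) = - (h / 4)"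
      by (simp add: \<xi>_def h_def)
    have h: "0 < h" "h \<le> 1"
      unfolding h_def using le Q g1 c1 by auto
    show "real g * (real c * ((x0 - \<xi>) / Q)) \<notin> \<int>"
      unfolding eq
    proof
      assume "- (h / 4) \<in> \<int>"
      then obtain z :: int where "- (h / 4) = of_int z" by (rule Ints_cases)
      then have "- 1 < real_of_int z" "real_of_int z < 0" using h by linarith+
      then show False by simp
    qed
  qed
  have q0: "0 \<le> q" by (simp add: q_def)
  \<comment> \<open>The gain at \<open>x0\<close> when the transform of \<open>\<mu>\<close> is
    replaced by that of \<open>\<rho>\<close>. It breaks Bessel's inequality for
    \<open>\<rho>\<close> once the Parseval sum for \<open>\<mu>\<close> exceeds
    \<open>1 - \<kappa>\<close>.\<close>
  define \<kappa> where "\<kappa> = (1 - q\<^sup>2) * (cmod (ft M b' (x0 - \<xi>)))\<^sup>2"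
  have "ft M b' (x0 - \<xi>) \<noteq> 0"
  proof -
    obtain c0 where c0: "0 < c0" "\<forall>M b f. digit_seq M b \<longrightarrow> \<bar>f\<bar> \<le> 3 / 4 \<longrightarrow> c0 \<le> cmod (ft M b f)"
      using ft_near_0 by blast
    have "c0 \<le> cmod (ft M b' (x0 - \<xi>))"
      by (rule c0(2)[rule_format, OF d']) (simp add: \<xi>_def)
    then show ?thesis using c0(1) by auto
  qed
  moreover have "q\<^sup>2 < 1" using q0 q1 by (simp add: power_less_one_iff abs_square_less_1)
  ultimately have \<kappa>: "0 < \<kappa>" unfolding \<kappa>_def by simp
  obtain A where A: "finite A" "A \<subseteq> \<Lambda>t" "1 - \<kappa> < (\<Sum>l\<in>A. (cmod (ft M b (l - \<xi>)))\<^sup>2)"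
    using \<mu>.is_spectrum_parseval[OF spec(2) \<kappa>, of \<xi>] unfolding \<Lambda>t_def \<mu>(2) by blast
  \<comment> \<open>The finite set from Parseval need not contain \<open>x0\<close>, where the gain
    occurs.\<close>
  let ?A = "insert x0 A"
  have "(\<Sum>l\<in>?A. (cmod (ft M b (l - \<xi>)))\<^sup>2) + \<kappa>
      \<le> (\<Sum>l\<in>?A. (cmod (ft M b' (l - \<xi>)))\<^sup>2)"
  proof -
    have le: "(cmod (ft M b y))\<^sup>2 \<le> (cmod (ft M b' y))\<^sup>2" for y
      unfolding factor[of y] norm_mult power_mult_distrib
      by (intro mult_left_le_one_le) (auto simp: power_le_one cmod_dmask_le_1)
    have "(cmod (ft M b (x0 - \<xi>)))\<^sup>2 + \<kappa> = (cmod (ft M b' (x0 - \<xi>)))\<^sup>2"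
      unfolding factor[of "x0 - \<xi>"] norm_mult power_mult_distrib \<kappa>_def q_def
      by (simp add: algebra_simps)
    moreover have "(\<Sum>l\<in>A - {x0}. (cmod (ft M b (l - \<xi>)))\<^sup>2) \<le> (\<Sum>l\<in>A - {x0}. (cmod (ft M b' (l - \<xi>)))\<^sup>2)"
      by (intro sum_mono le)
    ultimately show ?thesis using A(1) by (simp add: sum.insert_remove)
  qed
  also have "\<dots> \<le> 1"
    using \<rho>.bessel[of ?A \<xi>] A x0 ortho unfolding char\<rho> \<rho>.orthogonal_freqs_def by auto
  finally have "(\<Sum>l\<in>?A. (cmod (ft M b (l - \<xi>)))\<^sup>2) \<le> 1 - \<kappa>" by simp
  moreover have "(\<Sum>l\<in>A. (cmod (ft M b (l - \<xi>)))\<^sup>2) \<le> (\<Sum>l\<in>?A. (cmod (ft M b (l - \<xi>)))\<^sup>2)"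
    using A(1) by (intro sum_mono2) auto
  ultimately show False using A(3) by linarith
qed

lemma (in digit_system) is_spectrum_spectrum_of:
  assumes \<mu>: "real_distribution \<mu>" "\<And>x. char \<mu> (2 * pi * x) = ft M b x" and t: "t \<in> multipliers"
  shows "is_spectrum \<mu> ((\<lambda>l. real t * l) ` real_of_int ` spectrum_of \<alpha>)"
proof -
  interpret \<mu>: real_distribution \<mu> by fact
  let ?h = "\<lambda>a. real t * real_of_int a"
  have "0 < t" using t by (simp add: multipliers_def)
  then have inj: "inj_on ?h A" for A by (auto intro: inj_onI)
  show ?thesis
    unfolding image_image
  proof (rule \<mu>.is_spectrumI)
    show "countable (?h ` spectrum_of \<alpha>)" by simp
    show "\<mu>.orthogonal_freqs (?h ` spectrum_of \<alpha>)"
      unfolding \<mu>.orthogonal_freqs_def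
    proof (intro ballI impI)
      fix x y assume "x \<in> ?h ` spectrum_of \<alpha>" "y \<in> ?h ` spectrum_of \<alpha>" "x \<noteq> y"
      then obtain a a' where a: "a \<in> spectrum_of \<alpha>" "a' \<in> spectrum_of \<alpha>" "a \<noteq> a'" "x = ?h a" "y = ?h a'" by blast
      have "int t * (a - a') \<in> zero_set M b"
        using spectrum_of_diff[OF a(1-3)] t by (intro zero_set_mult_coprime) (auto simp: multipliers_def)
      moreover have "x - y = of_int (int t * (a - a'))" by (simp add: a algebra_simps)
      ultimately show "char \<mu> (2 * pi * (x - y)) = 0"
        unfolding \<mu>(2) ft_eq_0_iff[OF digit_seq] by blast
    qed
    fix \<xi> \<eta> :: real assume "0 < \<eta>"
    then have "eventually (\<lambda>j. 1 - \<eta> < mass t (- \<xi>) (snd (stage \<alpha> j))) sequentially"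
      by (intro order_tendstoD(1)[OF mass_stage_tendsto[OF t]]) simp
    then obtain j where j: "1 - \<eta> < mass t (- \<xi>) (snd (stage \<alpha> j))"
      by (auto simp: eventually_sequentially)
    have "mass t (- \<xi>) (snd (stage \<alpha> j)) = (\<Sum>l\<in>?h ` snd (stage \<alpha> j). (cmod (char \<mu> (2 * pi * (l - \<xi>))))\<^sup>2)"
      unfolding mass_def \<mu>(2) by (subst sum.reindex[OF inj]) (simp add: algebra_simps)
    moreover have "finite (snd (stage \<alpha> j))" using good_stage[of \<alpha> j] by (simp add: good_def)
    moreover have "snd (stage \<alpha> j) \<subseteq> spectrum_of \<alpha>" by (auto simp: spectrum_of_def)
    ultimately show "\<exists>A. finite A \<and> A \<subseteq> ?h ` spectrum_of \<alpha> \<and>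
        1 - \<eta> < (\<Sum>l\<in>A. (cmod (char \<mu> (2 * pi * (l - \<xi>))))\<^sup>2)"
      using j by (intro exI[of _ "?h ` snd (stage \<alpha> j)"]) auto
  qed
qed

lemma uncountable_bool_seqs: "uncountable (UNIV :: (nat \<Rightarrow> bool) set)"
proof
  assume "countable (UNIV :: (nat \<Rightarrow> bool) set)"
  then obtain f :: "nat \<Rightarrow> nat \<Rightarrow> bool" where "range f = UNIV"
    using uncountable_def by blast
  then obtain n where "(\<lambda>i. \<not> f i i) = f n" by blast
  from fun_cong[OF this, of n] show False by simp
qed

section \<open>The uniform measure, admissible pairs and the reduction to digit sequences\<close>

definition unit_uniform :: "real measure" where
  "unit_uniform = density lborel (\<lambda>x. ennreal (indicator {0..1} x))"

lemma emeasure_unit_uniform: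
  assumes "A \<in> sets borel"
  shows "emeasure unit_uniform A = emeasure lborel ({0..1} \<inter> A)"
proof -
  have "emeasure unit_uniform A = (\<integral>\<^sup>+x. ennreal (indicator {0..1} x) * indicator A x \<partial>lborel)"
    unfolding unit_uniform_def using assms by (intro emeasure_density) auto
  also have "\<dots> = (\<integral>\<^sup>+x. indicator ({0..1} \<inter> A) x \<partial>lborel)"
    by (intro nn_integral_cong) (auto simp: indicator_def)
  also have "\<dots> = emeasure lborel ({0..1} \<inter> A)"
    using assms by (intro nn_integral_indicator) auto
  finally show ?thesis .
qed

lemma real_distribution_unit_uniform: "real_distribution unit_uniform"
proof -
  have "space unit_uniform = UNIV" by (simp add: unit_uniform_def)
  then have "prob_space unit_uniform"
    using emeasure_unit_uniform[of UNIV] by (intro prob_spaceI) simp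
  then show ?thesis
    by (simp add: real_distribution_def real_distribution_axioms_def unit_uniform_def)
qed

lemma char_unit_uniform:
  assumes "t \<noteq> 0"
  shows "char unit_uniform t = (cis t - 1) / (\<i> * of_real t)"
proof -
  let ?F = "\<lambda>x. cis (t * x) / (\<i> * of_real t)"
  have "char unit_uniform t = (\<integral>x. indicator {0..1} x *\<^sub>R cis (t * x) \<partial>lborel)"
    unfolding char_def unit_uniform_def
    by (subst integral_density) (auto simp: cis_conv_exp)
  also have "\<dots> = ?F 1 - ?F 0"
  proof (rule integral_FTC_Icc)
    show "(?F has_vector_derivative cis (t * x)) (at x within {0..1})" for x
      using assms by (auto intro!: derivative_eq_intros has_vector_derivative_real_field simp: cis_conv_exp mult_ac)
    show "continuous_on {0..1} (\<lambda>x. cis (t * x))" by (intro continuous_intros)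
  qed simp
  finally show ?thesis by (simp add: diff_divide_distrib)
qed

text \<open>The uniform measure on \<open>{0..1}\<close> is self-similar: it is the uniform measure
  on \<open>{0..<m} / m\<close> convolved with its own copy scaled by \<open>1 / m\<close>.
  Iterating over the bases leaves a factor that tends to 1.\<close>

lemma ft_eq_char_unit_uniform:
  assumes d: "digit_seq M M"
  shows "ft M M x = char unit_uniform (2 * pi * x)"
proof -
  interpret U: real_distribution unit_uniform by (rule real_distribution_unit_uniform)
  have step: "char unit_uniform (2 * pi * x) = dmask m (x / real m) * char unit_uniform (2 * pi * (x / real m))"
    if "1 \<le> m" for m x
  proof (cases "x = 0")
    case False
    then show ?thesis
      using dmask_geometric[of m "x / real m"] that
      by (simp add: char_unit_uniform field_simps)
  qed (use that in \<open>simp add: U.char_zero dmask_int\<close>)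
  have eq: "char unit_uniform (2 * pi * x)
      = ft_fin M M k x * char unit_uniform (2 * pi * (x / real (base_prod M k)))" for k
  proof (induction k)
    case (Suc k)
    have "1 \<le> M k" using digit_seqD(1)[OF d, of k] by simp
    from step[OF this, of "x / real (base_prod M k)"] Suc show ?case
      by (simp add: ft_fin_Suc)
  qed simp
  have "(\<lambda>k. x / real (base_prod M k)) \<longlonglongrightarrow> 0"
  proof (rule Lim_null_comparison)
    show "eventually (\<lambda>k. norm (x / real (base_prod M k)) \<le> \<bar>x\<bar> / 2 ^ k) sequentially"
      using abs_div_base_prod[OF d, of x] by (intro always_eventually allI) (simp only: real_norm_def)
    show "(\<lambda>k. \<bar>x\<bar> / 2 ^ k) \<longlonglongrightarrow> 0" by (intro LIMSEQ_divide_realpow_zero) auto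
  qed
  then have "(\<lambda>k. 2 * pi * (x / real (base_prod M k))) \<longlonglongrightarrow> 2 * pi * 0" by (intro tendsto_intros)
  then have "(\<lambda>k. char unit_uniform (2 * pi * (x / real (base_prod M k)))) \<longlonglongrightarrow> char unit_uniform (2 * pi * 0)"
    by (rule isCont_tendsto_compose[OF U.isCont_char])
  then have "(\<lambda>k. ft_fin M M k x * char unit_uniform (2 * pi * (x / real (base_prod M k)))) \<longlonglongrightarrow> ft M M x * 1"
    using ft_fin_tendsto[OF d, of x] by (intro tendsto_mult) (simp_all add: U.char_zero)
  then have "(\<lambda>k. char unit_uniform (2 * pi * x)) \<longlonglongrightarrow> ft M M x" by (simp only: eq[symmetric] mult_1_right)
  then show ?thesis by (simp add: LIMSEQ_const_iff)
qed

lemma unit_uniform_not_singular: "\<not> singular_to unit_uniform lborel"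
proof
  assume "singular_to unit_uniform lborel"
  then obtain A where A: "A \<in> sets borel" "emeasure unit_uniform A = 0" "emeasure lborel (UNIV - A) = 0"
    unfolding singular_to_def by blast
  have "1 = emeasure lborel {0..1 :: real}" by simp
  also have "\<dots> \<le> emeasure lborel (({0..1} \<inter> A) \<union> (UNIV - A))"
    using A(1) by (intro emeasure_mono) auto
  also have "\<dots> \<le> emeasure lborel ({0..1} \<inter> A) + emeasure lborel (UNIV - A)"
    using A(1) by (intro emeasure_subadditive) auto
  also have "\<dots> = 0" using A emeasure_unit_uniform[OF A(1)] by simp
  finally show False by simp
qed

text \<open>\<open>L\<close> has \<open>b\<close> elements, and orthogonal columns mean
  \<open>N dvd b * (l - l')\<close> but not \<open>N dvd l - l'\<close>. With
  \<open>g = gcd N b\<close> and \<open>N = N1 * g\<close>, the elements of \<open>L\<close> are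
  congruent modulo \<open>N1\<close> and fall into distinct classes modulo \<open>N1 * g\<close>.
  Hence \<open>b \<le> g\<close>, so \<open>g = b\<close>.\<close>

lemma admissible_imp_dvd:
  assumes "admissible_pair N {0..int b - 1}"
  shows "2 \<le> N" "2 \<le> b" "b dvd nat N"
proof -
  define E where "E i l = of_real (1 / sqrt (real b)) * cis (- 2 * pi * real_of_int i * real_of_int l / real_of_int N)"
    for i l :: int
  have cardB: "card {0..int b - 1} = b" by simp
  obtain L where N: "2 \<le> N" "2 \<le> b" and U: "unitary_matrix_on {0..int b - 1} L E"
    using assms unfolding admissible_pair_def cardB E_def by auto
  show "2 \<le> N" "2 \<le> b" by fact+
  have sq: "complex_of_real (1 / sqrt (real b)) * complex_of_real (1 / sqrt (real b)) = 1 / of_nat b"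
    using N(2) by (simp flip: of_real_mult)
  have fin: "finite L" using U unfolding unitary_matrix_on_def by blast
  \<comment> \<open>The row of digit 0 has norm 1 and consists of entries of squared modulus
    \<open>1 / b\<close>.\<close>
  have cardL: "card L = b"
  proof -
    have "(\<Sum>l\<in>L. E 0 l * cnj (E 0 l)) = 1"
      using U N(2) unfolding unitary_matrix_on_def by simp
    then have "of_nat (card L) / of_nat b = (1 :: complex)" using sq by (simp add: E_def)
    then have "of_nat (card L) = (of_nat b :: complex)" using N(2) by (simp add: divide_eq_eq)
    then show ?thesis by (simp only: of_nat_eq_iff)
  qed
  have diff: "N dvd int b * (l - l')" "\<not> N dvd l - l'" if "l \<in> L" "l' \<in> L" "l \<noteq> l'" for l l'
  proof -
    have "0 = (\<Sum>i\<in>{0..int b - 1}. cnj (E i l) * E i l')"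
      using U that unfolding unitary_matrix_on_def by simp
    also have "\<dots> = (\<Sum>d<b. cnj (E (int d) l) * E (int d) l')"
    proof -
      have "{0..int b - 1} = int ` {..<b}"
        by (auto simp: image_iff intro!: bexI[of _ "nat _"])
      then show ?thesis by (simp add: sum.reindex)
    qed
    also have "\<dots> = (\<Sum>d<b. cis (2 * pi * real d * (of_int (l - l') / of_int N)) / of_nat b)"
    proof (rule sum.cong[OF refl])
      fix d
      have "cnj (E (int d) l) * E (int d) l'
          = (complex_of_real (1 / sqrt (real b)) * complex_of_real (1 / sqrt (real b)))
            * (cis (2 * pi * real d * of_int l / of_int N) * cis (- (2 * pi * real d * of_int l' / of_int N)))"
        by (simp add: E_def cis_cnj mult_ac)
      also have "\<dots> = cis (2 * pi * real d * (of_int (l - l') / of_int N)) / of_nat b"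
        unfolding sq cis_mult by (simp add: algebra_simps diff_divide_distrib)
      finally show "cnj (E (int d) l) * E (int d) l' = cis (2 * pi * real d * (of_int (l - l') / of_int N)) / of_nat b" .
    qed
    also have "\<dots> = dmask b (of_int (l - l') / of_int N)"
      by (simp add: dmask_def sum_divide_distrib)
    finally have "real b * (of_int (l - l') / of_int N) \<in> \<int>" "of_int (l - l') / of_int N \<notin> (\<int> :: real set)"
      using dmask_eq_0_iff[of b "of_int (l - l') / of_int N"] N(2) by auto
    moreover have "real b * (of_int (l - l') / of_int N) = of_int (int b * (l - l')) / of_int N" by simp
    ultimately have I: "of_int (int b * (l - l')) / of_int N \<in> (\<int> :: real set)"
      "of_int (l - l') / of_int N \<notin> (\<int> :: real set)" by simp_all
    have dvd_iff: "of_int x / of_int N \<in> (\<int> :: real set) \<longleftrightarrow> N dvd x" for x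
    proof
      assume "of_int x / of_int N \<in> (\<int> :: real set)"
      then obtain e :: int where "of_int x / of_int N = (of_int e :: real)" by (auto elim: Ints_cases)
      then have "of_int x = (of_int (e * N) :: real)" using N(1) by (simp add: field_simps)
      then have "x = e * N" by (simp only: of_int_eq_iff)
      then show "N dvd x" by simp
    qed (use N(1) in \<open>auto elim!: dvdE\<close>)
    show "N dvd int b * (l - l')" "\<not> N dvd l - l'" using I unfolding dvd_iff by auto
  qed
  define g where "g = gcd N (int b)"
  have g: "0 < g" using N by (simp add: g_def)
  obtain N1 b1 where N1: "N = N1 * g" and b1: "int b = b1 * g" and cop: "coprime N1 b1"
    using gcd_coprime_exists[of N "int b"] g unfolding g_def by auto
  have N1d: "N1 dvd l - l'" if "l \<in> L" "l' \<in> L" for l l'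
  proof (cases "l = l'")
    case False
    then have "N1 * g dvd (b1 * (l - l')) * g" using diff(1)[OF that] by (simp add: N1 b1 mult_ac)
    then have "N1 dvd b1 * (l - l')" using g by simp
    then show ?thesis using cop by (simp add: coprime_dvd_mult_right_iff)
  qed simp
  have "L \<noteq> {}" using cardL N(2) by auto
  then obtain l0 where l0: "l0 \<in> L" by blast
  have "inj_on (\<lambda>l. ((l - l0) div N1) mod g) L"
  proof (rule inj_onI, rule ccontr)
    fix l l' assume l: "l \<in> L" "l' \<in> L" "((l - l0) div N1) mod g = ((l' - l0) div N1) mod g" "l \<noteq> l'"
    have "g dvd (l - l0) div N1 - (l' - l0) div N1" using l(3) by (simp add: mod_eq_dvd_iff)
    then have "N1 * g dvd N1 * ((l - l0) div N1 - (l' - l0) div N1)" by simp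
    also have "N1 * ((l - l0) div N1 - (l' - l0) div N1) = l - l'"
      using N1d[OF l(1) l0] N1d[OF l(2) l0] by (simp add: right_diff_distrib)
    finally show False using diff(2)[OF l(1,2,4)] N1 by simp
  qed
  moreover have "(\<lambda>l. ((l - l0) div N1) mod g) ` L \<subseteq> {0..<g}" using g by auto
  ultimately have "card L \<le> card {0..<g}" by (intro card_inj_on_le) auto
  then have "int b \<le> g" using cardL g by simp
  moreover have "g \<le> int b" unfolding g_def using N(2) by (intro zdvd_imp_le) auto
  ultimately have "g = int b" by simp
  then have "int b dvd N" unfolding g_def by (metis gcd_dvd1)
  then have "int b dvd int (nat N)" using N(1) by simp
  then show "b dvd nat N" by (simp only: int_dvd_int_iff)
qed

lemma digit_set_Suc:
  assumes "\<And>i. 1 \<le> i \<Longrightarrow> 0 \<le> N (\<omega> i)" "B (\<omega> (Suc k)) = {0..int (b (\<omega> (Suc k))) - 1}"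
  shows "digit_set N B n \<omega> (Suc k) =
    (\<lambda>d. real d / real (base_prod (\<lambda>i. nat (N (\<omega> (Suc i))) ^ n (Suc i)) (Suc k))) ` {..<b (\<omega> (Suc k))}"
proof -
  have "(\<Prod>i=1..Suc k. inverse (real_of_int (N (\<omega> i)) ^ n i))
      = (\<Prod>i<Suc k. inverse (real_of_int (N (\<omega> (Suc i))) ^ n (Suc i)))"
    by (simp only: One_nat_def prod.atLeast1_atMost_eq)
  also have "\<dots> = inverse (\<Prod>i<Suc k. real_of_int (N (\<omega> (Suc i))) ^ n (Suc i))"
    using prod_inversef[of "\<lambda>i. real_of_int (N (\<omega> (Suc i))) ^ n (Suc i)" "{..<Suc k}"]
    by (simp only: comp_def)
  also have "(\<Prod>i<Suc k. real_of_int (N (\<omega> (Suc i))) ^ n (Suc i))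
      = real (base_prod (\<lambda>i. nat (N (\<omega> (Suc i))) ^ n (Suc i)) (Suc k))"
    unfolding base_prod_def of_nat_prod
    using assms(1) by (intro prod.cong refl) simp
  finally have P: "(\<Prod>i=1..Suc k. inverse (real_of_int (N (\<omega> i)) ^ n i))
      = inverse (real (base_prod (\<lambda>i. nat (N (\<omega> (Suc i))) ^ n (Suc i)) (Suc k)))" .
  have "{0..int (b (\<omega> (Suc k))) - 1} = int ` {..<b (\<omega> (Suc k))}"
    by (auto simp: image_iff intro!: bexI[of _ "nat _"])
  then show ?thesis
    unfolding digit_set_def P assms(2) by (simp add: image_image divide_inverse mult.commute del: base_prod_Suc)
qed

text \<open>Otherwise \<open>ft_eq_char_unit_uniform\<close> determines the transforms of all late
  tails, hence that of their weak limit, which would be the uniform measure. Only exponents 1 occur,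
  as in the definition of non-degeneracy.\<close>

lemma non_degenerate_imp_ratio_ge_2:
  assumes Npos: "\<And>i. 1 \<le> i \<Longrightarrow> 0 \<le> N (\<omega> i)"
    and B: "\<And>i. 1 \<le> i \<Longrightarrow> B (\<omega> i) = {0..int (b (\<omega> i)) - 1}"
    and d: "digit_seq (\<lambda>i. nat (N (\<omega> (Suc i)))) (\<lambda>i. b (\<omega> (Suc i)))"
    and nondeg: "non_degenerate N B \<omega>"
  shows "\<exists>i\<ge>k. 2 \<le> ratio (\<lambda>i. nat (N (\<omega> (Suc i)))) (\<lambda>i. b (\<omega> (Suc i))) i"
proof (rule ccontr)
  let ?M = "\<lambda>i. nat (N (\<omega> (Suc i)))" and ?b = "\<lambda>i. b (\<omega> (Suc i))"
  assume "\<not> ?thesis"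
  then have one: "?M i = ?b i" if "k \<le> i" for i
    using digit_seqD(4,5)[OF d, of i] that by (cases "ratio ?M ?b i = 1") force+
  interpret U: real_distribution unit_uniform by (rule real_distribution_unit_uniform)
  have tail: "real_distribution (nu_tail N B \<omega> j)" "k \<le> j \<Longrightarrow> char (nu_tail N B \<omega> j) t = char unit_uniform t"
    for j t
  proof -
    have dj: "digit_seq (tail j ?M) (tail j ?b)" by (rule digit_seq_tail[OF d])
    have D: "digit_set N B (\<lambda>_. 1) (\<lambda>i. \<omega> (j + i)) (Suc i)
        = (\<lambda>e. real e / real (base_prod (tail j ?M) (Suc i))) ` {..<tail j ?b i}" for i
      using digit_set_Suc[of N "\<lambda>i. \<omega> (j + i)" B i b "\<lambda>_. 1"] Npos B
      by (simp add: tail_def del: base_prod_Suc)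
    show "real_distribution (nu_tail N B \<omega> j)"
      unfolding nu_tail_def mu_def mu_n_def by (rule real_distribution_inf_conv[OF dj D])
    assume "k \<le> j"
    then have "tail j ?b = tail j ?M" using one by (auto simp: tail_def)
    then have "char (nu_tail N B \<omega> j) (2 * pi * (t / (2 * pi))) = char unit_uniform (2 * pi * (t / (2 * pi)))"
      unfolding nu_tail_def mu_def mu_n_def char_inf_conv[OF dj D]
      using dj by (simp only: ft_eq_char_unit_uniform)
    then show "char (nu_tail N B \<omega> j) t = char unit_uniform t" by simp
  qed
  obtain \<kappa> \<nu> where \<kappa>: "strict_mono \<kappa>" and \<nu>: "real_distribution \<nu>"
    and conv: "weak_conv_m (\<lambda>j. nu_tail N B \<omega> (\<kappa> j)) \<nu>" and sing: "singular_to \<nu> lborel"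
    using nondeg unfolding non_degenerate_def by blast
  have "char \<nu> t = char unit_uniform t" for t
  proof (rule LIMSEQ_unique)
    show "(\<lambda>j. char (nu_tail N B \<omega> (\<kappa> j)) t) \<longlonglongrightarrow> char \<nu> t"
      by (rule levy_continuity1[OF _ \<nu> conv]) (rule tail(1))
    have "eventually (\<lambda>j. char (nu_tail N B \<omega> (\<kappa> j)) t = char unit_uniform t) sequentially"
      unfolding eventually_sequentially
      using tail(2) strict_mono_imp_increasing[OF \<kappa>] by (meson order_trans)
    then show "(\<lambda>j. char (nu_tail N B \<omega> (\<kappa> j)) t) \<longlonglongrightarrow> char unit_uniform t"
      by (rule tendsto_eventually)
  qed
  then have "\<nu> = unit_uniform"
    by (intro Levy_uniqueness \<nu> real_distribution_unit_uniform ext)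
  then show False using sing unit_uniform_not_singular by simp
qed

theorem theorem1p3:
  fixes m :: nat and N :: "nat \<Rightarrow> int" and B :: "nat \<Rightarrow> int set"
    and b :: "nat \<Rightarrow> nat" and n :: "nat \<Rightarrow> nat" and \<omega> :: "nat \<Rightarrow> nat"
  assumes adm: "\<And>k. k \<in> {1..m} \<Longrightarrow> admissible_pair (N k) (B k)"
    and n_pos: "\<And>k. 1 \<le> k \<Longrightarrow> 1 \<le> n k"
    and b_pos: "\<And>k. k \<in> {1..m} \<Longrightarrow> 1 \<le> b k"
    and digits: "\<And>k. k \<in> {1..m} \<Longrightarrow> B k = {0..int (b k) - 1}"
    and omega: "\<omega> \<in> Omega m"
    and nondeg: "non_degenerate N B \<omega>"
  shows "spectral_measure (mu_n N B n \<omega>)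
    \<and> E_set b \<omega> = {t::nat. 1 \<le> t \<and> spectral_eigenvalue (mu_n N B n \<omega>) (real t)}
    \<and> uncountable {\<Lambda> :: real set. \<Lambda> \<subseteq> \<int> \<and>
         (\<forall>t\<in>E_set b \<omega>. is_spectrum (mu_n N B n \<omega>) ((\<lambda>l. real t * l) ` \<Lambda>))}"
proof -
  have \<omega>: "\<omega> i \<in> {1..m}" if "1 \<le> i" for i using omega that by (simp add: Omega_def)
  have B: "B (\<omega> i) = {0..int (b (\<omega> i)) - 1}" if "1 \<le> i" for i using digits[OF \<omega>[OF that]] .
  have NB: "2 \<le> N (\<omega> i)" "2 \<le> b (\<omega> i)" "b (\<omega> i) dvd nat (N (\<omega> i))" if "1 \<le> i" for i
    using admissible_imp_dvd[of "N (\<omega> i)" "b (\<omega> i)"] adm[OF \<omega>[OF that]] B[OF that] by simp_all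
  have Npos: "0 \<le> N (\<omega> i)" if "1 \<le> i" for i using NB(1)[OF that] by simp
  \<comment> \<open>\<open>M1\<close> are the bases of \<open>mu\<close>, \<open>M\<close> those of
    \<open>mu_n\<close>, with levels counted from 0.\<close>
  define M1 where "M1 i = nat (N (\<omega> (Suc i)))" for i
  define M where "M i = nat (N (\<omega> (Suc i))) ^ n (Suc i)" for i
  define b' where "b' i = b (\<omega> (Suc i))" for i
  have d1: "digit_seq M1 b'"
    unfolding digit_seq_def M1_def b'_def
  proof (intro allI conjI)
    fix i
    show "2 \<le> nat (N (\<omega> (Suc i)))" "1 \<le> b (\<omega> (Suc i))" "b (\<omega> (Suc i)) dvd nat (N (\<omega> (Suc i)))"
      using NB[of "Suc i"] by simp_all
  qed
  have M1M: "M1 i dvd M i" for i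
    unfolding M_def M1_def using n_pos[of "Suc i"] by (intro dvd_power) simp
  have M1_le: "M1 i \<le> M i" for i
    unfolding M_def M1_def using n_pos[of "Suc i"] NB(1)[of "Suc i"] by (intro self_le_power) auto
  have d: "digit_seq M b'"
    unfolding digit_seq_def
    using digit_seqD(1,2,3)[OF d1] M1M M1_le by (meson dvd_trans order_trans)
  have ratio: "\<exists>i\<ge>k. 2 \<le> ratio M b' i" for k
  proof -
    obtain i where i: "k \<le> i" "2 \<le> ratio M1 b' i"
      using non_degenerate_imp_ratio_ge_2[OF Npos B d1[unfolded M1_def b'_def] nondeg]
      unfolding M1_def b'_def by blast
    \<comment> \<open>Raising a base to a positive power only enlarges its ratio, which transfers
      the conclusion from \<open>mu\<close> to \<open>mu_n\<close>.\<close>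
    moreover have "ratio M1 b' i \<le> ratio M b' i" unfolding ratio_def by (intro div_le_mono M1_le)
    ultimately show ?thesis by (meson order_trans)
  qed
  interpret digit_system M b'
    using d ratio NB(2) by unfold_locales (auto simp: b'_def)
  let ?\<mu> = "mu_n N B n \<omega>"
  have D: "digit_set N B n \<omega> (Suc k) = (\<lambda>e. real e / real (base_prod M (Suc k))) ` {..<b' k}" for k
    unfolding M_def b'_def by (rule digit_set_Suc[where N = N and \<omega> = \<omega> and B = B and b = b]) (use Npos B in auto)
  have \<mu>: "real_distribution ?\<mu>" "\<And>x. char ?\<mu> (2 * pi * x) = ft M b' x"
    unfolding mu_n_def by (rule real_distribution_inf_conv[OF d D], rule char_inf_conv[OF d D])
  have E: "E_set b \<omega> = multipliers"
  proof -
    have "(\<forall>k\<ge>1. gcd t (b (\<omega> k)) = 1) \<longleftrightarrow> (\<forall>i. coprime t (b' i))" for t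
    proof
      assume "\<forall>k\<ge>1. gcd t (b (\<omega> k)) = 1"
      then show "\<forall>i. coprime t (b' i)" by (simp add: b'_def coprime_iff_gcd_eq_1)
    next
      assume R: "\<forall>i. coprime t (b' i)"
      have "gcd t (b (\<omega> k)) = 1" if "1 \<le> k" for k
        using R[rule_format, of "k - 1"] that by (simp add: b'_def coprime_iff_gcd_eq_1)
      then show "\<forall>k\<ge>1. gcd t (b (\<omega> k)) = 1" by blast
    qed
    then show ?thesis by (simp add: E_set_def multipliers_def)
  qed
  have spec: "is_spectrum ?\<mu> ((\<lambda>l. real t * l) ` real_of_int ` spectrum_of \<alpha>)" if "t \<in> E_set b \<omega>" for t \<alpha>
    using is_spectrum_spectrum_of[OF \<mu>] that E by simp
  have spec1: "is_spectrum ?\<mu> (real_of_int ` spectrum_of \<alpha>)" for \<alpha>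
    using spec[of 1 \<alpha>] one_multiplier E by simp
  have "E_set b \<omega> = {t. 1 \<le> t \<and> spectral_eigenvalue ?\<mu> (real t)}"
  proof (intro equalityI subsetI)
    fix t assume t: "t \<in> E_set b \<omega>"
    then have "1 \<le> t" by (simp add: E_set_def)
    moreover from this have "spectral_eigenvalue ?\<mu> (real t)"
      unfolding spectral_eigenvalue_def using spec1[of "\<lambda>_. True"] spec[OF t, of "\<lambda>_. True"]
      by (intro conjI exI[of _ "real_of_int ` spectrum_of (\<lambda>_. True)"]) auto
    ultimately show "t \<in> {t. 1 \<le> t \<and> spectral_eigenvalue ?\<mu> (real t)}" by blast
  next
    fix t assume "t \<in> {t. 1 \<le> t \<and> spectral_eigenvalue ?\<mu> (real t)}"
    then show "t \<in> E_set b \<omega>"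
      using spectral_eigenvalue_imp_coprime[OF \<mu> d]
      unfolding spectral_eigenvalue_def E multipliers_def by blast
  qed
  moreover have "uncountable {\<Lambda>. \<Lambda> \<subseteq> \<int> \<and> (\<forall>t\<in>E_set b \<omega>. is_spectrum ?\<mu> ((\<lambda>l. real t * l) ` \<Lambda>))}"
  proof
    assume "countable {\<Lambda>. \<Lambda> \<subseteq> \<int> \<and> (\<forall>t\<in>E_set b \<omega>. is_spectrum ?\<mu> ((\<lambda>l. real t * l) ` \<Lambda>))}"
    moreover have "range (\<lambda>\<alpha>. real_of_int ` spectrum_of \<alpha>) \<subseteq>
        {\<Lambda>. \<Lambda> \<subseteq> \<int> \<and> (\<forall>t\<in>E_set b \<omega>. is_spectrum ?\<mu> ((\<lambda>l. real t * l) ` \<Lambda>))}"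
    proof (intro subsetI CollectI conjI ballI)
      fix X t assume "X \<in> range (\<lambda>\<alpha>. real_of_int ` spectrum_of \<alpha>)"
      then obtain \<alpha> where X: "X = real_of_int ` spectrum_of \<alpha>" by blast
      show "x \<in> \<int>" if "x \<in> X" for x using that unfolding X by auto
      assume "t \<in> E_set b \<omega>"
      then show "is_spectrum ?\<mu> ((\<lambda>l. real t * l) ` X)" unfolding X by (rule spec)
    qed
    ultimately have "countable (range (\<lambda>\<alpha>. real_of_int ` spectrum_of \<alpha>))" by (rule countable_subset[rotated])
    moreover have "inj (\<lambda>\<alpha>. real_of_int ` spectrum_of \<alpha>)"
    proof (rule injI)
      fix \<alpha> \<alpha>' assume "real_of_int ` spectrum_of \<alpha> = real_of_int ` spectrum_of \<alpha>'"
      moreover have "inj real_of_int" by (rule injI) simp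
      ultimately have "spectrum_of \<alpha> = spectrum_of \<alpha>'" by (simp only: inj_image_eq_iff)
      then show "\<alpha> = \<alpha>'" by (rule injD[OF inj_spectrum_of])
    qed
    ultimately show False using uncountable_bool_seqs by (metis countable_image_inj_on)
  qed
  moreover have "spectral_measure ?\<mu>"
    unfolding spectral_measure_def using \<mu>(1) spec1 by blast
  ultimately show ?thesis by (intro conjI)
qed

end
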